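(* Let $(X_n)_{n\in\mathbb N}$ be a sequence of i.i.d. positive random variables on a probability space $(\Omega,\mathcal F,\mathbb P)$, and let $n_k=\sum_{j=1}^k X_j$. Assume that $X_1$ is bounded and has a bounded density. Let $f:\mathbb R\to\mathbb R$ be a $\mathrm{Lip}(\alpha)$ function satisfying $f(t+1)=f(t)$ for all $t\in\mathbb R$, $\int_0^1 f(t)\,dt=0$ and $\|f\|^2:=\int_0^1 f^2(t)\,dt<\infty$. For $x\in(0,1)$ put $$A_x=\|f\|^2+2\sum_{k=1}^\infty \mathbb E\big[f(U)\,f(U+n_kx)\big],$$ where $U$ is a random variable uniformly distributed on $(0,1)$ and independent of $(X_j)_{j\ge1}$. Then for $\mathbb P$-almost every realization of the sequence $(n_k)_{k\ge1}$ we have $$\limsup_{N\to\infty}\,(2N\log\log N)^{-1/2}\sum_{k=1}^N f(n_kx)=A_x^{1/2}$$ for almost every $x\in(0,1)$ with respect to Lebesgue measure.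
   Context: $\mathrm{Lip}(\alpha)$ means that there are a constant $L$ and an exponent $\alpha\in(0,1]$ with $|f(s)-f(t)|\le L|s-t|^\alpha$ for all $s,t$. The variable $U$ may be obtained by enlarging the probability space; $A_x$ depends only on $f$, $x$ and the distribution of $X_1$. The series defining $A_x$ converges absolutely. *)

theory Defs
  imports "HOL-Probability.Probability"
begin

definition Lip :: "real \<Rightarrow> (real \<Rightarrow> real) \<Rightarrow> bool" where
  "Lip \<alpha> f \<longleftrightarrow> 0 < \<alpha> \<and> \<alpha> \<le> 1 \<and>
     (\<exists>L. \<forall>s t. \<bar>f s - f t\<bar> \<le> L * \<bar>s - t\<bar> powr \<alpha>)"

definition norm2_sq :: "(real \<Rightarrow> real) \<Rightarrow> real" where
  "norm2_sq f = (LINT t:{0..1}|lborel. (f t)\<^sup>2)"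

text \<open>The sequence \<open>X\<close> is used from index 1 on; the value at index 0 is irrelevant.\<close>

definition rand_seq :: "(nat \<Rightarrow> 'a \<Rightarrow> real) \<Rightarrow> nat \<Rightarrow> 'a \<Rightarrow> real" where
  "rand_seq X k \<omega> = (\<Sum>j=1..k. X j \<omega>)"

text \<open>
  The uniform variable \<open>U\<close> independent of the sequence is the first coordinate on the enlarged
  probability space, the product of the uniform distribution on \<open>(0,1)\<close> with \<open>M\<close>; \<open>corr\<close> is the
  expectation of \<open>f U * f (U + n\<^sub>k x)\<close> on that space.
\<close>

definition corr :: "'a measure \<Rightarrow> (nat \<Rightarrow> 'a \<Rightarrow> real) \<Rightarrow> (real \<Rightarrow> real) \<Rightarrow> real \<Rightarrow> nat \<Rightarrow> real" where
  "corr M X f x k =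
     (\<integral>(u, \<omega>). f u * f (u + rand_seq X k \<omega> * x)
        \<partial>(uniform_measure lborel {0<..<1} \<Otimes>\<^sub>M M))"

definition A_const :: "'a measure \<Rightarrow> (nat \<Rightarrow> 'a \<Rightarrow> real) \<Rightarrow> (real \<Rightarrow> real) \<Rightarrow> real \<Rightarrow> real" where
  "A_const M X f x = norm2_sq f + 2 * (\<Sum>k. corr M X f x (Suc k))"

end

theory Submission
  imports Defs "HOL-Real_Asymp.Real_Asymp"
begin

text \<open>
  Fix \<open>x\<close>. Modulo 1 the points \<open>n\<^sub>k x\<close> form a random walk on the circle, with steps distributed like
  \<open>X\<^sub>1 x\<close>. The law of the iterated logarithm is proved for this walk almost surely, for every
  fixed \<open>x\<close>; Fubini's theorem then exchanges the two almost everywhere quantifiers.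

  Since the step has a density, some power of the transition operator \<open>P\<close> dominates a multiple of
  Lebesgue measure on the circle (\<open>doeblin_density\<close>). Hence \<open>P\<^sup>k\<close> contracts functions of mean zero
  geometrically (\<open>geometric_mixing\<close>) and the Poisson equation \<open>u - P u = \<phi>\<close> is solved by the
  bounded function \<open>u = \<Sum>\<^sub>k P\<^sup>k \<phi>\<close> (\<open>poisson_equation\<close>). This also gives the absolute convergence
  of the series \<open>A\<^sub>x\<close>, whose terms are the correlations \<open>\<integral> f P\<^sup>k f\<close>.

  Everything probabilistic comes from one perturbation argument. With
  \<open>\<psi> = 1 + l a + l\<^sup>2 b\<close>, where \<open>a = P (f + a)\<close> and \<open>b + A / 2 = P (f\<^sup>2 / 2 + f a + b)\<close>, one has
  \<open>P (exp (l f) \<psi>) = (1 + l\<^sup>2 A / 2) \<psi> + O(l\<^sup>3)\<close> uniformly in the starting point, for complex \<open>l\<close>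
  (\<open>approximate_eigenfunction\<close>). The equation for \<open>b\<close> is solvable exactly when \<open>A = A\<^sub>x\<close>
  (\<open>correctors\<close>), and this is how \<open>A\<^sub>x\<close> enters.

  For real \<open>l\<close> the function \<open>\<psi>\<close> turns \<open>exp (l S\<^sub>n)\<close> into a supermartingale, and Ville's inequality
  bounds the running maximum of the partial sums (\<open>maximal_inequality\<close>). Borel-Cantelli along
  \<open>\<theta>\<^sup>j\<close> with \<open>\<theta>\<close> close to 1 gives the upper bound (\<open>eventually_le_lil\<close>). For imaginary \<open>l\<close> it
  yields a central limit theorem that is uniform in the starting point (\<open>uniform_clt\<close>). Cutting \<open>n\<close>
  steps into about \<open>ln (ln n)\<close> blocks and applying it in each of them bounds moderate deviation
  probabilities from below (\<open>moderate_deviation_lower\<close>). Uniformity makes the increments over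
  blocks of length \<open>\<theta>\<^sup>j\<close> with \<open>\<theta>\<close> large behave, by the Markov property, like independent events
  of non-summable probability, so that large increments recur (\<open>frequently_ge_lil\<close>). In the
  degenerate case \<open>A = 0\<close> the upper bound for \<open>- f\<close> takes the place of the lower bound.
\<close>

section \<open>The transition operator of a random walk\<close>

definition bdd_meas :: "(real \<Rightarrow> 'b::real_normed_vector) \<Rightarrow> bool" where
  "bdd_meas \<phi> \<longleftrightarrow> \<phi> \<in> borel_measurable borel \<and> (\<exists>K. \<forall>y. norm (\<phi> y) \<le> K)"

definition periodic1 :: "(real \<Rightarrow> 'b) \<Rightarrow> bool" where
  "periodic1 \<phi> \<longleftrightarrow> (\<forall>y. \<phi> (y + 1) = \<phi> y)"

lemma bdd_measI: "\<phi> \<in> borel_measurable borel \<Longrightarrow> (\<And>y. norm (\<phi> y) \<le> K) \<Longrightarrow> bdd_meas \<phi>"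
  unfolding bdd_meas_def by blast

lemma bdd_meas_borel [measurable_dest]: "bdd_meas \<phi> \<Longrightarrow> \<phi> \<in> borel_measurable borel"
  unfolding bdd_meas_def by blast

lemma bdd_meas_bound:
  assumes "bdd_meas \<phi>"
  obtains K where "K \<ge> 0" "\<And>y. norm (\<phi> y) \<le> K"
proof -
  from assms obtain K where K: "\<And>y. norm (\<phi> y) \<le> K" unfolding bdd_meas_def by blast
  have "0 \<le> K" using norm_ge_zero[of "\<phi> 0"] K[of 0] by linarith
  with K that show thesis by blast
qed

lemma bdd_meas_const [simp]: "bdd_meas (\<lambda>_. c)"
  unfolding bdd_meas_def by auto

lemma bdd_meas_add:
  fixes \<phi> \<psi> :: "real \<Rightarrow> 'b::{real_normed_vector, second_countable_topology}"
  assumes "bdd_meas \<phi>" "bdd_meas \<psi>"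
  shows "bdd_meas (\<lambda>y. \<phi> y + \<psi> y)"
proof -
  obtain K L where "\<And>y. norm (\<phi> y) \<le> K" "\<And>y. norm (\<psi> y) \<le> L"
    using assms[THEN bdd_meas_bound] by metis
  then have "norm (\<phi> y + \<psi> y) \<le> K + L" for y
    using norm_triangle_ineq[of "\<phi> y" "\<psi> y"] by (meson add_mono order_trans)
  with assms show ?thesis by (intro bdd_measI[where K="K + L"] borel_measurable_add) (auto dest: bdd_meas_borel)
qed

lemma bdd_meas_mult:
  fixes \<phi> \<psi> :: "real \<Rightarrow> 'b::{real_normed_algebra, second_countable_topology}"
  assumes "bdd_meas \<phi>" "bdd_meas \<psi>"
  shows "bdd_meas (\<lambda>y. \<phi> y * \<psi> y)"
proof -
  obtain K L where "K \<ge> 0" "\<And>y. norm (\<phi> y) \<le> K" "\<And>y. norm (\<psi> y) \<le> L"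
    using assms[THEN bdd_meas_bound] by metis
  then have "norm (\<phi> y * \<psi> y) \<le> K * L" for y
    using norm_mult_ineq[of "\<phi> y" "\<psi> y"]
    by (meson mult_mono norm_ge_zero order_trans)
  with assms show ?thesis by (intro bdd_measI[where K="K * L"] borel_measurable_times) (auto dest: bdd_meas_borel)
qed

lemma bdd_meas_minus:
  fixes \<phi> :: "real \<Rightarrow> 'b::{real_normed_vector, second_countable_topology}"
  assumes "bdd_meas \<phi>" shows "bdd_meas (\<lambda>y. - \<phi> y)"
  using assms unfolding bdd_meas_def by auto

lemma bdd_meas_diff:
  fixes \<phi> \<psi> :: "real \<Rightarrow> 'b::{real_normed_vector, second_countable_topology}"
  assumes "bdd_meas \<phi>" "bdd_meas \<psi>"
  shows "bdd_meas (\<lambda>y. \<phi> y - \<psi> y)"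
  using bdd_meas_add[OF assms(1) bdd_meas_minus[OF assms(2)]] by simp

lemma bdd_meas_of_real:
  fixes \<phi> :: "real \<Rightarrow> real"
  assumes "bdd_meas \<phi>"
  shows "bdd_meas (\<lambda>y. of_real (\<phi> y) :: complex)"
  using assms unfolding bdd_meas_def by auto

lemma bdd_meas_shift: "bdd_meas \<phi> \<Longrightarrow> bdd_meas (\<lambda>y. \<phi> (y + c))"
  unfolding bdd_meas_def by auto

lemmas bdd_meas_intros =
  bdd_meas_const bdd_meas_add bdd_meas_mult bdd_meas_minus bdd_meas_diff bdd_meas_of_real

locale random_walk = prob_space \<nu> for \<nu> :: "real measure" +
  assumes sets_nu [measurable_cong]: "sets \<nu> = sets borel"
begin

lemma space_nu [simp]: "space \<nu> = UNIV"
  using sets_eq_imp_space_eq[OF sets_nu] by simp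

lemma integrable_bdd:
  fixes \<phi> :: "real \<Rightarrow> 'b::{banach, second_countable_topology}"
  assumes "bdd_meas \<phi>"
  shows "integrable \<nu> (\<lambda>t. \<phi> (y + t))"
proof -
  obtain K where "\<And>y. norm (\<phi> y) \<le> K" using assms by (rule bdd_meas_bound) blast
  moreover have [measurable]: "\<phi> \<in> borel_measurable borel" using assms by (rule bdd_meas_borel)
  ultimately show ?thesis by (intro integrable_const_bound[where B=K]) auto
qed

definition step_op :: "(real \<Rightarrow> 'b::{banach, second_countable_topology}) \<Rightarrow> real \<Rightarrow> 'b" where
  "step_op \<phi> y = (\<integral>t. \<phi> (y + t) \<partial>\<nu>)"

lemma step_op_bound:
  fixes \<phi> :: "real \<Rightarrow> 'b::{banach, second_countable_topology}"
  assumes "bdd_meas \<phi>" "\<And>y. norm (\<phi> y) \<le> K"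
  shows "norm (step_op \<phi> y) \<le> K"
proof -
  have "norm (step_op \<phi> y) \<le> (\<integral>t. norm (\<phi> (y + t)) \<partial>\<nu>)"
    unfolding step_op_def by (rule integral_norm_bound)
  also have "\<dots> \<le> K"
    by (rule integral_le_const[OF integrable_norm[OF integrable_bdd[OF assms(1)]]]) (use assms in auto)
  finally show ?thesis .
qed

lemma bdd_meas_step_op:
  fixes \<phi> :: "real \<Rightarrow> 'b::{banach, second_countable_topology}"
  assumes "bdd_meas \<phi>"
  shows "bdd_meas (step_op \<phi>)"
proof -
  have [measurable]: "\<phi> \<in> borel_measurable borel" using assms by (rule bdd_meas_borel)
  obtain K where "\<And>y. norm (\<phi> y) \<le> K" using assms by (rule bdd_meas_bound) blast
  then have "norm (step_op \<phi> y) \<le> K" for y using step_op_bound[OF assms] by blast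
  moreover have "step_op \<phi> \<in> borel_measurable borel"
    unfolding step_op_def[abs_def] by measurable
  ultimately show ?thesis by (rule bdd_measI[rotated])
qed

lemma step_op_const [simp]: "step_op (\<lambda>_. c) = (\<lambda>_. c)"
  using prob_space by (auto simp: step_op_def fun_eq_iff)

lemma step_op_add:
  fixes \<phi> \<psi> :: "real \<Rightarrow> 'b::{banach, second_countable_topology}"
  assumes "bdd_meas \<phi>" "bdd_meas \<psi>"
  shows "step_op (\<lambda>y. \<phi> y + \<psi> y) y = step_op \<phi> y + step_op \<psi> y"
  unfolding step_op_def
  by (rule Bochner_Integration.integral_add[OF integrable_bdd[OF assms(1)] integrable_bdd[OF assms(2)]])

lemma step_op_diff:
  fixes \<phi> \<psi> :: "real \<Rightarrow> 'b::{banach, second_countable_topology}"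
  assumes "bdd_meas \<phi>" "bdd_meas \<psi>"
  shows "step_op (\<lambda>y. \<phi> y - \<psi> y) y = step_op \<phi> y - step_op \<psi> y"
  unfolding step_op_def
  by (rule Bochner_Integration.integral_diff[OF integrable_bdd[OF assms(1)] integrable_bdd[OF assms(2)]])

lemma step_op_mult_left:
  fixes \<phi> :: "real \<Rightarrow> 'b::{real_normed_field, banach, second_countable_topology}"
  shows "step_op (\<lambda>y. c * \<phi> y) y = c * step_op \<phi> y"
  unfolding step_op_def by simp

lemma step_op_of_real:
  "step_op (\<lambda>y. complex_of_real (\<phi> y)) y = complex_of_real (step_op \<phi> y)"
  unfolding step_op_def by simp

lemma step_op_mono:
  fixes \<phi> \<psi> :: "real \<Rightarrow> real"
  assumes "bdd_meas \<phi>" "bdd_meas \<psi>" "\<And>y. \<phi> y \<le> \<psi> y"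
  shows "step_op \<phi> y \<le> step_op \<psi> y"
  unfolding step_op_def
  by (rule integral_mono[OF integrable_bdd[OF assms(1)] integrable_bdd[OF assms(2)] assms(3)])

lemma periodic1_step_op: "periodic1 \<phi> \<Longrightarrow> periodic1 (step_op \<phi>)"
proof -
  assume "periodic1 \<phi>"
  then have "\<phi> (y + 1 + t) = \<phi> (y + t)" for y t
    unfolding periodic1_def by (metis add.assoc add.commute)
  then show ?thesis unfolding periodic1_def step_op_def by simp
qed

lemma bdd_meas_funpow:
  fixes \<phi> :: "real \<Rightarrow> 'b::{banach, second_countable_topology}"
  assumes "bdd_meas \<phi>" shows "bdd_meas ((step_op ^^ k) \<phi>)"
  by (induction k) (auto simp: assms bdd_meas_step_op)

lemma periodic1_funpow: "periodic1 \<phi> \<Longrightarrow> periodic1 ((step_op ^^ k) \<phi>)"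
  by (induction k) (auto simp: periodic1_step_op)

lemma funpow_bound:
  fixes \<phi> :: "real \<Rightarrow> 'b::{banach, second_countable_topology}"
  assumes "bdd_meas \<phi>" "\<And>y. norm (\<phi> y) \<le> K"
  shows "norm ((step_op ^^ k) \<phi> y) \<le> K"
proof (induction k arbitrary: y)
  case (Suc k)
  then show ?case using step_op_bound[OF bdd_meas_funpow[OF assms(1)]] by simp
qed (use assms in simp)

end

section \<open>The mean over one period\<close>

abbreviation unif :: "real measure" where "unif \<equiv> uniform_measure lborel {0<..<1}"

definition circ :: "(real \<Rightarrow> real) \<Rightarrow> real" where "circ \<phi> = (\<integral>u. \<phi> u \<partial>unif)"

lemma prob_space_unif: "prob_space unif"
  by (rule prob_space_uniform_measure) auto

interpretation unif: prob_space unif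
  by (rule prob_space_unif)

lemma integrable_unif: "bdd_meas \<phi> \<Longrightarrow> integrable unif (\<phi> :: real \<Rightarrow> real)"
proof -
  assume b: "bdd_meas \<phi>"
  obtain K where "\<And>y. norm (\<phi> y) \<le> K" using b by (rule bdd_meas_bound) blast
  moreover have [measurable]: "\<phi> \<in> borel_measurable borel" using b by (rule bdd_meas_borel)
  ultimately show ?thesis by (intro unif.integrable_const_bound[where B=K]) auto
qed

lemma unif_eq_density: "unif = density lborel (\<lambda>x. ennreal (indicator {0..1} x))"
proof -
  have "AE x in lborel. x \<noteq> (0::real)" "AE x in lborel. x \<noteq> (1::real)"
    by (rule AE_lborel_singleton)+
  then have "AE x in lborel. indicator {0<..<1} x / emeasure lborel {0<..<1::real} =
     ennreal (indicator {0..1::real} x)"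
    by eventually_elim (auto split: split_indicator)
  then show ?thesis unfolding uniform_measure_def by (intro density_cong) auto
qed

lemma circ_eq_LINT:
  assumes [measurable]: "\<phi> \<in> borel_measurable borel"
  shows "circ \<phi> = (LINT t:{0..1}|lborel. \<phi> t)"
  unfolding circ_def unif_eq_density set_lebesgue_integral_def
  by (subst integral_density) auto

lemma circ_mono: "bdd_meas \<phi> \<Longrightarrow> bdd_meas \<psi> \<Longrightarrow> (\<And>y. \<phi> y \<le> \<psi> y) \<Longrightarrow> circ \<phi> \<le> circ \<psi>"
  unfolding circ_def by (intro integral_mono integrable_unif) auto

lemma circ_add: "bdd_meas \<phi> \<Longrightarrow> bdd_meas \<psi> \<Longrightarrow> circ (\<lambda>y. \<phi> y + \<psi> y) = circ \<phi> + circ \<psi>"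
  unfolding circ_def by (simp add: integrable_unif)

lemma circ_diff: "bdd_meas \<phi> \<Longrightarrow> bdd_meas \<psi> \<Longrightarrow> circ (\<lambda>y. \<phi> y - \<psi> y) = circ \<phi> - circ \<psi>"
  unfolding circ_def by (simp add: integrable_unif)

lemma circ_uminus: "circ (\<lambda>y. - \<phi> y) = - circ \<phi>"
  unfolding circ_def by simp

lemma circ_mult: "circ (\<lambda>y. c * \<phi> y) = c * circ \<phi>"
  unfolding circ_def by simp

lemma circ_const [simp]: "circ (\<lambda>_. c) = c"
  unfolding circ_def using unif.prob_space by simp

lemma circ_bound:
  assumes "bdd_meas \<phi>" "\<And>y. \<bar>\<phi> y\<bar> \<le> K"
  shows "\<bar>circ \<phi>\<bar> \<le> K"
  using circ_mono[OF assms(1) bdd_meas_const[of K]]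
    circ_mono[OF bdd_meas_const[of "-K"] assms(1)] assms(2) by (simp add: abs_le_iff) (metis minus_le_iff)

lemma periodic1_int:
  assumes "periodic1 \<phi>" shows "\<phi> (y + of_int k) = \<phi> y"
proof -
  have n: "\<phi> (y + of_nat n) = \<phi> y" for y n
    proof (induction n)
    case (Suc n)
    have "\<phi> (y + of_nat (Suc n)) = \<phi> ((y + of_nat n) + 1)" by (simp add: algebra_simps)
    then show ?case using Suc assms by (simp add: periodic1_def)
  qed simp
  show ?thesis
  proof (cases "k \<ge> 0")
    case True then show ?thesis using n[of y "nat k"] by simp
  next
    case False then show ?thesis using n[of "y + of_int k" "nat (-k)"] by simp
  qed
qed

text \<open>Cutting the period at an integer point and moving one of the two pieces by 1 turns the
  shifted period \<open>[z, z + 1]\<close> into the standard one.\<close>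

lemma nn_integral_period:
  fixes \<phi> :: "real \<Rightarrow> ennreal"
  assumes [measurable]: "\<phi> \<in> borel_measurable borel" and p: "periodic1 \<phi>"
  shows "(\<integral>\<^sup>+t. indicator {0..<1} t * \<phi> (t + z) \<partial>lborel) = (\<integral>\<^sup>+t. indicator {0..<1} t * \<phi> t \<partial>lborel)"
proof -
  define w where "w = frac z"
  have w: "0 \<le> w" "w < 1" by (auto simp: w_def frac_lt_1)
  have "\<phi> (t + z) = \<phi> (t + w)" for t
    using periodic1_int[OF p, of "t + w" "\<lfloor>z\<rfloor>"] by (simp add: w_def frac_def algebra_simps)
  then have "(\<integral>\<^sup>+t. indicator {0..<1} t * \<phi> (t + z) \<partial>lborel)
      = (\<integral>\<^sup>+t. indicator {0..<1} t * \<phi> (t + w) \<partial>lborel)" by simp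
  also have "\<dots> = (\<integral>\<^sup>+t. indicator {0..<1} (t - w) * \<phi> t \<partial>lborel)"
    by (subst nn_integral_real_affine[where c=1 and t="-w"]) auto
  also have "\<dots> = (\<integral>\<^sup>+t. indicator {w..<1} t * \<phi> t + indicator {1..<1+w} t * \<phi> t \<partial>lborel)"
    using w by (intro nn_integral_cong) (auto split: split_indicator)
  also have "\<dots> = (\<integral>\<^sup>+t. indicator {w..<1} t * \<phi> t \<partial>lborel) + (\<integral>\<^sup>+t. indicator {1..<1+w} t * \<phi> t \<partial>lborel)"
    by (subst nn_integral_add) auto
  also have "(\<integral>\<^sup>+t. indicator {1..<1+w} t * \<phi> t \<partial>lborel) = (\<integral>\<^sup>+t. indicator {1..<1+w} (1 + t) * \<phi> (1 + t) \<partial>lborel)"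
    by (subst nn_integral_real_affine[where c=1 and t="1"]) auto
  also have "\<dots> = (\<integral>\<^sup>+t. indicator {0..<w} t * \<phi> t \<partial>lborel)"
    using p by (intro nn_integral_cong) (auto split: split_indicator simp: periodic1_def add.commute)
  also have "(\<integral>\<^sup>+t. indicator {w..<1} t * \<phi> t \<partial>lborel) + (\<integral>\<^sup>+t. indicator {0..<w} t * \<phi> t \<partial>lborel)
     = (\<integral>\<^sup>+t. indicator {w..<1} t * \<phi> t + indicator {0..<w} t * \<phi> t \<partial>lborel)"
    by (subst nn_integral_add) auto
  also have "\<dots> = (\<integral>\<^sup>+t. indicator {0..<1} t * \<phi> t \<partial>lborel)"
    using w by (intro nn_integral_cong) (auto split: split_indicator)
  finally show ?thesis .
qed

lemma nn_integral_unif: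
  fixes \<phi> :: "real \<Rightarrow> ennreal"
  assumes [measurable]: "\<phi> \<in> borel_measurable borel"
  shows "(\<integral>\<^sup>+t. \<phi> t \<partial>unif) = (\<integral>\<^sup>+t. indicator {0..<1} t * \<phi> t \<partial>lborel)"
proof -
  have "AE x in lborel. x \<noteq> (1::real)" by (rule AE_lborel_singleton)
  then have "AE x in lborel. ennreal (indicator {0..1} x) * \<phi> x = indicator {0..<1} x * \<phi> x"
    by eventually_elim (auto split: split_indicator)
  then show ?thesis unfolding unif_eq_density
    by (subst nn_integral_density) (auto intro: nn_integral_cong_AE)
qed

lemma circ_shift:
  assumes "bdd_meas \<phi>" "periodic1 \<phi>"
  shows "circ (\<lambda>t. \<phi> (t + z)) = circ \<phi>"
proof -
  have [measurable]: "\<phi> \<in> borel_measurable borel" using assms(1) by (rule bdd_meas_borel)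
  have *: "circ (\<lambda>t. \<phi> (t + z)) = circ \<phi>"
    if "\<phi> \<in> borel_measurable borel" "periodic1 \<phi>" "\<And>y. \<phi> y \<ge> 0" for \<phi>
  proof -
    note that(1)[measurable]
    have "periodic1 (\<lambda>t. ennreal (\<phi> t))" using that(2) by (simp add: periodic1_def)
    from nn_integral_period[OF _ this, of z] show ?thesis
      unfolding circ_def using that(3)
      by (simp add: integral_eq_nn_integral nn_integral_unif)
  qed
  obtain K where K: "\<And>y. norm (\<phi> y) \<le> K" using assms(1) by (rule bdd_meas_bound) blast
  have "\<phi> y + K \<ge> 0" for y using K[of y] by (simp add: abs_le_iff)
  then have "circ (\<lambda>t. \<phi> (t + z) + K) = circ (\<lambda>t. \<phi> t + K)"
    using assms(2) by (intro *) (auto simp: periodic1_def)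
  then show ?thesis
    using assms(1) by (simp add: circ_add bdd_meas_shift)
qed

lemma (in random_walk) circ_mult_step_op:
  assumes "bdd_meas \<phi>" "bdd_meas \<psi>"
  shows "circ (\<lambda>u. \<psi> u * step_op \<phi> u) = (\<integral>t. circ (\<lambda>u. \<psi> u * \<phi> (u + t)) \<partial>\<nu>)"
proof -
  have [measurable]: "\<phi> \<in> borel_measurable borel" "\<psi> \<in> borel_measurable borel"
    using assms by (auto intro: bdd_meas_borel)
  obtain K where K: "\<And>y. norm (\<phi> y) \<le> K" using assms(1) by (rule bdd_meas_bound) blast
  obtain L where L: "L \<ge> 0" "\<And>y. norm (\<psi> y) \<le> L" using assms(2) by (rule bdd_meas_bound) blast
  interpret pair_prob_space unif \<nu> ..
  have "integrable (unif \<Otimes>\<^sub>M \<nu>) (\<lambda>(u, t). \<psi> u * \<phi> (u + t))"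
    using K L by (intro integrable_const_bound[where B="L * K"]) (auto simp: abs_mult intro!: AE_I2 mult_mono)
  from Fubini_integral[OF this] show ?thesis unfolding circ_def step_op_def by simp
qed

lemma (in random_walk) circ_step_op:
  assumes "bdd_meas \<phi>" "periodic1 \<phi>"
  shows "circ (step_op \<phi>) = circ \<phi>"
  using circ_mult_step_op[OF assms(1) bdd_meas_const[of 1]] circ_shift[OF assms] prob_space by simp

lemma (in random_walk) circ_funpow:
  assumes "bdd_meas \<phi>" "periodic1 \<phi>"
  shows "circ ((step_op ^^ k) \<phi>) = circ \<phi>"
  by (induction k) (use assms in \<open>auto simp: circ_step_op bdd_meas_funpow periodic1_funpow\<close>)

section \<open>A minorization for steps with a density\<close>

text \<open>A weak form of Lebesgue's density theorem. If \<open>E\<close> filled at most \<open>7/8\<close> of every interval of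
  an almost optimal cover by nonoverlapping intervals, then the measure of \<open>E\<close> would be at most
  \<open>7/8 * 9/8 < 1\<close> times itself.\<close>

lemma exists_interval_mostly_in:
  fixes E :: "real set"
  assumes E: "E \<in> sets borel" "E \<subseteq> {l..u}" "emeasure lborel E \<noteq> 0"
  obtains c d where "c < d" "7/8 * (d - c) < measure lborel (E \<inter> {c..d})"
proof -
  define e where "e = measure lborel E"
  have fin: "emeasure lborel E < \<infinity>"
    using E(2) bounded_closed_interval bounded_subset by (intro emeasure_bounded_finite) blast
  then have em: "emeasure lborel E = ennreal e"
    unfolding e_def by (simp add: emeasure_eq_ennreal_measure less_top)
  with E(3) have e: "e > 0" by (simp add: e_def zero_less_measure_iff)
  have lm: "E \<in> lmeasurable"
    using E fin by (intro fmeasurableI) auto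
  obtain D where D: "countable D" 
        "\<And>K. K \<in> D \<Longrightarrow> K \<subseteq> cbox l u \<and> K \<noteq> {} \<and> (\<exists>c d. K = cbox c d)"
        "pairwise (\<lambda>A B. interior A \<inter> interior B = {}) D"
        "E \<subseteq> \<Union>D" "\<Union>D \<in> lmeasurable" "measure lebesgue (\<Union>D) \<le> measure lebesgue E + e/8"
    by (rule measurable_outer_intervals_bounded[of E l u "e/8"]) (use E lm e in auto)
  \<comment> \<open>only the interiors are disjoint, but the end points form a null set\<close>
  define N where "N = (\<Union>K\<in>D. K - interior K)"
  have "countable (K - interior K)" if K: "K \<in> D" for K
  proof -
    obtain c d where "K = {c..d}" using D(2)[OF K] by auto
    then have "K - interior K \<subseteq> {c, d}" by auto
    then show ?thesis by (meson countable_finite finite.intros finite_subset)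
  qed
  then have "countable N" unfolding N_def using D(1) by auto
  then have N: "N \<in> null_sets lborel" by (rule countable_imp_null_set_lborel)
  have disj: "disjoint_family_on interior D"
    using D(3) by (auto simp: disjoint_family_on_def pairwise_def)
  have [measurable]: "E \<in> sets borel" by fact
  have "emeasure lborel E = emeasure lborel (E - N)"
    using N by (simp add: emeasure_Diff_null_set)
  also have "\<dots> \<le> emeasure lborel (\<Union>K\<in>D. E \<inter> interior K)"
    using D(4) by (intro emeasure_mono) (auto simp: N_def intro!: sets.countable_UN' D(1))
  also have "\<dots> = (\<integral>\<^sup>+K. emeasure lborel (E \<inter> interior K) \<partial>count_space D)"
    using disj by (intro emeasure_UN_countable D(1)) (auto simp: disjoint_family_on_def)
  finally have 1: "emeasure lborel E \<le> (\<integral>\<^sup>+K. emeasure lborel (E \<inter> interior K) \<partial>count_space D)" .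
  have 2: "(\<integral>\<^sup>+K. emeasure lborel (interior K) \<partial>count_space D) = emeasure lborel (\<Union>K\<in>D. interior K)"
    using disj by (intro emeasure_UN_countable[symmetric] D(1)) auto
  have "emeasure lborel (\<Union>K\<in>D. interior K) = emeasure lebesgue (\<Union>K\<in>D. interior K)"
    by (simp add: open_UN)
  also have "\<dots> \<le> emeasure lebesgue (\<Union>D)"
    using D(5) interior_subset by (intro emeasure_mono) (auto dest: fmeasurableD)
  also have "\<dots> = ennreal (measure lebesgue (\<Union>D))"
    using D(5) by (simp add: emeasure_eq_measure2)
  also have "\<dots> \<le> ennreal (9/8 * e)"
    using D(6) by (intro ennreal_leI) (simp add: e_def)
  finally have 3: "emeasure lborel (\<Union>K\<in>D. interior K) \<le> ennreal (9/8 * e)" .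
  have "\<exists>K\<in>D. \<not> emeasure lborel (E \<inter> interior K) \<le> ennreal (7/8) * emeasure lborel (interior K)"
  proof (rule ccontr)
    assume "\<not> ?thesis"
    then have "(\<integral>\<^sup>+K. emeasure lborel (E \<inter> interior K) \<partial>count_space D)
        \<le> (\<integral>\<^sup>+K. ennreal (7/8) * emeasure lborel (interior K) \<partial>count_space D)"
      by (intro nn_integral_mono) auto
    also have "\<dots> \<le> ennreal (7/8) * ennreal (9/8 * e)"
      using 2 3 by (simp add: nn_integral_cmult mult_left_mono)
    also have "\<dots> = ennreal (63/64 * e)" using e by (simp add: ennreal_mult[symmetric])
    finally have "ennreal e \<le> ennreal (63/64 * e)" using 1 em by simp
    with e show False by (simp add: ennreal_le_iff)
  qed
  then obtain K where K: "K \<in> D" "ennreal (7/8) * emeasure lborel (interior K) < emeasure lborel (E \<inter> interior K)"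
    by (auto simp: not_le)
  obtain c d where cd: "K = {c..d}" "K \<noteq> {}" using D(2)[OF K(1)] by auto
  then have "c \<le> d" by auto
  have "emeasure lborel (interior K) = ennreal (d - c)" using cd \<open>c \<le> d\<close> by auto
  then have "ennreal (7/8 * (d - c)) < emeasure lborel (E \<inter> interior K)"
    using K(2) \<open>c \<le> d\<close> by (simp add: ennreal_mult[symmetric])
  also have "\<dots> \<le> emeasure lborel (E \<inter> {c..d})"
    using cd interior_subset by (intro emeasure_mono) auto
  also have "\<dots> = ennreal (measure lborel (E \<inter> {c..d}))"
    using emeasure_bounded_finite[of "E \<inter> {c..d}"]
    by (intro emeasure_eq_ennreal_measure) (auto simp: bounded_Int)
  finally have 4: "7/8 * (d - c) < measure lborel (E \<inter> {c..d})"
    using \<open>c \<le> d\<close> by (simp add: ennreal_less_iff)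
  moreover have "c \<noteq> d"
  proof
    assume "c = d"
    then have "measure lborel (E \<inter> {c..d}) \<le> measure lborel {c..d}"
      by (intro measure_mono_fmeasurable) (auto simp: fmeasurable_def)
    with 4 \<open>c = d\<close> show False by simp
  qed
  ultimately show thesis using \<open>c \<le> d\<close> by (intro that[of c d]) auto
qed

lemma ennreal_mult3:
  "0 \<le> a \<Longrightarrow> 0 \<le> b \<Longrightarrow> 0 \<le> c \<Longrightarrow> ennreal a * ennreal b * ennreal c = ennreal (a * b * c)"
  by (simp add: ennreal_mult)

context random_walk
begin

text \<open>The transition operator on \<open>[0, \<infinity>]\<close>-valued functions, where Tonelli's theorem needs no
  integrability.\<close>

definition nn_op :: "(real \<Rightarrow> ennreal) \<Rightarrow> real \<Rightarrow> ennreal" where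
  "nn_op \<phi> y = (\<integral>\<^sup>+t. \<phi> (y + t) \<partial>\<nu>)"

lemma measurable_nn_op [measurable]:
  assumes [measurable]: "\<phi> \<in> borel_measurable borel"
  shows "nn_op \<phi> \<in> borel_measurable borel"
  unfolding nn_op_def[abs_def] by measurable

lemma measurable_nn_op_funpow [measurable]:
  "\<phi> \<in> borel_measurable borel \<Longrightarrow> (nn_op ^^ k) \<phi> \<in> borel_measurable borel"
  by (induction k) auto

lemma nn_op_funpow:
  assumes "bdd_meas \<phi>" "\<And>y. 0 \<le> \<phi> y"
  shows "0 \<le> (step_op ^^ k) \<phi> y \<and> ennreal ((step_op ^^ k) \<phi> y) = (nn_op ^^ k) (\<lambda>y. ennreal (\<phi> y)) y"
proof (induction k arbitrary: y)
  case (Suc k)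
  let ?\<psi> = "(step_op ^^ k) \<phi>"
  have "integrable \<nu> (\<lambda>t. ?\<psi> (y + t))"
    using bdd_meas_funpow[OF assms(1)] by (rule integrable_bdd)
  then have "(\<integral>\<^sup>+t. ennreal (?\<psi> (y + t)) \<partial>\<nu>) = ennreal (\<integral>t. ?\<psi> (y + t) \<partial>\<nu>)"
    using Suc by (intro nn_integral_eq_integral) auto
  moreover have "0 \<le> step_op ?\<psi> y"
    unfolding step_op_def[of ?\<psi>] using Suc by (intro Bochner_Integration.integral_nonneg) auto
  ultimately show ?case using Suc by (simp add: step_op_def[of ?\<psi>] nn_op_def)
qed (use assms in simp)

text \<open>The law of the sum of \<open>m\<close> steps has on \<open>E\<close> a density of at least \<open>\<delta>\<close>.\<close>

definition minorizes :: "nat \<Rightarrow> ennreal \<Rightarrow> real set \<Rightarrow> bool" where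
  "minorizes m \<delta> E \<longleftrightarrow> (\<forall>\<phi>\<in>borel_measurable borel. \<forall>y.
     \<delta> * (\<integral>\<^sup>+z. indicator E z * \<phi> (y + z) \<partial>lborel) \<le> (nn_op ^^ m) \<phi> y)"

text \<open>The factor \<open>\<eta>\<close> is a lower bound for the convolution of the indicator of \<open>E\<close> with itself.\<close>

lemma minorizes_convolve:
  assumes m: "minorizes m \<delta> E" and [measurable]: "E \<in> sets borel" "I \<in> sets borel"
    and \<eta>: "\<And>v. v \<in> I \<Longrightarrow> \<eta> \<le> emeasure lborel {s \<in> E. v - s \<in> E}"
  shows "minorizes (m + m) (\<delta> * \<delta> * \<eta>) I"
  unfolding minorizes_def
proof (intro ballI allI)
  fix \<phi> :: "real \<Rightarrow> ennreal" and y assume [measurable]: "\<phi> \<in> borel_measurable borel"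
  have "\<delta> * \<delta> * \<eta> * (\<integral>\<^sup>+v. indicator I v * \<phi> (y + v) \<partial>lborel)
    = \<delta> * (\<delta> * (\<integral>\<^sup>+v. \<eta> * (indicator I v * \<phi> (y + v)) \<partial>lborel))"
    by (subst nn_integral_cmult) (auto simp: ac_simps)
  also have "(\<integral>\<^sup>+v. \<eta> * (indicator I v * \<phi> (y + v)) \<partial>lborel)
    \<le> (\<integral>\<^sup>+v. (\<integral>\<^sup>+z. indicator E z * (indicator E (v - z) * \<phi> (y + v)) \<partial>lborel) \<partial>lborel)"
  proof (intro nn_integral_mono)
    fix v
    have "(\<integral>\<^sup>+z. indicator E z * (indicator E (v - z) * \<phi> (y + v)) \<partial>lborel)
      = (\<integral>\<^sup>+z. indicator {s \<in> E. v - s \<in> E} z * \<phi> (y + v) \<partial>lborel)"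
      by (intro nn_integral_cong) (auto split: split_indicator)
    also have "\<dots> = emeasure lborel {s \<in> E. v - s \<in> E} * \<phi> (y + v)"
      by (subst nn_integral_multc) auto
    finally show "\<eta> * (indicator I v * \<phi> (y + v))
       \<le> (\<integral>\<^sup>+z. indicator E z * (indicator E (v - z) * \<phi> (y + v)) \<partial>lborel)"
      using \<eta>[of v] by (auto split: split_indicator intro!: mult_right_mono)
  qed
  also have "\<dots> = (\<integral>\<^sup>+z. (\<integral>\<^sup>+v. indicator E z * (indicator E (v - z) * \<phi> (y + v)) \<partial>lborel) \<partial>lborel)"
    by (rule lborel_pair.Fubini') measurable
  also have "\<dots> = (\<integral>\<^sup>+z. indicator E z * (\<integral>\<^sup>+w. indicator E w * \<phi> (y + z + w) \<partial>lborel) \<partial>lborel)"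
  proof (intro nn_integral_cong)
    fix z
    have "(\<integral>\<^sup>+v. indicator E z * (indicator E (v - z) * \<phi> (y + v)) \<partial>lborel)
      = (\<integral>\<^sup>+w. indicator E z * (indicator E (z + w - z) * \<phi> (y + (z + w))) \<partial>lborel)"
      by (subst nn_integral_real_affine[where c=1 and t=z]) auto
    then show "(\<integral>\<^sup>+v. indicator E z * (indicator E (v - z) * \<phi> (y + v)) \<partial>lborel)
      = indicator E z * (\<integral>\<^sup>+w. indicator E w * \<phi> (y + z + w) \<partial>lborel)"
      by (simp add: nn_integral_cmult add.assoc)
  qed
  also have "\<delta> * \<dots> = (\<integral>\<^sup>+z. indicator E z * (\<delta> * (\<integral>\<^sup>+w. indicator E w * \<phi> (y + z + w) \<partial>lborel)) \<partial>lborel)"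
    by (subst nn_integral_cmult[symmetric]) (auto simp: ac_simps)
  also have "\<dots> \<le> (\<integral>\<^sup>+z. indicator E z * (nn_op ^^ m) \<phi> (y + z) \<partial>lborel)"
    using m by (intro nn_integral_mono mult_left_mono) (auto simp: minorizes_def)
  also have "\<delta> * \<dots> \<le> (nn_op ^^ m) ((nn_op ^^ m) \<phi>) y"
    using m by (auto simp: minorizes_def)
  finally show "\<delta> * \<delta> * \<eta> * (\<integral>\<^sup>+v. indicator I v * \<phi> (y + v) \<partial>lborel) \<le> (nn_op ^^ (m + m)) \<phi> y"
    by (simp add: funpow_add mult_left_mono)
qed


lemma minorizes_mono:
  assumes "minorizes m \<delta> E" "\<delta>' \<le> \<delta>" "E' \<subseteq> E"
  shows "minorizes m \<delta>' E'"
  unfolding minorizes_def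
proof (intro ballI allI)
  fix \<phi> :: "real \<Rightarrow> ennreal" and y assume "\<phi> \<in> borel_measurable borel"
  have "\<delta>' * (\<integral>\<^sup>+z. indicator E' z * \<phi> (y + z) \<partial>lborel) \<le> \<delta> * (\<integral>\<^sup>+z. indicator E z * \<phi> (y + z) \<partial>lborel)"
    using assms by (intro mult_mono nn_integral_mono) (auto split: split_indicator)
  also have "\<dots> \<le> (nn_op ^^ m) \<phi> y"
    using assms(1) \<open>\<phi> \<in> _\<close> by (auto simp: minorizes_def)
  finally show "\<delta>' * (\<integral>\<^sup>+z. indicator E' z * \<phi> (y + z) \<partial>lborel) \<le> (nn_op ^^ m) \<phi> y" .
qed

lemma minorizes_density:
  assumes "\<nu> = density lborel g" and [measurable]: "g \<in> borel_measurable borel" "E \<in> sets borel"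
    and "\<And>t. t \<in> E \<Longrightarrow> \<delta> \<le> g t"
  shows "minorizes 1 \<delta> E"
  unfolding minorizes_def
proof (intro ballI allI)
  fix \<phi> :: "real \<Rightarrow> ennreal" and y assume [measurable]: "\<phi> \<in> borel_measurable borel"
  have "\<delta> * (\<integral>\<^sup>+z. indicator E z * \<phi> (y + z) \<partial>lborel) = (\<integral>\<^sup>+z. \<delta> * (indicator E z * \<phi> (y + z)) \<partial>lborel)"
    by (subst nn_integral_cmult) auto
  also have "\<dots> \<le> (\<integral>\<^sup>+z. g z * \<phi> (y + z) \<partial>lborel)"
    using assms(4) by (intro nn_integral_mono) (auto split: split_indicator intro!: mult_right_mono)
  also have "\<dots> = (\<integral>\<^sup>+z. \<phi> (y + z) \<partial>density lborel g)"
    by (simp add: nn_integral_density)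
  also have "\<dots> = (nn_op ^^ 1) \<phi> y"
    by (simp add: nn_op_def flip: assms(1))
  finally show "\<delta> * (\<integral>\<^sup>+z. indicator E z * \<phi> (y + z) \<partial>lborel) \<le> (nn_op ^^ 1) \<phi> y" .
qed

definition reaches :: "real \<Rightarrow> bool" where
  "reaches r \<longleftrightarrow> (\<exists>m \<delta> a. 0 < (\<delta>::real) \<and> minorizes m (ennreal \<delta>) {a..a + r})"

lemma reaches_mono: "reaches r \<Longrightarrow> r' \<le> r \<Longrightarrow> reaches r'"
  unfolding reaches_def using minorizes_mono[OF _ order.refl, of _ _ "{_.._ + r}" "{_.._ + r'}"]
  by (metis add_left_mono atLeastatMost_subset_iff order.refl)

text \<open>The convolution of the indicator of an interval of length \<open>r\<close> with itself is at least
  \<open>r / 4\<close> on an interval of length \<open>3 r / 2\<close>.\<close>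

lemma reaches_grow:
  assumes "reaches r" "0 < r" shows "reaches (3/2 * r)"
proof -
  obtain m \<delta> a where *: "0 < (\<delta>::real)" "minorizes m (ennreal \<delta>) {a..a + r}"
    using assms(1) by (auto simp: reaches_def)
  define a' where "a' = 2 * a + r / 4"
  have "ennreal (r/4) \<le> emeasure lborel {s \<in> {a..a+r}. v - s \<in> {a..a+r}}" if "v \<in> {a'..a' + 3/2*r}" for v
  proof -
    have "{s \<in> {a..a+r}. v - s \<in> {a..a+r}} = {max a (v - a - r)..min (a + r) (v - a)}" by auto
    moreover have "r / 4 \<le> min (a + r) (v - a) - max a (v - a - r)"
      using that assms(2) by (auto simp: a'_def min_def max_def field_simps)
    ultimately show ?thesis
      using assms(2) that by (auto simp: emeasure_lborel_Icc_eq a'_def intro!: ennreal_leI)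
  qed
  then have "minorizes (m + m) (ennreal \<delta> * ennreal \<delta> * ennreal (r/4)) {a'..a' + 3/2*r}"
    by (intro minorizes_convolve[OF *(2)]) auto
  then have "minorizes (m + m) (ennreal (\<delta> * \<delta> * (r/4))) {a'..a' + 3/2*r}"
    using assms(2) *(1) by (subst (asm) ennreal_mult3) auto
  moreover have "0 < \<delta> * \<delta> * (r/4)" using assms(2) * by auto
  ultimately show ?thesis unfolding reaches_def by blast
qed

lemma reaches_1:
  assumes "reaches r" "0 < r" shows "reaches 1"
proof -
  have pow: "reaches ((3/2)^k * r)" for k
  proof (induction k)
    case (Suc k) then show ?case using reaches_grow[of "(3/2)^k * r"] assms(2) by (simp add: mult.assoc)
  qed (use assms in simp)
  obtain k where "1 / r < (3/2)^k" using real_arch_pow[of "3/2" "1/r"] by auto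
  then have "1 \<le> (3/2)^k * r" using assms(2) by (simp add: field_simps)
  with pow[of k] show ?thesis by (rule reaches_mono)
qed

text \<open>Both \<open>E\<close> and its reflection at \<open>v / 2\<close> have measure at least \<open>7/8 * (d - c)\<close> and lie in an
  interval of length \<open>3/2 * (d - c)\<close>, so they overlap.\<close>

lemma emeasure_overlap_reflected:
  assumes [measurable]: "E \<in> sets borel" and E: "E \<subseteq> {c..d}" "7/8 * (d - c) \<le> measure lborel E"
    and v: "\<bar>v - (c + d)\<bar> \<le> (d - c) / 4" and cd: "c \<le> d"
  shows "ennreal ((d - c) / 4) \<le> emeasure lborel {s \<in> E. v - s \<in> E}"
proof -
  define R where "R = {s. v - s \<in> E}"
  have [measurable]: "R \<in> sets borel" unfolding R_def by measurable
  have R: "R \<subseteq> {v - d..v - c}" using E(1) by (auto simp: R_def)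
  have fm: "A \<in> fmeasurable lborel" if "A \<in> sets borel" "A \<subseteq> {x..y}" for A and x y :: real
  proof -
    have "bounded A" using that(2) bounded_closed_interval bounded_subset by blast
    then show ?thesis using that(1) emeasure_bounded_finite by (intro fmeasurableI) auto
  qed
  have "emeasure lborel E = (\<integral>\<^sup>+s. indicator E s \<partial>lborel)" by simp
  also have "\<dots> = (\<integral>\<^sup>+s. indicator E (v - s) \<partial>lborel)"
    by (subst nn_integral_real_affine[where c="-1" and t=v]) auto
  also have "\<dots> = (\<integral>\<^sup>+s. indicator R s \<partial>lborel)"
    by (intro nn_integral_cong) (auto simp: R_def split: split_indicator)
  finally have "measure lborel R = measure lborel E" by (simp add: measure_def)
  moreover have "measure lborel (E \<union> R) = measure lborel E + measure lborel R - measure lborel (E \<inter> R)"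
    by (rule measure_Un3[OF fm[OF _ E(1)] fm[OF _ R]]) auto
  moreover have "measure lborel (E \<union> R) \<le> 3/2 * (d - c)"
  proof -
    have "c - (d - c)/4 \<le> v - d" "v - c \<le> d + (d - c)/4" using v by linarith+
    then have "E \<union> R \<subseteq> {c - (d - c)/4..d + (d - c)/4}"
      using E(1) R cd by (force simp: field_simps)
    then have "measure lborel (E \<union> R) \<le> measure lborel {c - (d - c)/4..d + (d - c)/4}"
      by (intro measure_mono_fmeasurable fm) auto
    also have "\<dots> = 3/2 * (d - c)" using cd by (simp add: field_simps)
    finally show ?thesis .
  qed
  ultimately have "(d - c) / 4 \<le> measure lborel (E \<inter> R)" using E(2) cd by (simp add: field_simps)
  moreover have "emeasure lborel (E \<inter> R) = ennreal (measure lborel (E \<inter> R))"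
    by (rule emeasure_eq_measure2[OF fm[of "E \<inter> R" c d]]) (use E(1) in auto)
  ultimately have "ennreal ((d - c) / 4) \<le> emeasure lborel (E \<inter> R)"
    by (simp only:) (rule ennreal_leI)
  moreover have "E \<inter> R = {s \<in> E. v - s \<in> E}" by (auto simp: R_def)
  ultimately show ?thesis by simp
qed

text \<open>A density exceeds a positive constant on a set of positive measure. This set almost fills some
  interval, and the convolution with itself then stays away from 0 on an interval around the
  doubled midpoint.\<close>

lemma reaches_density:
  assumes "\<nu> = density lborel g" and [measurable]: "g \<in> borel_measurable borel"
  shows "reaches 1"
proof -
  define A where "A n = {x \<in> {- real n..real n}. 1 / (real n + 1) \<le> g x}" for n :: nat
  have [measurable]: "A n \<in> sets borel" for n unfolding A_def by measurable
  have "\<exists>n. emeasure lborel (A n) \<noteq> 0"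
  proof (rule ccontr)
    assume "\<not> ?thesis"
    then have "A n \<in> null_sets lborel" for n by (auto simp: null_sets_def)
    then have "(\<Union>n. A n) \<in> null_sets lborel" by auto
    then have "AE x in lborel. x \<notin> (\<Union>n. A n)" by (rule AE_not_in)
    moreover have "g x = 0" if nx: "x \<notin> (\<Union>n. A n)" for x
    proof (rule ccontr)
      assume "g x \<noteq> 0"
      obtain e :: real where e: "0 < e" "ennreal e \<le> g x"
      proof (cases "g x")
        case (real r)
        show thesis by (rule that[of r]) (use real \<open>g x \<noteq> 0\<close> in \<open>auto simp: less_le\<close>)
      next
        case top
        show thesis by (rule that[of 1]) (use top in auto)
      qed
      obtain n where n: "max \<bar>x\<bar> (1/e) < real n" using reals_Archimedean2 by blast
      then have "1 / (real n + 1) \<le> e" using e(1) by (simp add: field_simps)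
      then have "ennreal (1 / (real n + 1)) \<le> g x" using e(2) ennreal_leI order_trans by blast
      then have "x \<in> A n" using n by (auto simp: A_def)
      with nx show False by blast
    qed
    ultimately have "AE x in lborel. g x = 0" by (auto elim: eventually_mono)
    then have "(\<integral>\<^sup>+x. g x \<partial>lborel) = 0" by (subst nn_integral_0_iff_AE) auto
    moreover have "(\<integral>\<^sup>+x. g x \<partial>lborel) = emeasure \<nu> UNIV"
      by (simp add: assms(1) emeasure_density)
    ultimately show False using emeasure_space_1 by simp
  qed
  then obtain n where n: "emeasure lborel (A n) \<noteq> 0" by blast
  define \<delta> where "\<delta> = 1 / (real n + 1)"
  obtain c d where cd: "c < d" "7/8 * (d - c) < measure lborel (A n \<inter> {c..d})"
    by (rule exists_interval_mostly_in[of "A n" "-real n" "real n"]) (use n in \<open>auto simp: A_def\<close>)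
  have 1: "minorizes 1 (ennreal \<delta>) (A n \<inter> {c..d})"
    by (rule minorizes_density[OF assms]) (auto simp: A_def \<delta>_def)
  define r a where "r = (d - c) / 2" and "a = (c + d) - (d - c) / 4"
  have "ennreal ((d - c)/4) \<le> emeasure lborel {s \<in> A n \<inter> {c..d}. v - s \<in> A n \<inter> {c..d}}"
    if "v \<in> {a..a + r}" for v
  proof (rule emeasure_overlap_reflected)
    show "\<bar>v - (c + d)\<bar> \<le> (d - c) / 4"
      using that cd(1) unfolding r_def a_def atLeastAtMost_iff by (intro abs_leI) argo+
  qed (use cd in auto)
  then have "minorizes (1 + 1) (ennreal \<delta> * ennreal \<delta> * ennreal ((d - c)/4)) {a..a + r}"
    by (intro minorizes_convolve[OF 1]) auto
  then have "minorizes (1 + 1) (ennreal (\<delta> * \<delta> * ((d - c)/4))) {a..a + r}"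
    using cd by (subst (asm) ennreal_mult3) (auto simp: \<delta>_def)
  moreover have "0 < \<delta> * \<delta> * ((d - c)/4)" using cd by (auto simp: \<delta>_def)
  ultimately have "reaches r" unfolding reaches_def by blast
  then show ?thesis by (rule reaches_1) (use cd in \<open>simp add: r_def\<close>)
qed

text \<open>Once the minorized interval has length 1, it covers the whole circle.\<close>

lemma doeblin_density:
  assumes "\<nu> = density lborel g" "g \<in> borel_measurable borel"
  shows "\<exists>m \<epsilon>. 0 < \<epsilon> \<and> (\<forall>\<phi> y. bdd_meas \<phi> \<longrightarrow> periodic1 \<phi> \<longrightarrow> (\<forall>z. 0 \<le> \<phi> z) \<longrightarrow>
     \<epsilon> * circ \<phi> \<le> (step_op ^^ m) \<phi> y)"
proof -
  obtain m \<delta> a where *: "0 < (\<delta>::real)" "minorizes m (ennreal \<delta>) {a..a + 1}"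
    using reaches_density[OF assms] by (auto simp: reaches_def)
  have "\<delta> * circ \<phi> \<le> (step_op ^^ m) \<phi> y"
    if \<phi>: "bdd_meas \<phi>" "periodic1 \<phi>" "\<And>z. 0 \<le> \<phi> z" for \<phi> y
  proof -
    have [measurable]: "\<phi> \<in> borel_measurable borel" using \<phi>(1) by (rule bdd_meas_borel)
    have p: "periodic1 (\<lambda>t. ennreal (\<phi> t))" using \<phi>(2) by (simp add: periodic1_def)
    have "ennreal (circ \<phi>) = (\<integral>\<^sup>+t. ennreal (\<phi> t) \<partial>unif)"
      unfolding circ_def using \<phi> by (intro nn_integral_eq_integral[symmetric] integrable_unif) auto
    also have "\<dots> = (\<integral>\<^sup>+t. indicator {0..<1} t * ennreal (\<phi> (t + (y + a))) \<partial>lborel)"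
      by (simp add: nn_integral_unif nn_integral_period[OF _ p])
    also have "\<dots> \<le> (\<integral>\<^sup>+t. indicator {a..a+1} (a + t) * ennreal (\<phi> (y + (a + t))) \<partial>lborel)"
      by (intro nn_integral_mono) (auto split: split_indicator simp: ac_simps)
    also have "\<dots> = (\<integral>\<^sup>+t. indicator {a..a+1} t * ennreal (\<phi> (y + t)) \<partial>lborel)"
      by (subst (2) nn_integral_real_affine[where c=1 and t=a]) auto
    finally have "ennreal \<delta> * ennreal (circ \<phi>) \<le> (nn_op ^^ m) (\<lambda>t. ennreal (\<phi> t)) y"
      using *(2)[unfolded minorizes_def, rule_format, of "\<lambda>t. ennreal (\<phi> t)" y]
      by (auto intro: order_trans[OF mult_left_mono])
    also have "\<dots> = ennreal ((step_op ^^ m) \<phi> y)"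
      using nn_op_funpow[OF \<phi>(1,3)] by simp
    finally have "ennreal (\<delta> * circ \<phi>) \<le> ennreal ((step_op ^^ m) \<phi> y)"
      using *(1) by (simp add: ennreal_mult')
    moreover have "0 \<le> (step_op ^^ m) \<phi> y" using nn_op_funpow[OF \<phi>(1,3)] by blast
    ultimately show ?thesis by (simp only: ennreal_le_iff)
  qed
  with *(1) show ?thesis by blast
qed

end

section \<open>Geometric mixing and the Poisson equation\<close>

locale mixing_walk = random_walk +
  assumes doeblin: "\<exists>m \<epsilon>. 0 < \<epsilon> \<and> (\<forall>\<phi> y. bdd_meas \<phi> \<longrightarrow> periodic1 \<phi> \<longrightarrow> (\<forall>z. 0 \<le> \<phi> z) \<longrightarrow>
     \<epsilon> * circ \<phi> \<le> (step_op ^^ m) \<phi> y)"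
begin

lemma step_op_funpow_affine:
  fixes \<phi> :: "real \<Rightarrow> real"
  assumes "bdd_meas \<phi>"
  shows "(step_op ^^ k) (\<lambda>y. c + s * \<phi> y) = (\<lambda>y. c + s * (step_op ^^ k) \<phi> y)"
proof (induction k)
  case (Suc k)
  have "bdd_meas (\<lambda>y. s * (step_op ^^ k) \<phi> y)"
    by (intro bdd_meas_intros bdd_meas_funpow assms)
  from step_op_add[OF bdd_meas_const this] show ?case
    by (simp only: funpow.simps o_apply Suc step_op_mult_left step_op_const fun_eq_iff) simp
qed simp

text \<open>For \<open>\<bar>\<phi>\<bar> \<le> K\<close> of mean zero apply the minorization to the nonnegative functions \<open>K + \<phi>\<close> and
  \<open>K - \<phi>\<close>, both of mean \<open>K\<close>.\<close>

lemma funpow_contracts: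
  obtains m \<epsilon> where "0 < m" "0 < \<epsilon>" "\<epsilon> < 1"
    "\<And>\<phi> K y. bdd_meas \<phi> \<Longrightarrow> periodic1 \<phi> \<Longrightarrow> circ \<phi> = 0 \<Longrightarrow> (\<And>z. \<bar>\<phi> z\<bar> \<le> K) \<Longrightarrow>
       \<bar>(step_op ^^ m) \<phi> y\<bar> \<le> (1 - \<epsilon>) * K"
proof -
  obtain m \<epsilon>' where d: "0 < \<epsilon>'" "\<And>\<phi> y. bdd_meas \<phi> \<Longrightarrow> periodic1 \<phi> \<Longrightarrow> (\<And>z. 0 \<le> \<phi> z) \<Longrightarrow>
     \<epsilon>' * circ \<phi> \<le> (step_op ^^ m) \<phi> y" using doeblin by blast
  \<comment> \<open>a strict bound \<open>\<epsilon> < 1\<close> and a positive exponent \<open>Suc m\<close> are needed for the root in the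
    geometric rate\<close>
  define \<epsilon> where "\<epsilon> = min \<epsilon>' (1/2)"
  have \<epsilon>: "0 < \<epsilon>" "\<epsilon> < 1" using d(1) by (auto simp: \<epsilon>_def)
  have low: "\<epsilon> * circ \<phi> \<le> (step_op ^^ Suc m) \<phi> y"
    if \<phi>: "bdd_meas \<phi>" "periodic1 \<phi>" "\<And>z. 0 \<le> \<phi> z" for \<phi> y
  proof -
    have "0 \<le> step_op \<phi> z" for z
      using step_op_mono[OF bdd_meas_const[of 0] \<phi>(1,3), of z] by simp
    then have "\<epsilon>' * circ (step_op \<phi>) \<le> (step_op ^^ m) (step_op \<phi>) y"
      using \<phi> by (intro d(2)) (auto simp: bdd_meas_step_op periodic1_step_op)
    moreover have "0 \<le> circ \<phi>" using circ_mono[OF bdd_meas_const[of 0] \<phi>(1,3)] by simp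
    then have "\<epsilon> * circ \<phi> \<le> \<epsilon>' * circ \<phi>" by (intro mult_right_mono) (auto simp: \<epsilon>_def)
    ultimately show ?thesis using \<phi> by (simp add: circ_step_op funpow_swap1)
  qed
  have "\<bar>(step_op ^^ Suc m) \<phi> y\<bar> \<le> (1 - \<epsilon>) * K"
    if \<phi>: "bdd_meas \<phi>" "periodic1 \<phi>" "circ \<phi> = 0" "\<And>z. \<bar>\<phi> z\<bar> \<le> K" for \<phi> K y
  proof -
    have *: "\<epsilon> * K \<le> K + s * (step_op ^^ Suc m) \<phi> y" if "s = 1 \<or> s = -1" for s :: real
    proof -
      have "0 \<le> K + s * \<phi> z" for z using \<phi>(4)[of z] that by (auto simp: abs_le_iff)
      then have "\<epsilon> * circ (\<lambda>y. K + s * \<phi> y) \<le> (step_op ^^ Suc m) (\<lambda>y. K + s * \<phi> y) y"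
        using \<phi> by (intro low bdd_meas_intros) (auto simp: periodic1_def)
      moreover have "circ (\<lambda>y. K + s * \<phi> y) = K"
        using circ_add[OF bdd_meas_const bdd_meas_mult[OF bdd_meas_const \<phi>(1)]] \<phi>(3)
        by (simp add: circ_mult)
      ultimately show ?thesis by (simp only: step_op_funpow_affine[OF \<phi>(1)])
    qed
    show ?thesis using *[of 1] *[of "-1"] by (simp add: abs_le_iff algebra_simps)
  qed
  then show thesis by (rule that[OF zero_less_Suc \<epsilon>])
qed

lemma geometric_mixing:
  obtains C \<rho> where "0 \<le> C" "0 < \<rho>" "\<rho> < 1"
    "\<And>\<phi> K k y. bdd_meas \<phi> \<Longrightarrow> periodic1 \<phi> \<Longrightarrow> circ \<phi> = 0 \<Longrightarrow> (\<And>z. \<bar>\<phi> z\<bar> \<le> K) \<Longrightarrow>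
       \<bar>(step_op ^^ k) \<phi> y\<bar> \<le> C * \<rho> ^ k * K"
proof -
  obtain m \<epsilon> where m: "0 < m" "0 < \<epsilon>" "\<epsilon> < 1"
    "\<And>\<phi> K y. bdd_meas \<phi> \<Longrightarrow> periodic1 \<phi> \<Longrightarrow> circ \<phi> = 0 \<Longrightarrow> (\<And>z. \<bar>\<phi> z\<bar> \<le> K) \<Longrightarrow>
       \<bar>(step_op ^^ m) \<phi> y\<bar> \<le> (1 - \<epsilon>) * K"
    by (rule funpow_contracts) blast
  define \<rho> where "\<rho> = root m (1 - \<epsilon>)"
  have \<rho>: "0 < \<rho>" "\<rho> < 1" "\<rho> ^ m = 1 - \<epsilon>" using m by (auto simp: \<rho>_def)
  have "\<bar>(step_op ^^ k) \<phi> y\<bar> \<le> 1 / (1 - \<epsilon>) * \<rho> ^ k * K"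
    if \<phi>: "bdd_meas \<phi>" "periodic1 \<phi>" "circ \<phi> = 0" "\<And>z. \<bar>\<phi> z\<bar> \<le> K" for \<phi> K k y
  proof -
    have K: "0 \<le> K" using \<phi>(4)[of 0] by linarith
    have q: "\<bar>(step_op ^^ (m * q)) \<phi> z\<bar> \<le> (1 - \<epsilon>) ^ q * K" for q z
    proof (induction q arbitrary: z)
      case (Suc q)
      have "\<bar>(step_op ^^ m) ((step_op ^^ (m * q)) \<phi>) z\<bar> \<le> (1 - \<epsilon>) * ((1 - \<epsilon>) ^ q * K)"
        using \<phi> Suc by (intro m(4)) (auto simp: bdd_meas_funpow periodic1_funpow circ_funpow)
      then show ?case by (simp add: funpow_add)
    qed (use \<phi> in simp)
    define q r where "q = k div m" and "r = k mod m"
    have k: "k = r + m * q" and r: "r \<le> m" using m(1) by (auto simp: q_def r_def less_imp_le)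
    have "\<bar>(step_op ^^ k) \<phi> y\<bar> \<le> (1 - \<epsilon>) ^ q * K"
      unfolding k funpow_add o_def
      using funpow_bound[OF bdd_meas_funpow[OF \<phi>(1), of "m * q"], of "(1 - \<epsilon>) ^ q * K" r y] q by simp
    also have "(1 - \<epsilon>) ^ q * (1 - \<epsilon>) \<le> (1 - \<epsilon>) ^ q * \<rho> ^ r"
      unfolding \<rho>(3)[symmetric] using \<rho>(1,2) r m(3) by (intro mult_left_mono power_decreasing) auto
    then have "(1 - \<epsilon>) ^ q \<le> 1 / (1 - \<epsilon>) * \<rho> ^ k"
      using m(3) by (simp add: k power_add power_mult \<rho>(3) field_simps)
    then have "(1 - \<epsilon>) ^ q * K \<le> 1 / (1 - \<epsilon>) * \<rho> ^ k * K" using K by (rule mult_right_mono)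
    finally show ?thesis .
  qed
  note bound = this
  have "0 \<le> 1 / (1 - \<epsilon>)" using m by simp
  then show thesis by (rule that[OF _ \<rho>(1,2)]) (rule bound)
qed

text \<open>The solution is \<open>u = \<Sum>\<^sub>k P\<^sup>k \<phi>\<close>; the last conclusion allows its correlations to be computed
  termwise.\<close>

lemma poisson_equation:
  assumes \<phi>: "bdd_meas \<phi>" "periodic1 \<phi>" "circ \<phi> = 0"
  obtains u where "bdd_meas u" "periodic1 u" "\<And>y. u y = \<phi> y + step_op u y"
    "\<And>\<psi>. bdd_meas \<psi> \<Longrightarrow> (\<lambda>k. circ (\<lambda>y. \<psi> y * (step_op ^^ k) \<phi> y)) sums circ (\<lambda>y. \<psi> y * u y)"
proof -
  obtain C \<rho> where C: "0 \<le> C" "0 < \<rho>" "\<rho> < 1"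
    "\<And>\<phi> K k y. bdd_meas \<phi> \<Longrightarrow> periodic1 \<phi> \<Longrightarrow> circ \<phi> = 0 \<Longrightarrow> (\<And>z. \<bar>\<phi> z\<bar> \<le> K) \<Longrightarrow>
       \<bar>(step_op ^^ k) \<phi> y\<bar> \<le> C * \<rho> ^ k * K"
    by (rule geometric_mixing) blast
  obtain K where K: "0 \<le> K" "\<And>y. norm (\<phi> y) \<le> K" using \<phi>(1) by (rule bdd_meas_bound) blast
  define B where "B k = C * \<rho> ^ k * K" for k
  have B: "\<bar>(step_op ^^ k) \<phi> y\<bar> \<le> B k" for k y
    unfolding B_def using \<phi> K by (intro C(4)) auto
  have sB: "summable B" unfolding B_def using C(2,3)
    by (intro summable_mult2 summable_mult summable_geometric) auto
  note bk = bdd_meas_funpow[OF \<phi>(1)]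
  have [measurable]: "(step_op ^^ k) \<phi> \<in> borel_measurable borel" for k using bk by (rule bdd_meas_borel)
  have s: "summable (\<lambda>k. (step_op ^^ k) \<phi> y)" "summable (\<lambda>k. \<bar>(step_op ^^ k) \<phi> y\<bar>)" for y
    by (rule summable_comparison_test[OF _ sB]; use B in auto)+
  define u where "u y = (\<Sum>k. (step_op ^^ k) \<phi> y)" for y
  have "\<bar>u y\<bar> \<le> suminf B" for y
  proof -
    have "\<bar>u y\<bar> \<le> (\<Sum>k. \<bar>(step_op ^^ k) \<phi> y\<bar>)" unfolding u_def by (rule summable_rabs[OF s(2)])
    also have "\<dots> \<le> suminf B" by (rule suminf_le[OF B s(2) sB])
    finally show ?thesis .
  qed
  then have u: "bdd_meas u" unfolding u_def[abs_def] by (intro bdd_measI) auto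
  have p: "periodic1 u" using periodic1_funpow[OF \<phi>(2)] by (auto simp: u_def periodic1_def)
  have "step_op u y = (\<Sum>k. (step_op ^^ Suc k) \<phi> y)" for y
  proof -
    have "summable (\<lambda>k. \<integral>t. norm ((step_op ^^ k) \<phi> (y + t)) \<partial>\<nu>)"
    proof (rule summable_comparison_test[OF _ sB], intro exI allI impI)
      fix k
      have "(\<integral>t. norm ((step_op ^^ k) \<phi> (y + t)) \<partial>\<nu>) \<le> B k"
        using B by (intro integral_le_const integrable_norm integrable_bdd bk) auto
      then show "norm (\<integral>t. norm ((step_op ^^ k) \<phi> (y + t)) \<partial>\<nu>) \<le> B k" by simp
    qed
    then have "(\<integral>t. (\<Sum>k. (step_op ^^ k) \<phi> (y + t)) \<partial>\<nu>) = (\<Sum>k. \<integral>t. (step_op ^^ k) \<phi> (y + t) \<partial>\<nu>)"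
      using s by (intro integral_suminf integrable_bdd bk) auto
    then show ?thesis by (simp add: step_op_def[of u] u_def step_op_def[of "(step_op ^^ _) \<phi>"])
  qed
  moreover have "u y = (\<Sum>k. (step_op ^^ Suc k) \<phi> y) + (step_op ^^ 0) \<phi> y" for y
    unfolding u_def using suminf_split_head[OF s(1), of y] by simp
  ultimately have eq: "u y = \<phi> y + step_op u y" for y by simp
  have "(\<lambda>k. circ (\<lambda>y. \<psi> y * (step_op ^^ k) \<phi> y)) sums circ (\<lambda>y. \<psi> y * u y)"
    if \<psi>: "bdd_meas \<psi>" for \<psi>
  proof -
    obtain L where L: "0 \<le> L" "\<And>y. norm (\<psi> y) \<le> L" using \<psi> by (rule bdd_meas_bound) blast
    have b: "bdd_meas (\<lambda>y. \<psi> y * (step_op ^^ k) \<phi> y)" for k by (intro bdd_meas_intros \<psi> bk)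
    have "norm (\<psi> y * (step_op ^^ k) \<phi> y) \<le> L * B k" for y k
      unfolding norm_mult using L B[of k y] by (intro mult_mono) auto
    then have "(\<integral>y. norm (\<psi> y * (step_op ^^ k) \<phi> y) \<partial>unif) \<le> L * B k" for k
      by (intro unif.integral_le_const integrable_norm integrable_unif b AE_I2)
    then have "summable (\<lambda>k. \<integral>y. norm (\<psi> y * (step_op ^^ k) \<phi> y) \<partial>unif)"
      by (intro summable_comparison_test[OF _ summable_mult[OF sB, of L]] exI[of _ 0] allI impI)
        (simp add: abs_of_nonneg Bochner_Integration.integral_nonneg)
    then have "(\<lambda>k. \<integral>y. \<psi> y * (step_op ^^ k) \<phi> y \<partial>unif) sums (\<integral>y. (\<Sum>k. \<psi> y * (step_op ^^ k) \<phi> y) \<partial>unif)"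
      using s(2) by (intro sums_integral integrable_unif b) (auto simp: abs_mult summable_mult)
    then show ?thesis unfolding circ_def u_def by (simp add: suminf_mult[OF s(1)])
  qed
  then show thesis by (rule that[OF u p eq])
qed


end

section \<open>An approximate eigenfunction of the tilted operators\<close>

locale lil_walk = mixing_walk +
  fixes f :: "real \<Rightarrow> real"
  assumes f: "bdd_meas f" "periodic1 f" "circ f = 0"
begin

text \<open>The asymptotic variance of the partial sums, called \<open>A\<^sub>x\<close> in the theorem.\<close>

definition asym_var :: real where
  "asym_var = circ (\<lambda>y. (f y)\<^sup>2) + 2 * (\<Sum>k. circ (\<lambda>y. f y * (step_op ^^ Suc k) f y))"

lemma summable_correlations: "summable (\<lambda>k. \<bar>circ (\<lambda>y. f y * (step_op ^^ k) f y)\<bar>)"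
proof -
  obtain C \<rho> where C: "0 \<le> C" "0 < \<rho>" "\<rho> < 1"
    "\<And>\<phi> K k y. bdd_meas \<phi> \<Longrightarrow> periodic1 \<phi> \<Longrightarrow> circ \<phi> = 0 \<Longrightarrow> (\<And>z. \<bar>\<phi> z\<bar> \<le> K) \<Longrightarrow>
       \<bar>(step_op ^^ k) \<phi> y\<bar> \<le> C * \<rho> ^ k * K"
    by (rule geometric_mixing) blast
  obtain K where K: "0 \<le> K" "\<And>y. norm (f y) \<le> K" using f(1) by (rule bdd_meas_bound) blast
  have bound: "\<bar>circ (\<lambda>y. f y * (step_op ^^ k) f y)\<bar> \<le> K * (C * \<rho> ^ k * K)" for k
  proof (rule circ_bound)
    show "bdd_meas (\<lambda>y. f y * (step_op ^^ k) f y)" by (intro bdd_meas_intros f bdd_meas_funpow)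
    fix y show "\<bar>f y * (step_op ^^ k) f y\<bar> \<le> K * (C * \<rho> ^ k * K)"
      unfolding abs_mult using K f C(1,2) by (intro mult_mono C(4)) auto
  qed
  have "summable (\<lambda>k. K * (C * \<rho> ^ k * K))"
    using C(2,3) by (intro summable_mult summable_mult2 summable_geometric) auto
  then show ?thesis by (rule summable_comparison_test'[where N=0]) (simp add: bound)
qed

text \<open>Since \<open>P\<close> preserves the mean, the second Poisson equation is solvable only if the mean of
  \<open>f\<^sup>2 / 2 + f a\<close> is \<open>asym_var / 2\<close>. This holds because \<open>a = \<Sum>\<^sub>k P\<^sup>k\<^sup>+\<^sup>1 f\<close>.\<close>

lemma correctors:
  obtains a b where "bdd_meas a" "bdd_meas b"
    "\<And>y. step_op (\<lambda>z. f z + a z) y = a y"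
    "\<And>y. step_op (\<lambda>z. (f z)\<^sup>2 / 2 + f z * a z + b z) y = b y + asym_var / 2"
proof -
  obtain u where u: "bdd_meas u" "periodic1 u" "\<And>y. u y = f y + step_op u y"
    "\<And>\<psi>. bdd_meas \<psi> \<Longrightarrow> (\<lambda>k. circ (\<lambda>y. \<psi> y * (step_op ^^ k) f y)) sums circ (\<lambda>y. \<psi> y * u y)"
    using f by (rule poisson_equation) blast
  define a where "a = step_op u"
  have a: "bdd_meas a" "periodic1 a" "\<And>y. u y = f y + a y"
    using u by (auto simp: a_def bdd_meas_step_op periodic1_step_op)
  have "u = (\<lambda>z. f z + a z)" using a(3) by auto
  then have fa: "step_op (\<lambda>z. f z + a z) y = a y" for y by (simp add: a_def)
  have "(\<lambda>k. circ (\<lambda>y. f y * (step_op ^^ Suc k) f y)) sums (circ (\<lambda>y. f y * u y) - circ (\<lambda>y. f y * f y))"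
    using sums_Suc_imp[where f="\<lambda>k. circ (\<lambda>y. f y * (step_op ^^ k) f y)"] u(4)[OF f(1)]
    by (subst sums_Suc_iff) simp
  then have "(\<Sum>k. circ (\<lambda>y. f y * (step_op ^^ Suc k) f y)) = circ (\<lambda>y. f y * u y) - circ (\<lambda>y. f y * f y)"
    by (rule sums_unique[symmetric])
  also have "\<dots> = circ (\<lambda>y. f y * u y - f y * f y)"
    by (intro circ_diff[symmetric] bdd_meas_intros f u)
  also have "(\<lambda>y. f y * u y - f y * f y) = (\<lambda>y. f y * a y)"
    by (simp add: a(3) algebra_simps)
  finally have var: "asym_var = circ (\<lambda>y. (f y)\<^sup>2) + 2 * circ (\<lambda>y. f y * a y)"
    by (simp add: asym_var_def)
  define h where "h z = (f z)\<^sup>2 / 2 + f z * a z" for z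
  have h: "bdd_meas h" "periodic1 h"
    using bdd_meas_mult[OF f(1) f(1)] bdd_meas_mult[OF f(1) a(1)] f(2) a(2)
      bdd_meas_mult[OF bdd_meas_const[of "1/2"] bdd_meas_mult[OF f(1) f(1)]]
    by (auto simp: h_def[abs_def] power2_eq_square periodic1_def intro!: bdd_meas_add)
  have ch: "circ h = asym_var / 2"
    unfolding h_def[abs_def] var
    using circ_add[OF bdd_meas_mult[OF bdd_meas_const[of "1/2"] bdd_meas_mult[OF f(1) f(1)]] bdd_meas_mult[OF f(1) a(1)]]
      circ_mult[of "1/2" "\<lambda>y. (f y)\<^sup>2"]
    by (simp add: power2_eq_square)
  define F where "F y = step_op h y - asym_var / 2" for y
  have F: "bdd_meas F" "periodic1 F"
    unfolding F_def[abs_def] using periodic1_step_op[OF h(2)]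
    by (auto intro!: bdd_meas_intros bdd_meas_step_op h simp: periodic1_def)
  have "circ F = 0"
    unfolding F_def[abs_def] using circ_diff[OF bdd_meas_step_op[OF h(1)] bdd_meas_const]
    by (simp add: circ_step_op h ch)
  then obtain b where b: "bdd_meas b" "\<And>y. b y = F y + step_op b y"
    using F poisson_equation by blast
  have "step_op (\<lambda>z. h z + b z) y = b y + asym_var / 2" for y
    using step_op_add[OF h(1) b(1)] b(2)[of y] by (simp add: F_def)
  then show thesis using a(1) b(1) fa by (intro that[of a b]) (auto simp: h_def)
qed

end

text \<open>Second order Taylor expansion of \<open>exp (l u)\<close>, multiplied out.\<close>

lemma tilt_expansion:
  fixes l :: complex and u a b F :: real
  assumes l: "norm l \<le> 1" and b: "\<bar>u\<bar> \<le> F" "\<bar>a\<bar> \<le> F" "\<bar>b\<bar> \<le> F" "1 \<le> F"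
  shows "norm (exp (l * u) * (1 + l * a + l\<^sup>2 * b) - (1 + l * (u + a) + l\<^sup>2 * (u\<^sup>2 / 2 + u * a + b)))
     \<le> (exp F * F ^ 3 * (1 + 2 * F) + F\<^sup>2 + F ^ 3 + F ^ 3) * norm l ^ 3"
proof -
  define R where "R = exp (l * u) - (1 + l * u + (l * u)\<^sup>2 / 2)"
  have lu: "norm (l * u) \<le> norm l * F"
    using b by (simp add: norm_mult mult_left_mono)
  then have lu': "norm (l * u) \<le> F" using l b(4) by (smt (verit) mult_left_le_one_le norm_ge_zero)
  have "norm R \<le> exp \<bar>Re (l * u)\<bar> * norm (l * u) ^ 3 / 2"
    using Taylor_exp[of "l * u" 2] by (simp add: R_def numeral_2_eq_2 numeral_3_eq_3 del: power_Suc)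
  also have "\<dots> \<le> exp F * (norm l * F) ^ 3"
  proof -
    have "\<bar>Re (l * u)\<bar> \<le> F" using abs_Re_le_cmod[of "l * u"] lu' by linarith
    then have "exp \<bar>Re (l * u)\<bar> * norm (l * u) ^ 3 \<le> exp F * (norm l * F) ^ 3"
      using lu by (intro mult_mono power_mono) auto
    moreover have "0 \<le> exp F * (norm l * F) ^ 3" using b(4) by simp
    ultimately show ?thesis by linarith
  qed
  finally have R: "norm R \<le> exp F * F ^ 3 * norm l ^ 3" by (simp add: power_mult_distrib mult_ac)
  have l2: "norm l ^ 2 \<le> 1" "norm l ^ 4 \<le> norm l ^ 3" using l
    by (auto simp: power_le_one power_decreasing)
  have "norm (1 + l * a + l\<^sup>2 * b) \<le> 1 + norm l * \<bar>a\<bar> + norm l ^ 2 * \<bar>b\<bar>"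
    using norm_triangle_ineq[of "1 + l * a" "l\<^sup>2 * b"] norm_triangle_ineq[of 1 "l * a"]
    by (simp add: norm_mult norm_power)
  also have "\<dots> \<le> 1 + 1 * F + 1 * F"
    using l l2 b by (intro add_mono mult_mono) auto
  finally have psi: "norm (1 + l * a + l\<^sup>2 * b) \<le> 1 + 2 * F" by simp
  have eq: "exp (l * u) * (1 + l * a + l\<^sup>2 * b) - (1 + l * (u + a) + l\<^sup>2 * (u\<^sup>2 / 2 + u * a + b))
    = R * (1 + l * a + l\<^sup>2 * b) + l ^ 3 * of_real (u * b + u\<^sup>2 * a / 2) + l ^ 4 * of_real (u\<^sup>2 * b / 2)"
    unfolding R_def by (simp add: algebra_simps power2_eq_square power3_eq_cube power4_eq_xxxx)
  have n1: "norm (R * (1 + l * a + l\<^sup>2 * b)) \<le> (exp F * F ^ 3 * norm l ^ 3) * (1 + 2 * F)"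
    unfolding norm_mult using R psi b(4) by (intro mult_mono) auto
  have ub: "\<bar>u * b\<bar> \<le> F * F" "\<bar>u\<^sup>2 * a\<bar> \<le> F\<^sup>2 * F" "\<bar>u\<^sup>2 * b\<bar> \<le> F\<^sup>2 * F"
    unfolding abs_mult using b power_mono[OF b(1), of 2] by (intro mult_mono; simp)+
  then have "\<bar>u * b + u\<^sup>2 * a / 2\<bar> \<le> F\<^sup>2 + F ^ 3" "\<bar>u\<^sup>2 * b / 2\<bar> \<le> F ^ 3"
    by (simp_all add: power2_eq_square power3_eq_cube abs_le_iff)
  then have n2: "norm (l ^ 3 * of_real (u * b + u\<^sup>2 * a / 2)) \<le> norm l ^ 3 * (F\<^sup>2 + F ^ 3)"
    and n3: "norm (l ^ 4 * of_real (u\<^sup>2 * b / 2)) \<le> norm l ^ 3 * F ^ 3"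
    unfolding norm_mult norm_power norm_of_real using l2 by (intro mult_mono; simp)+
  show ?thesis unfolding eq
    using norm_triangle_ineq[of "R * (1 + l * a + l\<^sup>2 * b) + l ^ 3 * of_real (u * b + u\<^sup>2 * a / 2)" "l ^ 4 * of_real (u\<^sup>2 * b / 2)"]
      norm_triangle_ineq[of "R * (1 + l * a + l\<^sup>2 * b)" "l ^ 3 * of_real (u * b + u\<^sup>2 * a / 2)"]
      n1 n2 n3 by (simp add: algebra_simps)
qed

context lil_walk
begin

text \<open>The correctors are chosen so that \<open>P\<close> maps the coefficients of \<open>l\<close> and \<open>l\<^sup>2\<close> in the expansion to
  those of \<open>(1 + l\<^sup>2 A / 2) (1 + l a + l\<^sup>2 b)\<close>.\<close>

lemma approximate_eigenfunction:
  obtains a b :: "real \<Rightarrow> real" and F K :: real where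
    "bdd_meas a" "bdd_meas b" "1 \<le> F" "\<And>y. \<bar>a y\<bar> \<le> F" "\<And>y. \<bar>b y\<bar> \<le> F" "0 \<le> K"
    "\<And>l y. norm l \<le> 1 \<Longrightarrow>
       norm (step_op (\<lambda>z. exp (l * complex_of_real (f z)) * (1 + l * of_real (a z) + l\<^sup>2 * of_real (b z))) y
         - (1 + l\<^sup>2 * of_real asym_var / 2) * (1 + l * of_real (a y) + l\<^sup>2 * of_real (b y))) \<le> K * norm l ^ 3"
proof -
  obtain a b where ab: "bdd_meas a" "bdd_meas b"
    "\<And>y. step_op (\<lambda>z. f z + a z) y = a y"
    "\<And>y. step_op (\<lambda>z. (f z)\<^sup>2 / 2 + f z * a z + b z) y = b y + asym_var / 2"
    by (rule correctors) blast
  obtain F1 F2 F3 where F123: "\<And>y. norm (f y) \<le> F1" "\<And>y. norm (a y) \<le> F2" "\<And>y. norm (b y) \<le> F3"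
    using f(1) ab(1,2) by (metis bdd_meas_bound)
  define F where "F = max 1 (max F1 (max F2 F3))"
  have F: "1 \<le> F" "\<bar>f y\<bar> \<le> F" "\<bar>a y\<bar> \<le> F" "\<bar>b y\<bar> \<le> F" for y
    using F123(1)[of y] F123(2)[of y] F123(3)[of y] by (auto simp: F_def)
  define K where "K = exp F * F ^ 3 * (1 + 2 * F) + F\<^sup>2 + F ^ 3 + F ^ 3"
  have K: "0 \<le> K" unfolding K_def using F(1) by (intro add_nonneg_nonneg mult_nonneg_nonneg) auto
  note [measurable] = f(1)[THEN bdd_meas_borel] ab(1,2)[THEN bdd_meas_borel]
  have h: "bdd_meas (\<lambda>z. (f z)\<^sup>2 / 2 + f z * a z + b z)"
    using bdd_meas_mult[OF bdd_meas_const[of "1/2"] bdd_meas_mult[OF f(1) f(1)]]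
      bdd_meas_mult[OF f(1) ab(1)] ab(2)
    by (auto simp: power2_eq_square intro!: bdd_meas_add)
  have "norm (step_op (\<lambda>z. exp (l * complex_of_real (f z)) * (1 + l * of_real (a z) + l\<^sup>2 * of_real (b z))) y
         - (1 + l\<^sup>2 * of_real asym_var / 2) * (1 + l * of_real (a y) + l\<^sup>2 * of_real (b y)))
        \<le> (K + F * \<bar>asym_var\<bar>) * norm l ^ 3" if l: "norm l \<le> 1" for l :: complex and y
  proof -
    let ?G = "\<lambda>z. exp (l * of_real (f z)) * (1 + l * of_real (a z) + l\<^sup>2 * of_real (b z))"
    let ?Q = "\<lambda>z. 1 + l * of_real (f z + a z) + l\<^sup>2 * of_real ((f z)\<^sup>2 / 2 + f z * a z + b z)"
    have GQ: "norm (?G z - ?Q z) \<le> K * norm l ^ 3" for z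
      using tilt_expansion[OF l F(2,3,4,1), of z z z] by (simp add: K_def)
    have Q: "bdd_meas ?Q" by (intro bdd_meas_intros h f ab)
    have D: "bdd_meas (\<lambda>z. ?G z - ?Q z)" by (rule bdd_measI[OF _ GQ]) measurable
    have G: "bdd_meas ?G" using bdd_meas_add[OF D Q] by simp
    have 1: "norm (step_op ?G y - step_op ?Q y) \<le> K * norm l ^ 3"
      using step_op_bound[OF D GQ, of y] by (simp only: step_op_diff[OF G Q])
    have "step_op ?Q y = 1 + l * of_real (a y) + l\<^sup>2 * of_real (b y + asym_var / 2)"
    proof -
      have q1: "bdd_meas (\<lambda>z. l * complex_of_real (f z + a z))"
        and q2: "bdd_meas (\<lambda>z. l\<^sup>2 * complex_of_real ((f z)\<^sup>2 / 2 + f z * a z + b z))"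
        by (intro bdd_meas_intros h f ab)+
      show ?thesis
        unfolding step_op_add[OF bdd_meas_add[OF bdd_meas_const q1] q2] step_op_add[OF bdd_meas_const q1]
        by (simp only: step_op_const step_op_mult_left step_op_of_real ab)
    qed
    then have eq: "step_op ?Q y - (1 + l\<^sup>2 * of_real asym_var / 2) * (1 + l * of_real (a y) + l\<^sup>2 * of_real (b y))
       = - (l ^ 3 * of_real (a y * asym_var / 2)) - l ^ 4 * of_real (b y * asym_var / 2)"
      by (simp add: algebra_simps power2_eq_square power3_eq_cube power4_eq_xxxx)
    have l4: "norm l ^ 4 \<le> norm l ^ 3" using l by (auto simp: power_decreasing)
    have "\<bar>a y * asym_var / 2\<bar> \<le> F * \<bar>asym_var\<bar> / 2" "\<bar>b y * asym_var / 2\<bar> \<le> F * \<bar>asym_var\<bar> / 2"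
      using F(3,4)[of y] by (auto simp: abs_mult intro!: mult_right_mono)
    then have "norm (l ^ 3 * complex_of_real (a y * asym_var / 2)) \<le> norm l ^ 3 * (F * \<bar>asym_var\<bar> / 2)"
      "norm (l ^ 4 * complex_of_real (b y * asym_var / 2)) \<le> norm l ^ 3 * (F * \<bar>asym_var\<bar> / 2)"
      unfolding norm_mult norm_power norm_of_real using l4 by (intro mult_mono; simp)+
    then have 2: "norm (- (l ^ 3 * complex_of_real (a y * asym_var / 2)) - l ^ 4 * complex_of_real (b y * asym_var / 2))
        \<le> F * \<bar>asym_var\<bar> * norm l ^ 3"
      using norm_triangle_ineq4[of "- (l ^ 3 * complex_of_real (a y * asym_var / 2))" "l ^ 4 * complex_of_real (b y * asym_var / 2)"]
      by (simp only: norm_minus_cancel) (simp add: algebra_simps)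
    show ?thesis
      using norm_triangle_ineq[of "step_op ?G y - step_op ?Q y"
          "step_op ?Q y - (1 + l\<^sup>2 * of_real asym_var / 2) * (1 + l * of_real (a y) + l\<^sup>2 * of_real (b y))"] 1 2
      unfolding eq[symmetric] by (simp add: algebra_simps)
  qed
  then show thesis using ab F K by (intro that[of a b F "K + F * \<bar>asym_var\<bar>"]) auto
qed

text \<open>For small real \<open>l\<close> the eigenfunction is close to 1, so the error \<open>O(\<bar>l\<bar>\<^sup>3)\<close> can be absorbed
  into the eigenvalue.\<close>

lemma real_eigenfunction:
  obtains \<psi> :: "real \<Rightarrow> real \<Rightarrow> real" and K l0 where "0 \<le> K" "0 < l0"
    "\<And>l. \<bar>l\<bar> \<le> l0 \<Longrightarrow> bdd_meas (\<psi> l)"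
    "\<And>l y. \<bar>l\<bar> \<le> l0 \<Longrightarrow> 1/2 \<le> \<psi> l y \<and> \<psi> l y \<le> 2"
    "\<And>l y. \<bar>l\<bar> \<le> l0 \<Longrightarrow>
       step_op (\<lambda>z. exp (l * f z) * \<psi> l z) y \<le> exp (l\<^sup>2 * asym_var / 2 + K * \<bar>l\<bar> ^ 3) * \<psi> l y"
proof -
  obtain a b F K where *: "bdd_meas a" "bdd_meas b" "1 \<le> F" "\<And>y. \<bar>a y\<bar> \<le> F" "\<And>y. \<bar>b y\<bar> \<le> F" "0 \<le> K"
    "\<And>l y. norm l \<le> 1 \<Longrightarrow>
       norm (step_op (\<lambda>z. exp (l * complex_of_real (f z)) * (1 + l * of_real (a z) + l\<^sup>2 * of_real (b z))) y
         - (1 + l\<^sup>2 * of_real asym_var / 2) * (1 + l * of_real (a y) + l\<^sup>2 * of_real (b y))) \<le> K * norm l ^ 3"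
    by (rule approximate_eigenfunction) blast
  define \<psi> where "\<psi> l y = 1 + l * a y + l\<^sup>2 * b y" for l y
  define l0 where "l0 = 1 / (4 * F)"
  have l0: "0 < l0" "l0 \<le> 1" using *(3) by (auto simp: l0_def)
  have psi: "1/2 \<le> \<psi> l y \<and> \<psi> l y \<le> 2" if l: "\<bar>l\<bar> \<le> l0" for l y
  proof -
    have 1: "\<bar>l * a y\<bar> \<le> l0 * F" unfolding abs_mult using l * by (intro mult_mono) auto
    have "\<bar>l * (l * b y)\<bar> \<le> 1 * (l0 * F)"
      unfolding abs_mult using l l0 * by (intro mult_mono) auto
    with 1 have "\<bar>l * a y\<bar> + \<bar>l\<^sup>2 * b y\<bar> \<le> 1/2"
      using *(3) by (simp add: l0_def power2_eq_square mult.assoc)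
    then show ?thesis unfolding \<psi>_def by linarith
  qed
  have "step_op (\<lambda>z. exp (l * f z) * \<psi> l z) y \<le> exp (l\<^sup>2 * asym_var / 2 + 2 * K * \<bar>l\<bar> ^ 3) * \<psi> l y"
    if l: "\<bar>l\<bar> \<le> l0" for l y
  proof -
    have "norm (complex_of_real l) \<le> 1" using l l0 by simp
    from *(7)[OF this, of y]
    have "norm (complex_of_real (step_op (\<lambda>z. exp (l * f z) * \<psi> l z) y - (1 + l\<^sup>2 * asym_var / 2) * \<psi> l y)) \<le> K * \<bar>l\<bar> ^ 3"
      unfolding \<psi>_def step_op_of_real[symmetric] of_real_diff by (simp flip: exp_of_real)
    then have "step_op (\<lambda>z. exp (l * f z) * \<psi> l z) y \<le> (1 + l\<^sup>2 * asym_var / 2) * \<psi> l y + K * \<bar>l\<bar> ^ 3"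
      unfolding norm_of_real by linarith
    also have "K * \<bar>l\<bar> ^ 3 \<le> (2 * K * \<bar>l\<bar> ^ 3) * \<psi> l y"
      using psi[OF l, of y] *(6) mult_left_mono[of "1/2" "\<psi> l y" "2 * K * \<bar>l\<bar> ^ 3"] by simp
    finally have "step_op (\<lambda>z. exp (l * f z) * \<psi> l z) y \<le> (1 + (l\<^sup>2 * asym_var / 2 + 2 * K * \<bar>l\<bar> ^ 3)) * \<psi> l y"
      by (simp add: algebra_simps)
    also have "\<dots> \<le> exp (l\<^sup>2 * asym_var / 2 + 2 * K * \<bar>l\<bar> ^ 3) * \<psi> l y"
      using psi[OF l, of y] by (intro mult_right_mono exp_ge_add_one_self) auto
    finally show ?thesis .
  qed
  moreover have "bdd_meas (\<psi> l)" for l unfolding \<psi>_def[abs_def] by (intro bdd_meas_intros *)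
  ultimately show thesis using that[of "2 * K" l0 \<psi>] *(6) l0(1) psi by auto
qed

end

section \<open>Powers of the operators with an imaginary tilt\<close>

context lil_walk
begin

definition tilt :: "real \<Rightarrow> (real \<Rightarrow> complex) \<Rightarrow> real \<Rightarrow> complex" where
  "tilt \<theta> u = step_op (\<lambda>z. exp (\<i> * \<theta> * f z) * u z)"

lemma norm_exp_i [simp]: "norm (exp (\<i> * complex_of_real \<theta> * complex_of_real x)) = 1"
  by (simp add: norm_exp_eq_Re)

lemma bdd_meas_exp_i: "bdd_meas (\<lambda>z. exp (\<i> * complex_of_real \<theta> * complex_of_real (f z)))"
proof -
  note [measurable] = f(1)[THEN bdd_meas_borel]
  show ?thesis
  proof (rule bdd_measI)
    show "(\<lambda>z. exp (\<i> * complex_of_real \<theta> * complex_of_real (f z))) \<in> borel_measurable borel"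
      by measurable
    show "norm (exp (\<i> * complex_of_real \<theta> * complex_of_real (f z))) \<le> 1" for z
      by (simp only: norm_exp_i)
  qed
qed

lemma bdd_meas_tilt: "bdd_meas u \<Longrightarrow> bdd_meas (tilt \<theta> u)"
  unfolding tilt_def by (intro bdd_meas_step_op bdd_meas_mult bdd_meas_exp_i)

lemma bdd_meas_tilt_funpow: "bdd_meas u \<Longrightarrow> bdd_meas ((tilt \<theta> ^^ n) u)"
  by (induction n) (auto simp: bdd_meas_tilt)

lemma tilt_bound:
  assumes "bdd_meas u" "\<And>y. norm (u y) \<le> K" shows "norm (tilt \<theta> u y) \<le> K"
  unfolding tilt_def
  by (rule step_op_bound) (use assms in \<open>auto intro!: bdd_meas_mult bdd_meas_exp_i simp: norm_mult\<close>)

lemma tilt_funpow_bound: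
  assumes "bdd_meas u" "\<And>y. norm (u y) \<le> K" shows "norm ((tilt \<theta> ^^ n) u y) \<le> K"
proof (induction n arbitrary: y)
  case (Suc n)
  then show ?case using tilt_bound[OF bdd_meas_tilt_funpow[OF assms(1)]] by simp
qed (use assms in simp)

lemma tilt_diff:
  assumes "bdd_meas u" "bdd_meas v" shows "tilt \<theta> (\<lambda>y. u y - v y) y = tilt \<theta> u y - tilt \<theta> v y"
  unfolding tilt_def
  using step_op_diff[OF bdd_meas_mult[OF bdd_meas_exp_i assms(1)] bdd_meas_mult[OF bdd_meas_exp_i assms(2)]]
  by (simp add: algebra_simps)

lemma tilt_mult: "tilt \<theta> (\<lambda>y. c * u y) y = c * tilt \<theta> u y"
  unfolding tilt_def using step_op_mult_left[of c "\<lambda>z. exp (\<i> * \<theta> * f z) * u z"]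
  by (simp add: algebra_simps)

lemma tilt_funpow_diff:
  assumes "bdd_meas u" "bdd_meas v"
  shows "(tilt \<theta> ^^ n) (\<lambda>y. u y - v y) y = (tilt \<theta> ^^ n) u y - (tilt \<theta> ^^ n) v y"
proof (induction n arbitrary: y)
  case (Suc n)
  then have "(tilt \<theta> ^^ n) (\<lambda>y. u y - v y) = (\<lambda>y. (tilt \<theta> ^^ n) u y - (tilt \<theta> ^^ n) v y)" by auto
  then show ?case using tilt_diff[OF bdd_meas_tilt_funpow[OF assms(1)] bdd_meas_tilt_funpow[OF assms(2)]] by simp
qed simp

lemma exp_minus_taylor: "\<bar>exp (- x) - (1 - x)\<bar> \<le> exp \<bar>x\<bar> * x\<^sup>2" for x :: real
  using Taylor_exp_field[of "- x" 1] by (simp add: power2_eq_square)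

text \<open>Iterating the approximate eigenvalue equation \<open>n\<close> times costs at most \<open>n\<close> times the
  one-step error, because the operators \<open>tilt\<close> do not increase the supremum norm.\<close>

lemma tilt_power_limit:
  obtains K where "0 \<le> K"
    "\<And>\<theta> n y. \<bar>\<theta>\<bar> \<le> 1 \<Longrightarrow> norm ((tilt \<theta> ^^ n) (\<lambda>_. 1) y - complex_of_real (exp (- real n * \<theta>\<^sup>2 * asym_var / 2)))
        \<le> K * exp (real n * \<theta>\<^sup>2 * \<bar>asym_var\<bar> / 2) * (\<bar>\<theta>\<bar> + real n * \<bar>\<theta>\<bar> ^ 3)"
proof -
  obtain a b F K where *: "bdd_meas a" "bdd_meas b" "1 \<le> F" "\<And>y. \<bar>a y\<bar> \<le> F" "\<And>y. \<bar>b y\<bar> \<le> F" "0 \<le> K"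
    "\<And>l y. norm l \<le> 1 \<Longrightarrow>
       norm (step_op (\<lambda>z. exp (l * complex_of_real (f z)) * (1 + l * of_real (a z) + l\<^sup>2 * of_real (b z))) y
         - (1 + l\<^sup>2 * of_real asym_var / 2) * (1 + l * of_real (a y) + l\<^sup>2 * of_real (b y))) \<le> K * norm l ^ 3"
    by (rule approximate_eigenfunction) blast
  define A where "A = asym_var"
  define K1 where "K1 = K + (exp \<bar>A / 2\<bar> * (A/2)\<^sup>2) * (1 + 2 * F)"
  define K2 where "K2 = K1 + 4 * F"
  have K1: "0 \<le> K1" using * by (auto simp: K1_def)
  have "norm ((tilt \<theta> ^^ n) (\<lambda>_. 1) y - complex_of_real (exp (- real n * \<theta>\<^sup>2 * A / 2)))
        \<le> K2 * exp (real n * \<theta>\<^sup>2 * \<bar>A\<bar> / 2) * (\<bar>\<theta>\<bar> + real n * \<bar>\<theta>\<bar> ^ 3)" if \<theta>: "\<bar>\<theta>\<bar> \<le> 1" for \<theta> n y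
  proof -
    define \<psi> where "\<psi> z = 1 + (\<i> * \<theta>) * complex_of_real (a z) + (\<i> * \<theta>)\<^sup>2 * complex_of_real (b z)" for z
    define E where "E = exp (- (\<theta>\<^sup>2 * A / 2))"
  \<comment> \<open>a bound for \<open>E ^ n\<close> valid for both signs of \<open>A\<close>: that \<open>A\<close> is nonnegative follows only from this lemma\<close>
    define X where "X n = exp (real n * \<theta>\<^sup>2 * \<bar>A\<bar> / 2)" for n
    have X1: "1 \<le> X n" for n by (auto simp: X_def)
    have Xm: "X n \<le> X m" if "n \<le> m" for n m
      using that by (auto simp: X_def intro!: mult_right_mono)
    have En: "E ^ n = exp (- real n * \<theta>\<^sup>2 * A / 2)" for n
      by (simp add: E_def exp_of_nat_mult[symmetric])
    have EX: "E ^ n \<le> X n" for n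
    proof -
      have "real n * \<theta>\<^sup>2 * (- A) \<le> real n * \<theta>\<^sup>2 * \<bar>A\<bar>" by (intro mult_left_mono) auto
      then show ?thesis unfolding En X_def by simp
    qed
    have E0: "0 \<le> E" by (simp add: E_def)
    have t2: "\<theta>\<^sup>2 \<le> \<bar>\<theta>\<bar>" using \<theta> power_decreasing[of 1 2 "\<bar>\<theta>\<bar>"] by simp
    have b\<psi>: "bdd_meas \<psi>" unfolding \<psi>_def[abs_def] by (intro bdd_meas_intros *)
    have psi1: "norm (\<psi> z - 1) \<le> 2 * F * \<bar>\<theta>\<bar>" for z
    proof -
      have "norm (\<psi> z - 1) \<le> \<bar>\<theta>\<bar> * \<bar>a z\<bar> + \<theta>\<^sup>2 * \<bar>b z\<bar>"
        unfolding \<psi>_def using norm_triangle_ineq[of "(\<i> * \<theta>) * complex_of_real (a z)" "(\<i> * \<theta>)\<^sup>2 * complex_of_real (b z)"]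
        by (simp add: norm_mult norm_power)
      also have "\<dots> \<le> \<bar>\<theta>\<bar> * F + \<bar>\<theta>\<bar> * F"
        using t2 * by (intro add_mono mult_mono) auto
      finally show ?thesis by simp
    qed
    have psi: "norm (\<psi> z) \<le> 1 + 2 * F" for z
    proof -
      have "norm (\<psi> z) \<le> 1 + norm (\<psi> z - 1)" using norm_triangle_ineq[of 1 "\<psi> z - 1"] by simp
      moreover have "2 * F * \<bar>\<theta>\<bar> \<le> 2 * F * 1" using \<theta> *(3) by (intro mult_left_mono) auto
      ultimately show ?thesis using psi1[of z] by simp
    qed
    have one: "norm (tilt \<theta> \<psi> z - E * \<psi> z) \<le> K1 * \<bar>\<theta>\<bar> ^ 3" for z
    proof -
      have "norm (tilt \<theta> \<psi> z - (1 + (\<i> * \<theta>)\<^sup>2 * of_real A / 2) * \<psi> z) \<le> K * \<bar>\<theta>\<bar> ^ 3"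
        using *(7)[of "\<i> * \<theta>" z] \<theta> unfolding tilt_def \<psi>_def A_def by (simp add: norm_mult)
      moreover have "(1 + (\<i> * \<theta>)\<^sup>2 * of_real A / 2) = complex_of_real (1 - \<theta>\<^sup>2 * A / 2)"
        by (simp add: power_mult_distrib)
      ultimately have 1: "norm (tilt \<theta> \<psi> z - complex_of_real (1 - \<theta>\<^sup>2 * A / 2) * \<psi> z) \<le> K * \<bar>\<theta>\<bar> ^ 3" by simp
      have "\<bar>E - (1 - \<theta>\<^sup>2 * A / 2)\<bar> \<le> exp \<bar>\<theta>\<^sup>2 * A / 2\<bar> * (\<theta>\<^sup>2 * A / 2)\<^sup>2"
        unfolding E_def by (rule exp_minus_taylor)
      also have "\<dots> \<le> exp \<bar>A / 2\<bar> * (\<bar>\<theta>\<bar> ^ 3 * (A / 2)\<^sup>2)"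
      proof (intro mult_mono)
        have "\<theta>\<^sup>2 * \<bar>A\<bar> \<le> 1 * \<bar>A\<bar>" using t2 \<theta> by (intro mult_right_mono) auto
        then show "exp \<bar>\<theta>\<^sup>2 * A / 2\<bar> \<le> exp \<bar>A / 2\<bar>" by (simp add: abs_mult)
        have "(\<theta>\<^sup>2 * A / 2)\<^sup>2 = \<bar>\<theta>\<bar> ^ 4 * (A/2)\<^sup>2" by (simp add: power2_eq_square power4_eq_xxxx)
        also have "\<dots> \<le> \<bar>\<theta>\<bar> ^ 3 * (A/2)\<^sup>2" using \<theta> by (intro mult_right_mono power_decreasing) auto
        finally show "(\<theta>\<^sup>2 * A / 2)\<^sup>2 \<le> \<bar>\<theta>\<bar> ^ 3 * (A / 2)\<^sup>2" .
      qed auto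
      finally have e: "\<bar>E - (1 - \<theta>\<^sup>2 * A / 2)\<bar> \<le> exp \<bar>A / 2\<bar> * (A / 2)\<^sup>2 * \<bar>\<theta>\<bar> ^ 3" by (simp add: mult_ac)
      have "norm (complex_of_real (E - (1 - \<theta>\<^sup>2 * A / 2)) * \<psi> z) \<le> (exp \<bar>A / 2\<bar> * (A / 2)\<^sup>2 * \<bar>\<theta>\<bar> ^ 3) * (1 + 2 * F)"
        unfolding norm_mult norm_of_real using e psi[of z] by (intro mult_mono) auto
      moreover have "tilt \<theta> \<psi> z - E * \<psi> z = (tilt \<theta> \<psi> z - complex_of_real (1 - \<theta>\<^sup>2 * A / 2) * \<psi> z)
          - complex_of_real (E - (1 - \<theta>\<^sup>2 * A / 2)) * \<psi> z" by (simp add: algebra_simps)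
      ultimately show ?thesis
        using 1 norm_triangle_ineq4[of "tilt \<theta> \<psi> z - complex_of_real (1 - \<theta>\<^sup>2 * A / 2) * \<psi> z"
          "complex_of_real (E - (1 - \<theta>\<^sup>2 * A / 2)) * \<psi> z"] by (simp add: K1_def algebra_simps)
    qed
    have many: "norm ((tilt \<theta> ^^ n) \<psi> z - complex_of_real E ^ n * \<psi> z) \<le> real n * X n * (K1 * \<bar>\<theta>\<bar> ^ 3)" for n z
    proof (induction n arbitrary: z)
      case (Suc n)
      note bn = bdd_meas_tilt_funpow[OF b\<psi>, where \<theta>=\<theta> and n=n]
      have bE: "bdd_meas (\<lambda>z. complex_of_real E ^ n * \<psi> z)" by (intro bdd_meas_intros b\<psi>)
      have "(tilt \<theta> ^^ Suc n) \<psi> z - complex_of_real E ^ Suc n * \<psi> z =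
         tilt \<theta> (\<lambda>z. (tilt \<theta> ^^ n) \<psi> z - complex_of_real E ^ n * \<psi> z) z + complex_of_real E ^ n * (tilt \<theta> \<psi> z - E * \<psi> z)"
        unfolding tilt_diff[OF bn bE] tilt_mult by (simp add: algebra_simps)
      moreover have "norm (tilt \<theta> (\<lambda>z. (tilt \<theta> ^^ n) \<psi> z - complex_of_real E ^ n * \<psi> z) z) \<le> real n * X n * (K1 * \<bar>\<theta>\<bar> ^ 3)"
        using Suc bdd_meas_diff[OF bn bE] by (intro tilt_bound) auto
      moreover have "norm (complex_of_real E ^ n * (tilt \<theta> \<psi> z - E * \<psi> z)) \<le> X n * (K1 * \<bar>\<theta>\<bar> ^ 3)"
        unfolding norm_mult using one[of z] EX[of n] E0 X1[of n] by (intro mult_mono) (auto simp: norm_power)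
      ultimately have "norm ((tilt \<theta> ^^ Suc n) \<psi> z - complex_of_real E ^ Suc n * \<psi> z)
          \<le> real n * X n * (K1 * \<bar>\<theta>\<bar> ^ 3) + X n * (K1 * \<bar>\<theta>\<bar> ^ 3)"
        using norm_triangle_mono by (metis (no_types, lifting))
      also have "\<dots> = real (Suc n) * X n * (K1 * \<bar>\<theta>\<bar> ^ 3)" by (simp add: algebra_simps)
      also have "\<dots> \<le> real (Suc n) * X (Suc n) * (K1 * \<bar>\<theta>\<bar> ^ 3)"
        using Xm[of n "Suc n"] K1 by (intro mult_right_mono mult_left_mono) auto
      finally show ?case .
    qed simp
    have b1: "bdd_meas (\<lambda>z. 1 - \<psi> z)" by (intro bdd_meas_intros b\<psi>)
    have first: "norm ((tilt \<theta> ^^ n) (\<lambda>z. 1 - \<psi> z) y) \<le> 2 * F * \<bar>\<theta>\<bar>"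
      using psi1 by (intro tilt_funpow_bound b1) (simp add: norm_minus_commute)
    have last: "norm (complex_of_real E ^ n * (\<psi> y - 1)) \<le> X n * (2 * F * \<bar>\<theta>\<bar>)"
      unfolding norm_mult using psi1[of y] EX[of n] E0 X1[of n] by (intro mult_mono) (auto simp: norm_power)
    have "(tilt \<theta> ^^ n) (\<lambda>_. 1) y - complex_of_real E ^ n = (tilt \<theta> ^^ n) (\<lambda>z. 1 - \<psi> z) y
       + ((tilt \<theta> ^^ n) \<psi> y - complex_of_real E ^ n * \<psi> y) + complex_of_real E ^ n * (\<psi> y - 1)"
      unfolding tilt_funpow_diff[OF bdd_meas_const b\<psi>] by (simp add: algebra_simps)
    also have "norm \<dots> \<le> 2 * F * \<bar>\<theta>\<bar> + real n * X n * (K1 * \<bar>\<theta>\<bar> ^ 3) + X n * (2 * F * \<bar>\<theta>\<bar>)"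
      by (intro norm_triangle_mono first many last)
    also have "\<dots> \<le> X n * (2 * F * \<bar>\<theta>\<bar>) + real n * X n * (K1 * \<bar>\<theta>\<bar> ^ 3) + X n * (2 * F * \<bar>\<theta>\<bar>)"
      using mult_right_mono[OF X1[of n], of "2 * F * \<bar>\<theta>\<bar>"] *(3) by (simp add: mult.commute)
    also have "\<dots> = X n * (4 * F * \<bar>\<theta>\<bar>) + X n * (K1 * (real n * \<bar>\<theta>\<bar> ^ 3))" by (simp add: algebra_simps)
    also have "\<dots> \<le> X n * (K2 * \<bar>\<theta>\<bar>) + X n * (K2 * (real n * \<bar>\<theta>\<bar> ^ 3))"
      using X1[of n] K1 *(3) by (intro add_mono mult_left_mono mult_right_mono) (auto simp: K2_def)
    finally show ?thesis unfolding En[symmetric] X_def[symmetric] of_real_power by (simp add: algebra_simps)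
  qed
  moreover have "0 \<le> K2" using K1 *(3) by (simp add: K2_def)
  ultimately show thesis using that[of K2] by (auto simp: A_def)
qed

end

section \<open>Partial sums along the walk\<close>

text \<open>The walk is realized on streams of steps, so that conditioning on the first step becomes the
  decomposition of a stream into head and tail.\<close>

primrec walk_pos :: "nat \<Rightarrow> real \<Rightarrow> real stream \<Rightarrow> real" where
  "walk_pos 0 y s = y"
| "walk_pos (Suc n) y s = walk_pos n (y + shd s) (stl s)"

primrec walk_sum :: "(real \<Rightarrow> real) \<Rightarrow> nat \<Rightarrow> real \<Rightarrow> real stream \<Rightarrow> real" where
  "walk_sum f 0 y s = 0"
| "walk_sum f (Suc n) y s = f (y + shd s) + walk_sum f n (y + shd s) (stl s)"

lemma walk_sum_add:
  "walk_sum f (m + n) y s = walk_sum f m y s + walk_sum f n (walk_pos m y s) (sdrop m s)"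
  by (induction m arbitrary: y s) auto

lemma walk_sum_eq: "walk_sum f n y s = (\<Sum>k=1..n. f (walk_pos k y s))"
proof (induction n arbitrary: y s)
  case (Suc n)
  have "(\<Sum>k=1..Suc n. f (walk_pos k y s)) = f (walk_pos 1 y s) + (\<Sum>k=Suc 1..Suc n. f (walk_pos k y s))"
    by (rule sum.atLeast_Suc_atMost) simp
  also have "(\<Sum>k=Suc 1..Suc n. f (walk_pos k y s)) = (\<Sum>k=1..n. f (walk_pos (Suc k) y s))"
    by (rule sum.shift_bounds_cl_Suc_ivl)
  finally show ?case using Suc by simp
qed simp

lemma walk_pos_to_stream: "walk_pos n y (to_stream X) = y + (\<Sum>j<n. X j)"
proof (induction n arbitrary: y X)
  case (Suc n)
  have "case_nat (X 0) (\<lambda>j. X (Suc j)) = X" by (rule ext) (simp split: nat.split)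
  then have "to_stream X = X 0 ## to_stream (\<lambda>j. X (Suc j))"
    using to_stream_nat_case[of "X 0" "\<lambda>j. X (Suc j)"] by simp
  then show ?case using Suc by (simp add: sum.lessThan_Suc_shift add.assoc del: sum.lessThan_Suc)
qed simp

lemma abs_walk_sum_le:
  assumes "\<And>z. \<bar>f z\<bar> \<le> F" shows "\<bar>walk_sum f n y s\<bar> \<le> real n * F"
proof (induction n arbitrary: y s)
  case (Suc n)
  show ?case using assms[of "y + shd s"] Suc[of "y + shd s" "stl s"] by (simp add: algebra_simps)
qed simp

context random_walk
begin

abbreviation "paths \<equiv> stream_space \<nu>"

lemma prob_space_paths: "prob_space paths"
  by (rule prob_space_stream_space)

sublocale paths: prob_space paths by (rule prob_space_paths)

lemma space_paths [simp]: "space paths = UNIV"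
  by (simp add: space_stream_space)

lemma sets_Collect_paths: "Measurable.pred paths P \<Longrightarrow> {s. P s} \<in> sets paths"
  unfolding pred_def by simp

lemma measurable_shd_borel [measurable (raw)]:
  assumes [measurable]: "h \<in> measurable N paths" shows "(\<lambda>x. shd (h x)) \<in> borel_measurable N"
proof -
  have "(\<lambda>x. shd (h x)) \<in> measurable N \<nu>" by measurable
  then show ?thesis by (simp cong: measurable_cong_sets add: sets_nu)
qed

lemma measurable_walk_pos [measurable (raw)]:
  assumes "g \<in> borel_measurable N" "h \<in> measurable N paths"
  shows "(\<lambda>x. walk_pos n (g x) (h x)) \<in> borel_measurable N"
  using assms
proof (induction n arbitrary: g h)
  case (Suc n)
  note Suc.prems[measurable]
  show ?case unfolding walk_pos.simps by (rule Suc.IH) measurable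
qed simp

lemma measurable_walk_sum [measurable (raw)]:
  assumes [measurable]: "f \<in> borel_measurable borel"
  assumes "g \<in> borel_measurable N" "h \<in> measurable N paths"
  shows "(\<lambda>x. walk_sum f n (g x) (h x)) \<in> borel_measurable N"
  using assms(2,3)
proof (induction n arbitrary: g h)
  case (Suc n)
  note Suc.prems[measurable]
  show ?case unfolding walk_sum.simps
    by (intro borel_measurable_add Suc.IH) measurable
qed simp

text \<open>The Markov property at a fixed time, by induction on \<open>n\<close>: the tail of a stream is independent
  of its head and has the same law as the whole stream.\<close>

lemma markov_property:
  assumes "f \<in> borel_measurable borel"
    and "(\<lambda>(w, z, s). H w z s) \<in> borel_measurable (borel \<Otimes>\<^sub>M borel \<Otimes>\<^sub>M paths)"
  shows "(\<integral>\<^sup>+s. H (walk_sum f n y s) (walk_pos n y s) (sdrop n s) \<partial>paths)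
    = (\<integral>\<^sup>+s. (\<integral>\<^sup>+s'. H (walk_sum f n y s) (walk_pos n y s) s' \<partial>paths) \<partial>paths)"
  using assms(2)
proof (induction n arbitrary: y H)
  case 0
  then show ?case using paths.emeasure_space_1 by simp
next
  case (Suc n)
  note [measurable] = assms(1)
  have H: "(\<lambda>x. H (a x) (b x) (c x)) \<in> borel_measurable N"
    if "a \<in> borel_measurable N" "b \<in> borel_measurable N" "c \<in> measurable N paths" for a b c and N :: "'c measure"
    using measurable_compose[OF measurable_Pair[OF that(1) measurable_Pair[OF that(2,3)]] Suc.prems] by simp
  note [measurable (raw)] = H
  have "(\<integral>\<^sup>+s. H (walk_sum f (Suc n) y s) (walk_pos (Suc n) y s) (sdrop (Suc n) s) \<partial>paths)
     = (\<integral>\<^sup>+t. (\<integral>\<^sup>+s. H (f (y + t) + walk_sum f n (y + t) s) (walk_pos n (y + t) s) (sdrop n s) \<partial>paths) \<partial>\<nu>)"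
    by (subst nn_integral_stream_space) auto
  also have "\<dots> = (\<integral>\<^sup>+t. (\<integral>\<^sup>+s. (\<integral>\<^sup>+s'. H (f (y + t) + walk_sum f n (y + t) s) (walk_pos n (y + t) s) s' \<partial>paths) \<partial>paths) \<partial>\<nu>)"
    by (intro nn_integral_cong Suc.IH) measurable
  also have "\<dots> = (\<integral>\<^sup>+s. (\<integral>\<^sup>+s'. H (walk_sum f (Suc n) y s) (walk_pos (Suc n) y s) s' \<partial>paths) \<partial>paths)"
    by (subst nn_integral_stream_space) auto
  finally show ?case .
qed

lemma integral_paths:
  fixes F :: "real stream \<Rightarrow> 'b::{banach, second_countable_topology}"
  assumes [measurable]: "F \<in> borel_measurable paths" and F: "\<And>s. norm (F s) \<le> K"
  shows "(\<integral>s. F s \<partial>paths) = (\<integral>t. (\<integral>s. F (t ## s) \<partial>paths) \<partial>\<nu>)"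
proof -
  have eq: "paths = distr (\<nu> \<Otimes>\<^sub>M paths) paths (\<lambda>(t, s). t ## s)"
  proof (rule measure_eqI)
    fix A assume [measurable]: "A \<in> sets paths"
    have "emeasure paths A = (\<integral>\<^sup>+s. indicator A s \<partial>paths)" by simp
    also have "\<dots> = (\<integral>\<^sup>+t. (\<integral>\<^sup>+s. indicator A (t ## s) \<partial>paths) \<partial>\<nu>)"
      by (rule nn_integral_stream_space[of "indicator A"]) measurable
    also have "\<dots> = (\<integral>\<^sup>+x. indicator A (case x of (t, s) \<Rightarrow> t ## s) \<partial>(\<nu> \<Otimes>\<^sub>M paths))"
      by (subst paths.nn_integral_fst[symmetric]) auto
    also have "\<dots> = (\<integral>\<^sup>+s. indicator A s \<partial>distr (\<nu> \<Otimes>\<^sub>M paths) paths (\<lambda>(t, s). t ## s))"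
      by (subst nn_integral_distr) auto
    finally show "emeasure paths A = emeasure (distr (\<nu> \<Otimes>\<^sub>M paths) paths (\<lambda>(t, s). t ## s)) A" by simp
  qed simp
  have "(\<integral>s. F s \<partial>paths) = (\<integral>x. F (case x of (t, s) \<Rightarrow> t ## s) \<partial>(\<nu> \<Otimes>\<^sub>M paths))"
    by (subst eq, subst integral_distr) auto
  also have "\<dots> = (\<integral>t. (\<integral>s. F (t ## s) \<partial>paths) \<partial>\<nu>)"
  proof -
    interpret pair_prob_space \<nu> paths ..
    have "integrable (\<nu> \<Otimes>\<^sub>M paths) (\<lambda>(t, s). F (t ## s))"
      using F by (intro integrable_const_bound[where B=K]) auto
    from integral_fst[OF this] show ?thesis by (simp add: case_prod_beta')
  qed
  finally show ?thesis .
qed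

lemma integral_walk_pos:
  fixes \<phi> :: "real \<Rightarrow> 'b::{banach, second_countable_topology}"
  assumes "bdd_meas \<phi>"
  shows "(\<integral>s. \<phi> (walk_pos k y s) \<partial>paths) = (step_op ^^ k) \<phi> y"
proof (induction k arbitrary: y)
  case 0
  then show ?case using paths.prob_space by simp
next
  case (Suc k)
  have [measurable]: "\<phi> \<in> borel_measurable borel" using assms by (rule bdd_meas_borel)
  obtain K where K: "\<And>y. norm (\<phi> y) \<le> K" using assms by (rule bdd_meas_bound) blast
  have "(\<integral>s. \<phi> (walk_pos (Suc k) y s) \<partial>paths) = (\<integral>t. (\<integral>s. \<phi> (walk_pos (Suc k) y (t ## s)) \<partial>paths) \<partial>\<nu>)"
    by (rule integral_paths[OF _ K]) measurable
  also have "\<dots> = (step_op ^^ Suc k) \<phi> y"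
    by (simp add: Suc step_op_def[of "(step_op ^^ k) \<phi>"])
  finally show ?case .
qed

end

context lil_walk
begin

abbreviation "S \<equiv> walk_sum f"

lemmas f_borel [measurable] = bdd_meas_borel[OF f(1)]

lemma char_walk_sum: "(\<integral>s. exp (\<i> * \<theta> * S n y s) \<partial>paths) = (tilt \<theta> ^^ n) (\<lambda>_. 1) y"
proof (induction n arbitrary: y)
  case 0
  then show ?case using paths.prob_space by simp
next
  case (Suc n)
  have "(\<integral>s. exp (\<i> * \<theta> * S (Suc n) y s) \<partial>paths)
    = (\<integral>t. (\<integral>s. exp (\<i> * \<theta> * f (y + t)) * exp (\<i> * \<theta> * S n (y + t) s) \<partial>paths) \<partial>\<nu>)"
    by (subst integral_paths[where K=1]) (auto simp: exp_add[symmetric] algebra_simps norm_exp_i[unfolded mult.assoc])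
  also have "\<dots> = (tilt \<theta> ^^ Suc n) (\<lambda>_. 1) y"
    by (simp add: Suc tilt_def[of \<theta> "(tilt \<theta> ^^ n) (\<lambda>_. 1)"] step_op_def)
  finally show ?case .
qed

text \<open>A negative value would make the limit of the characteristic functions exceed 1.\<close>

lemma asym_var_nonneg: "0 \<le> asym_var"
proof (rule ccontr)
  assume "\<not> 0 \<le> asym_var"
  then have A: "asym_var < 0" by simp
  obtain K where K: "0 \<le> K"
    "\<And>\<theta> n y. \<bar>\<theta>\<bar> \<le> 1 \<Longrightarrow> norm ((tilt \<theta> ^^ n) (\<lambda>_. 1) y - complex_of_real (exp (- real n * \<theta>\<^sup>2 * asym_var / 2)))
        \<le> K * exp (real n * \<theta>\<^sup>2 * \<bar>asym_var\<bar> / 2) * (\<bar>\<theta>\<bar> + real n * \<bar>\<theta>\<bar> ^ 3)"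
    by (rule tilt_power_limit) blast
  define c where "c = exp (\<bar>asym_var\<bar> / 2)"
  have c: "1 < c" using A by (simp add: c_def)
  have "c - 1 \<le> K * c * (2 / sqrt (real n))" if n: "0 < n" for n
  proof -
    define \<theta> where "\<theta> = 1 / sqrt (real n)"
    have \<theta>: "\<bar>\<theta>\<bar> \<le> 1" "0 \<le> \<theta>" "real n * \<theta>\<^sup>2 = 1" using n by (auto simp: \<theta>_def power_divide)
    have "real n * \<theta> ^ 3 = \<theta>" using \<theta>(3) by (simp add: power2_eq_square power3_eq_cube mult_ac)
    then have "norm ((tilt \<theta> ^^ n) (\<lambda>_. 1) 0 - complex_of_real c) \<le> K * c * (2 * \<theta>)"
      using K(2)[OF \<theta>(1), of n 0] \<theta>(2,3) A by (simp add: c_def)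
    moreover have "norm ((tilt \<theta> ^^ n) (\<lambda>_. 1) 0) \<le> 1"
      by (intro tilt_funpow_bound) auto
    moreover have "norm (complex_of_real c) = c" using c by simp
    ultimately have "c - 1 \<le> K * c * (2 * \<theta>)"
      using norm_triangle_ineq2[of "complex_of_real c" "(tilt \<theta> ^^ n) (\<lambda>_. 1) 0"] by (simp only: norm_minus_commute)
    then show ?thesis by (simp add: \<theta>_def)
  qed
  moreover have "(\<lambda>n. K * c * (2 / sqrt (real n))) \<longlonglongrightarrow> 0" by real_asymp
  ultimately have "c - 1 \<le> 0"
    by (intro LIMSEQ_le_const[where X="\<lambda>n. K * c * (2 / sqrt (real n))"]) (auto intro!: exI[of _ 1])
  with c show False by simp
qed


subsection \<open>A maximal inequality and a uniform central limit theorem\<close>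

text \<open>Ville's inequality for the positive supermartingale
  \<open>exp (l * S k - k * \<beta>) * \<psi> (walk_pos k)\<close>, by conditioning on the first step.\<close>

lemma maximal_inequality_aux:
  assumes [measurable]: "bdd_meas \<psi>" and \<psi>: "\<And>y. 0 \<le> \<psi> y"
    and super: "\<And>y. step_op (\<lambda>z. exp (l * f z) * \<psi> z) y \<le> exp \<beta> * \<psi> y"
    and z: "0 \<le> z"
  shows "emeasure paths {s. \<exists>k\<le>n. 1 \<le> z * (exp (l * S k y s - real k * \<beta>) * \<psi> (walk_pos k y s))} \<le> ennreal (z * \<psi> y)"
  using z
proof (induction n arbitrary: y z)
  case 0
  show ?case
  proof (cases "1 \<le> z * \<psi> y")
    case True
    then show ?thesis using order_trans[OF paths.emeasure_le_1, of "ennreal (z * \<psi> y)"] by simp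
  qed auto
next
  case (Suc n)
  have [measurable]: "\<psi> \<in> borel_measurable borel" using assms(1) by (rule bdd_meas_borel)
  show ?case
  proof (cases "1 \<le> z * \<psi> y")
    case True
    then show ?thesis using order_trans[OF paths.emeasure_le_1, of "ennreal (z * \<psi> y)"] by simp
  next
    case False
    \<comment> \<open>after a first step \<open>t\<close> the same event occurs for the walk from \<open>y + t\<close> with this factor\<close>
    define z' where "z' t = z * exp (l * f (y + t) - \<beta>)" for t
    define W where "W m y z s \<longleftrightarrow> (\<exists>k\<le>m. 1 \<le> z * (exp (l * S k y s - real k * \<beta>) * \<psi> (walk_pos k y s)))" for m y z s
    have W: "W (Suc n) y z (t ## s) \<longleftrightarrow> W n (y + t) (z' t) s" for t s
    proof -
      have "(\<exists>k\<le>Suc n. P k) \<longleftrightarrow> P 0 \<or> (\<exists>k\<le>n. P (Suc k))" for P :: "nat \<Rightarrow> bool"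
        by (metis Suc_le_mono le0 not0_implies_Suc)
      moreover have "z * (exp (l * S (Suc k) y (t ## s) - real (Suc k) * \<beta>) * \<psi> (walk_pos (Suc k) y (t ## s)))
        = z' t * (exp (l * S k (y + t) s - real k * \<beta>) * \<psi> (walk_pos k (y + t) s))" for k
        by (simp add: z'_def exp_add exp_diff field_simps)
      ultimately show ?thesis using False by (simp add: W_def del: walk_sum.simps(2) walk_pos.simps(2) of_nat_Suc)
    qed
    have [measurable]: "{s. W m y z s} \<in> sets paths" for m y z
      by (rule sets_Collect_paths) (unfold W_def[abs_def], measurable)
    have "integrable \<nu> (\<lambda>t. exp (l * f (y + t)) * \<psi> (y + t))"
    proof (rule integrable_bdd[where \<phi>="\<lambda>z. exp (l * f z) * \<psi> z"], rule bdd_meas_mult)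
      obtain F where F: "\<And>y. norm (f y) \<le> F" using f(1) by (rule bdd_meas_bound) blast
      have "l * f z \<le> \<bar>l\<bar> * F" for z
        using F[of z] mult_left_mono[of "\<bar>f z\<bar>" F "\<bar>l\<bar>"] abs_ge_self[of "l * f z"] by (simp add: abs_mult)
      then show "bdd_meas (\<lambda>z. exp (l * f z))" by (intro bdd_measI[where K="exp (\<bar>l\<bar> * F)"]) auto
    qed fact
    then have int: "integrable \<nu> (\<lambda>t. z' t * \<psi> (y + t))"
      unfolding z'_def exp_diff by (simp add: field_simps integrable_mult_right)
    have "emeasure paths {s. W (Suc n) y z s} = (\<integral>\<^sup>+t. emeasure paths {s. W n (y + t) (z' t) s} \<partial>\<nu>)"
      by (subst emeasure_stream_space) (auto simp: W)
    also have "\<dots> \<le> (\<integral>\<^sup>+t. ennreal (z' t * \<psi> (y + t)) \<partial>\<nu>)"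
      using Suc.prems unfolding W_def by (intro nn_integral_mono Suc.IH) (simp add: z'_def)
    also have "\<dots> = ennreal (\<integral>t. z' t * \<psi> (y + t) \<partial>\<nu>)"
      using \<psi> Suc.prems by (intro nn_integral_eq_integral int) (auto simp: z'_def)
    also have "\<dots> \<le> ennreal (z * \<psi> y)"
    proof (rule ennreal_leI)
      have "(\<integral>t. z' t * \<psi> (y + t) \<partial>\<nu>) = z * exp (- \<beta>) * step_op (\<lambda>z. exp (l * f z) * \<psi> z) y"
        unfolding step_op_def z'_def integral_mult_right_zero[symmetric] by (simp add: exp_diff exp_minus field_simps)
      also have "\<dots> \<le> z * exp (- \<beta>) * (exp \<beta> * \<psi> y)"
        using Suc.prems by (intro mult_left_mono super) auto
      also have "\<dots> = z * \<psi> y" by (simp add: exp_minus)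
      finally show "(\<integral>t. z' t * \<psi> (y + t) \<partial>\<nu>) \<le> z * \<psi> y" .
    qed
    finally show ?thesis by (simp add: W_def)
  qed
qed

text \<open>On the event in question the supermartingale exceeds \<open>exp (l * t - n * \<beta>) / 2\<close> at time \<open>k\<close>.\<close>

lemma maximal_inequality:
  obtains K l0 where "0 \<le> K" "0 < l0"
    "\<And>l n t y. 0 \<le> l \<Longrightarrow> l \<le> l0 \<Longrightarrow> paths.prob {s. \<exists>k\<le>n. t \<le> S k y s}
        \<le> 4 * exp (real n * (l\<^sup>2 * asym_var / 2 + K * l ^ 3) - l * t)"
proof -
  obtain \<psi> :: "real \<Rightarrow> real \<Rightarrow> real" and K l0 where *: "0 \<le> K" "0 < l0"
    "\<And>l. \<bar>l\<bar> \<le> l0 \<Longrightarrow> bdd_meas (\<psi> l)"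
    "\<And>l y. \<bar>l\<bar> \<le> l0 \<Longrightarrow> 1/2 \<le> \<psi> l y \<and> \<psi> l y \<le> 2"
    "\<And>l y. \<bar>l\<bar> \<le> l0 \<Longrightarrow>
       step_op (\<lambda>z. exp (l * f z) * \<psi> l z) y \<le> exp (l\<^sup>2 * asym_var / 2 + K * \<bar>l\<bar> ^ 3) * \<psi> l y"
    by (rule real_eigenfunction) blast
  have "paths.prob {s. \<exists>k\<le>n. t \<le> S k y s} \<le> 4 * exp (real n * (l\<^sup>2 * asym_var / 2 + K * l ^ 3) - l * t)"
    if l: "0 \<le> l" "l \<le> l0" for l n t y
  proof -
    have l': "\<bar>l\<bar> \<le> l0" using l by simp
    define \<beta> where "\<beta> = l\<^sup>2 * asym_var / 2 + K * l ^ 3"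
    define z where "z = 2 * exp (real n * \<beta> - l * t)"
    have \<beta>: "0 \<le> \<beta>" unfolding \<beta>_def using l *(1) asym_var_nonneg by simp
    have [measurable]: "\<psi> l \<in> borel_measurable borel" using *(3)[OF l'] by (rule bdd_meas_borel)
    have "1 \<le> z * (exp (l * S k y s - real k * \<beta>) * \<psi> l (walk_pos k y s))" if k: "k \<le> n" "t \<le> S k y s" for k s
    proof -
      have "l * t - real n * \<beta> \<le> l * S k y s - real k * \<beta>"
        using k l \<beta> by (intro diff_mono mult_left_mono mult_right_mono) auto
      then have "exp (l * t - real n * \<beta>) * (1/2) \<le> exp (l * S k y s - real k * \<beta>) * \<psi> l (walk_pos k y s)"
        using *(4)[OF l'] by (intro mult_mono) auto
      then have "z * (exp (l * t - real n * \<beta>) * (1/2)) \<le> z * (exp (l * S k y s - real k * \<beta>) * \<psi> l (walk_pos k y s))"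
        by (intro mult_left_mono) (auto simp: z_def)
      then show ?thesis by (simp add: z_def exp_diff)
    qed
    then have "emeasure paths {s. \<exists>k\<le>n. t \<le> S k y s}
        \<le> emeasure paths {s. \<exists>k\<le>n. 1 \<le> z * (exp (l * S k y s - real k * \<beta>) * \<psi> l (walk_pos k y s))}"
      by (intro emeasure_mono sets_Collect_paths) auto
    also have "\<dots> \<le> ennreal (z * \<psi> l y)"
    proof (rule maximal_inequality_aux)
      show "0 \<le> \<psi> l y" for y using *(4)[OF l', of y] by linarith
      show "step_op (\<lambda>z. exp (l * f z) * \<psi> l z) y \<le> exp \<beta> * \<psi> l y" for y
        using *(5)[OF l', of y] l by (simp add: \<beta>_def)
    qed (use *(3)[OF l'] in \<open>auto simp: z_def\<close>)
    also have "\<dots> \<le> ennreal (4 * exp (real n * \<beta> - l * t))"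
      using *(4)[OF l', of y] by (intro ennreal_leI) (simp add: z_def)
    finally show ?thesis
      unfolding paths.emeasure_eq_measure \<beta>_def by (simp add: ennreal_le_iff)
  qed
  with *(1,2) show thesis by (rule that)
qed

text \<open>The central limit theorem, uniformly in the starting point: otherwise the laws along a
  sequence of bad starting points would violate Levy's continuity theorem.\<close>

lemma uniform_clt:
  assumes A: "0 < asym_var" and p: "p < measure std_normal_distribution {c<..}"
  shows "\<exists>n0. \<forall>n\<ge>n0. \<forall>y. p \<le> paths.prob {s. c * sqrt (asym_var * real n) \<le> S n y s}"
proof (rule ccontr)
  assume "\<not> ?thesis"
  then have "\<forall>k. \<exists>n y. Suc k \<le> n \<and> paths.prob {s. c * sqrt (asym_var * real n) \<le> S n y s} < p"
    by (metis not_le)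
  then obtain N Y where NY: "\<And>k. Suc k \<le> N k"
    "\<And>k. paths.prob {s. c * sqrt (asym_var * real (N k)) \<le> S (N k) (Y k) s} < p" by metis
  define \<mu> where "\<mu> k = distr paths borel (\<lambda>s. S (N k) (Y k) s / sqrt (asym_var * real (N k)))" for k
  have Nlim: "filterlim (\<lambda>k. real (N k)) at_top sequentially"
    by (rule filterlim_at_top_mono[OF filterlim_real_sequentially])
      (use NY(1) in \<open>auto intro!: always_eventually simp: Suc_le_eq less_imp_le\<close>)
  have rd: "real_distribution (\<mu> k)" for k unfolding \<mu>_def by (rule paths.real_distribution_distr) measurable
  interpret std: real_distribution std_normal_distribution
    by (rule real_dist_normal_dist)
  have "(\<lambda>k. char (\<mu> k) t) \<longlonglongrightarrow> char std_normal_distribution t" for t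
  proof -
    obtain K where K: "0 \<le> K"
      "\<And>\<theta> n y. \<bar>\<theta>\<bar> \<le> 1 \<Longrightarrow> norm ((tilt \<theta> ^^ n) (\<lambda>_. 1) y - complex_of_real (exp (- real n * \<theta>\<^sup>2 * asym_var / 2)))
        \<le> K * exp (real n * \<theta>\<^sup>2 * \<bar>asym_var\<bar> / 2) * (\<bar>\<theta>\<bar> + real n * \<bar>\<theta>\<bar> ^ 3)"
      by (rule tilt_power_limit) blast
    define \<tau> where "\<tau> = t / sqrt asym_var"
    define \<theta> where "\<theta> k = \<tau> / sqrt (real (N k))" for k
    have N0: "0 < N k" for k using NY(1)[of k] by linarith
    have ch: "char (\<mu> k) t = (tilt (\<theta> k) ^^ N k) (\<lambda>_. 1) (Y k)" for k
    proof -
      have "char (\<mu> k) t = (\<integral>s. exp (\<i> * (t * (S (N k) (Y k) s / sqrt (asym_var * real (N k))))) \<partial>paths)"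
        unfolding char_def \<mu>_def by (subst integral_distr) auto
      also have "\<dots> = (\<integral>s. exp (\<i> * \<theta> k * S (N k) (Y k) s) \<partial>paths)"
        by (intro Bochner_Integration.integral_cong) (auto simp: \<theta>_def \<tau>_def real_sqrt_mult mult_ac)
      finally show ?thesis by (simp add: char_walk_sum)
    qed
    have n\<theta>: "real (N k) * (\<theta> k)\<^sup>2 = \<tau>\<^sup>2" for k using N0[of k] by (simp add: \<theta>_def power_divide)
    have n3: "real (N k) * \<bar>\<theta> k\<bar> ^ 3 = \<tau>\<^sup>2 * \<bar>\<theta> k\<bar>" for k
    proof -
      have "\<bar>\<theta> k\<bar> ^ 3 = (\<theta> k)\<^sup>2 * \<bar>\<theta> k\<bar>" by (simp add: power3_eq_cube power2_eq_square)
      then show ?thesis using n\<theta>[of k] by (simp add: mult.assoc[symmetric])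
    qed
    have \<theta>0: "\<theta> \<longlonglongrightarrow> 0" unfolding \<theta>_def
      by (rule tendsto_divide_0[OF tendsto_const])
        (rule filterlim_at_top_imp_at_infinity[OF filterlim_compose[OF sqrt_at_top Nlim]])
    have t2: "\<tau>\<^sup>2 * asym_var = t\<^sup>2" using A by (simp add: \<tau>_def power_divide)
    have "\<forall>\<^sub>F k in sequentially. norm (\<theta> k) < 1"
      using order_tendstoD(2)[OF tendsto_norm[OF \<theta>0], of 1] by simp
    then have ev: "\<forall>\<^sub>F k in sequentially. norm (char (\<mu> k) t - exp (- (t\<^sup>2) / 2)) \<le> K * exp (t\<^sup>2 / 2) * (\<bar>\<theta> k\<bar> + \<tau>\<^sup>2 * \<bar>\<theta> k\<bar>)"
    proof eventually_elim
      case (elim k)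
      have "- real (N k) * (\<theta> k)\<^sup>2 * asym_var / 2 = - (t\<^sup>2) / 2" "real (N k) * (\<theta> k)\<^sup>2 * \<bar>asym_var\<bar> / 2 = t\<^sup>2 / 2"
        using n\<theta>[of k] t2 A by simp_all
      then show ?case using K(2)[of "\<theta> k" "N k" "Y k"] elim unfolding ch n3 by (simp only:) simp
    qed
    have "(\<lambda>k. K * exp (t\<^sup>2 / 2) * (\<bar>\<theta> k\<bar> + \<tau>\<^sup>2 * \<bar>\<theta> k\<bar>)) \<longlonglongrightarrow> K * exp (t\<^sup>2 / 2) * (\<bar>0\<bar> + \<tau>\<^sup>2 * \<bar>0\<bar>)"
      by (intro tendsto_intros \<theta>0)
    then have "(\<lambda>k. char (\<mu> k) t - exp (- (t\<^sup>2) / 2)) \<longlonglongrightarrow> 0"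
      using ev by (intro Lim_null_comparison[OF ev]) simp
    then show ?thesis unfolding char_std_normal_distribution by (simp add: LIM_zero_iff)
  qed
  then have wc: "weak_conv_m \<mu> std_normal_distribution"
    by (rule levy_continuity[OF rd real_dist_normal_dist])
  have "emeasure std_normal_distribution {c} = 0"
    by (subst emeasure_density) (auto simp: AE_lborel_singleton nn_integral_0_iff_AE)
  then have "isCont (cdf std_normal_distribution) c"
    unfolding std.isCont_cdf by (simp add: measure_def)
  then have "(\<lambda>k. cdf (\<mu> k) c) \<longlonglongrightarrow> cdf std_normal_distribution c"
    using wc unfolding weak_conv_m_def weak_conv_def by blast
  then have "(\<lambda>k. 1 - cdf (\<mu> k) c) \<longlonglongrightarrow> 1 - cdf std_normal_distribution c"
    by (intro tendsto_intros)
  moreover have "1 - cdf (\<mu> k) c \<le> p" for k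
  proof -
    interpret \<mu>: real_distribution "\<mu> k" by (rule rd)
    have pos: "0 < sqrt (asym_var * real (N k))" using A NY(1)[of k] by simp
    have "1 - cdf (\<mu> k) c = measure (\<mu> k) {c<..}"
      using \<mu>.prob_compl[of "{..c}"] by (simp add: cdf_def Compl_eq_Diff_UNIV[symmetric] Compl_atMost)
    also have "\<dots> = paths.prob {s. c < S (N k) (Y k) s / sqrt (asym_var * real (N k))}"
      unfolding \<mu>_def by (subst measure_distr) (auto simp: vimage_def)
    also have "\<dots> \<le> paths.prob {s. c * sqrt (asym_var * real (N k)) \<le> S (N k) (Y k) s}"
      using pos by (intro paths.finite_measure_mono sets_Collect_paths) (auto simp: field_simps)
    finally show ?thesis using NY(2)[of k] by linarith
  qed
  ultimately have "1 - cdf std_normal_distribution c \<le> p"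
    by (intro LIMSEQ_le_const2) auto
  moreover have "1 - cdf std_normal_distribution c = measure std_normal_distribution {c<..}"
    using std.prob_compl[of "{..c}"] by (simp add: cdf_def Compl_eq_Diff_UNIV[symmetric] Compl_atMost)
  ultimately show False using p by simp
qed

end

text \<open>The tail is at least the minimum of the density over \<open>[c, c + 1]\<close>.\<close>

lemma normal_tail_lower:
  assumes "0 < \<delta>"
  obtains c where "0 < c" "exp (- (c\<^sup>2 * (1 + \<delta>) / 2)) < measure std_normal_distribution {c<..}"
proof -
  interpret std: real_distribution std_normal_distribution
    by (rule real_dist_normal_dist)
  have low: "exp (- ((c + 1)\<^sup>2 / 2)) / sqrt (2 * pi) \<le> measure std_normal_distribution {c<..}" if "0 < c" for c
  proof -
    have "ennreal (exp (- ((c + 1)\<^sup>2 / 2)) / sqrt (2 * pi)) = (\<integral>\<^sup>+x. ennreal (exp (- ((c + 1)\<^sup>2 / 2)) / sqrt (2 * pi)) * indicator {c<..c+1} x \<partial>lborel)"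
      by (subst nn_integral_cmult_indicator) auto
    also have "\<dots> \<le> (\<integral>\<^sup>+x. ennreal (std_normal_density x) * indicator {c<..} x \<partial>lborel)"
    proof (intro nn_integral_mono)
      fix x
      have "exp (- ((c + 1)\<^sup>2 / 2)) / sqrt (2 * pi) \<le> std_normal_density x" if "x \<in> {c<..c+1}"
        using that \<open>0 < c\<close> unfolding std_normal_density_def
        by (auto intro!: divide_right_mono power_mono)
      then show "ennreal (exp (- ((c + 1)\<^sup>2 / 2)) / sqrt (2 * pi)) * indicator {c<..c+1} x \<le> ennreal (std_normal_density x) * indicator {c<..} x"
        by (auto split: split_indicator intro!: ennreal_leI)
    qed
    also have "\<dots> = emeasure std_normal_distribution {c<..}" by (subst emeasure_density) auto
    also have "\<dots> = ennreal (measure std_normal_distribution {c<..})" by (rule std.emeasure_eq_measure)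
    finally show ?thesis by (simp add: ennreal_le_iff)
  qed
  have "\<forall>\<^sub>F c in at_top. exp (- (c\<^sup>2 * (1 + \<delta>) / 2)) < exp (- ((c + 1)\<^sup>2 / 2)) / sqrt (2 * pi)"
    using assms by real_asymp
  then have "\<forall>\<^sub>F c in at_top. 0 < c \<and> exp (- (c\<^sup>2 * (1 + \<delta>) / 2)) < exp (- ((c + 1)\<^sup>2 / 2)) / sqrt (2 * pi)"
    using eventually_gt_at_top[of 0] by eventually_elim simp
  then obtain c where "0 < c" "exp (- (c\<^sup>2 * (1 + \<delta>) / 2)) < exp (- ((c + 1)\<^sup>2 / 2)) / sqrt (2 * pi)"
    using eventually_happens'[OF trivial_limit_at_top_linorder] by blast
  moreover from this low[of c] have "exp (- (c\<^sup>2 * (1 + \<delta>) / 2)) < measure std_normal_distribution {c<..}" by linarith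
  ultimately show thesis by (intro that)
qed

section \<open>The upper half of the law of the iterated logarithm\<close>

lemma ex_power_bracket:
  fixes \<theta> x :: real
  assumes "1 < \<theta>" "1 \<le> x"
  obtains j where "\<theta> ^ j \<le> x" "x < \<theta> ^ Suc j"
proof -
  define n where "n = (LEAST n. x < \<theta> ^ n)"
  have n: "x < \<theta> ^ n" unfolding n_def using real_arch_pow[OF assms(1), of x] by (rule LeastI_ex)
  then have "n \<noteq> 0" using assms(2) by (auto intro: ccontr)
  then obtain j where j: "n = Suc j" by (cases n) auto
  have "\<not> x < \<theta> ^ j" using not_less_Least[of j "\<lambda>n. x < \<theta> ^ n"] by (simp add: n_def[symmetric] j)
  then show thesis using n unfolding j by (intro that[of j]) auto
qed

context lil_walk
begin

text \<open>Borel-Cantelli for the events that the sums up to time \<open>\<theta>\<^sup>j\<^sup>+\<^sup>1\<close> ever exceed the boundary at time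
  \<open>\<theta>\<^sup>j\<close>; the maximal inequality bounds their probabilities by a multiple of \<open>j\<^sup>-\<^sup>r\<close>.\<close>

lemma eventually_le_lil:
  assumes \<sigma>: "0 < \<sigma>" "asym_var < \<sigma>\<^sup>2"
  shows "AE s in paths. \<forall>\<^sub>F N in sequentially. S N y s \<le> \<sigma> * sqrt (2 * real N * ln (ln (real N)))"
proof -
  define A where "A = asym_var"
  have A: "0 \<le> A" "A < \<sigma>\<^sup>2" using asym_var_nonneg \<sigma> by (auto simp: A_def)
  \<comment> \<open>close enough to 1 for \<open>\<theta> * A < \<sigma>\<^sup>2\<close>\<close>
  define \<theta> where "\<theta> = 2 * \<sigma>\<^sup>2 / (A + \<sigma>\<^sup>2)"
  have d: "0 < A + \<sigma>\<^sup>2" using A by linarith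
  have \<theta>: "1 < \<theta>" using A d by (simp add: \<theta>_def field_simps)
  have "\<theta> * A < \<sigma>\<^sup>2"
  proof -
    have "2 * A * \<sigma>\<^sup>2 < (A + \<sigma>\<^sup>2) * \<sigma>\<^sup>2" using A by (intro mult_strict_right_mono) auto
    then show ?thesis using d by (simp add: \<theta>_def field_simps)
  qed
  define q where "q = \<theta> * A / \<sigma>\<^sup>2"
  have q: "q < 1" using \<open>\<theta> * A < \<sigma>\<^sup>2\<close> \<sigma> by (simp add: q_def)
  define r where "r = 1 + (1 - q) / 2"
  have r: "1 < r" using q by (simp add: r_def)
  obtain K l0 where K: "0 \<le> K" "0 < l0"
    "\<And>l n t y. 0 \<le> l \<Longrightarrow> l \<le> l0 \<Longrightarrow> paths.prob {s. \<exists>k\<le>n. t \<le> S k y s}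
        \<le> 4 * exp (real n * (l\<^sup>2 * asym_var / 2 + K * l ^ 3) - l * t)"
    by (rule maximal_inequality) blast
  define LL where "LL j = ln (ln (\<theta> ^ j))" for j
  \<comment> \<open>nearly optimal tilt: \<open>l * t = 2 * LL\<close>, while the quadratic term of the exponent is \<open>q * LL\<close>
    with \<open>q < 1\<close>\<close>
  define l where "l j = sqrt (2 * LL j / \<theta> ^ j) / \<sigma>" for j
  define t where "t j = \<sigma> * sqrt (2 * \<theta> ^ j * LL j)" for j
  define n where "n j = nat \<lfloor>\<theta> ^ Suc j\<rfloor>" for j
  define B where "B j = {s. \<exists>k\<le>n j. t j \<le> S k y s}" for j
  have B[measurable]: "B j \<in> sets paths" for j
    unfolding B_def by (rule sets_Collect_paths) measurable
  have ln\<theta>: "0 < ln \<theta>" using \<theta> by simp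
  have LL_eq: "LL j = ln (real j * ln \<theta>)" for j using \<theta> by (simp add: LL_def ln_realpow)
  have "\<forall>\<^sub>F j in sequentially. 1 < ln (real j * ln \<theta>)" using ln\<theta> by real_asymp
  then have ev1: "\<forall>\<^sub>F j in sequentially. 1 < LL j" by (simp add: LL_eq)
  have "(\<lambda>j. ln (real j * ln \<theta>) / \<theta> ^ j) \<longlonglongrightarrow> 0" using \<theta> ln\<theta> by real_asymp
  then have "(\<lambda>j. sqrt (2 * (LL j / \<theta> ^ j)) / \<sigma>) \<longlonglongrightarrow> sqrt (2 * 0) / \<sigma>"
    unfolding LL_eq using \<sigma> by (intro tendsto_intros) auto
  then have l0: "l \<longlonglongrightarrow> 0" by (simp add: l_def[abs_def])
  have ev2: "\<forall>\<^sub>F j in sequentially. l j < l0" using order_tendstoD(2)[OF l0 K(2)] .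
  have "(\<lambda>j. 2 * \<theta> * K / \<sigma>\<^sup>2 * l j) \<longlonglongrightarrow> 2 * \<theta> * K / \<sigma>\<^sup>2 * 0" by (intro tendsto_intros l0)
  then have ev3: "\<forall>\<^sub>F j in sequentially. 2 * \<theta> * K / \<sigma>\<^sup>2 * l j < (1 - q) / 2"
    using q by (intro order_tendstoD(2)) auto
  from ev1 ev2 ev3 have bound: "\<forall>\<^sub>F j in sequentially. paths.prob (B j) \<le> 4 * (ln \<theta> powr (- r) * real j powr (- r))"
  proof eventually_elim
    case (elim j)
    have m: "0 < \<theta> ^ j" using \<theta> by simp
    have l: "0 \<le> l j" using elim(1) \<theta> \<sigma> by (auto simp: l_def)
    have l2: "\<theta> ^ j * (l j)\<^sup>2 = 2 * LL j / \<sigma>\<^sup>2" using elim(1) m \<sigma> \<theta> by (simp add: l_def power_divide)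
    have lt: "l j * t j = 2 * LL j"
    proof -
      have "l j * t j = sqrt ((2 * LL j / \<theta> ^ j) * (2 * \<theta> ^ j * LL j))"
        unfolding real_sqrt_mult using \<sigma> by (simp add: l_def t_def real_sqrt_mult)
      also have "(2 * LL j / \<theta> ^ j) * (2 * \<theta> ^ j * LL j) = (2 * LL j)\<^sup>2"
        using m \<theta> by (simp add: power2_eq_square)
      also have "sqrt \<dots> = 2 * LL j" using elim(1) by (intro real_sqrt_unique) auto
      finally show ?thesis .
    qed
    have "real (n j) \<le> \<theta> * \<theta> ^ j" using \<theta> by (simp add: n_def)
    then have "real (n j) * ((l j)\<^sup>2 * A / 2 + K * l j ^ 3) \<le> \<theta> * \<theta> ^ j * ((l j)\<^sup>2 * A / 2 + K * l j ^ 3)"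
      using l K(1) A(1) by (intro mult_right_mono) auto
    also have "\<dots> = \<theta> * (\<theta> ^ j * (l j)\<^sup>2) * A / 2 + \<theta> * K * (\<theta> ^ j * (l j)\<^sup>2) * l j"
      by (simp add: algebra_simps power2_eq_square power3_eq_cube)
    also have "\<dots> = LL j * (q + 2 * \<theta> * K / \<sigma>\<^sup>2 * l j)" unfolding l2 q_def by (simp add: field_simps)
    also have "\<dots> \<le> LL j * (q + (1 - q) / 2)" using elim by (intro mult_left_mono) auto
    finally have "real (n j) * ((l j)\<^sup>2 * A / 2 + K * l j ^ 3) \<le> LL j * (q + (1 - q) / 2)" .
    moreover have "LL j * (q + (1 - q) / 2) - 2 * LL j = - r * LL j" by (simp add: r_def field_simps)
    ultimately have "real (n j) * ((l j)\<^sup>2 * A / 2 + K * l j ^ 3) - l j * t j \<le> - r * LL j"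
      unfolding lt by linarith
    moreover have "paths.prob (B j) \<le> 4 * exp (real (n j) * ((l j)\<^sup>2 * A / 2 + K * l j ^ 3) - l j * t j)"
      unfolding B_def A_def using l elim(2) by (intro K(3)) auto
    ultimately have "paths.prob (B j) \<le> 4 * exp (- r * LL j)"
      by (smt (verit) exp_le_cancel_iff)
    also have "j \<noteq> 0" using elim(1) by (auto simp: LL_eq intro: ccontr)
    then have "exp (- r * LL j) = ln \<theta> powr (- r) * real j powr (- r)"
      using ln\<theta> by (simp add: LL_eq powr_mult[symmetric] mult.commute) (simp add: powr_def)
    finally show ?case .
  qed
  have "summable (\<lambda>j. real j powr (- r))" using r by (simp add: summable_real_powr_iff)
  then have "summable (\<lambda>j. 4 * (ln \<theta> powr (- r) * real j powr (- r)))" by (intro summable_mult)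
  then have "summable (\<lambda>j. paths.prob (B j))"
    by (rule summable_comparison_test_ev[rotated]) (simp add: bound)
  then have "AE s in paths. \<forall>\<^sub>F j in sequentially. s \<in> space paths - B j"
    using B by (intro borel_cantelli_AE1) (auto simp: paths.emeasure_eq_measure)
  then show ?thesis
  proof eventually_elim
    case (elim s)
    then have "\<forall>\<^sub>F j in sequentially. s \<notin> B j \<and> 1 < LL j" using ev1 by eventually_elim auto
    then obtain J where J: "\<And>j. j \<ge> J \<Longrightarrow> s \<notin> B j \<and> 1 < LL j" by (auto simp: eventually_sequentially)
    have "S N y s \<le> \<sigma> * sqrt (2 * real N * ln (ln (real N)))" if N: "real N \<ge> \<theta> ^ J" for N
    proof -
      have "1 \<le> \<theta> ^ J" using \<theta> by simp
      with N have "1 \<le> real N" by linarith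
      then obtain j where j: "\<theta> ^ j \<le> real N" "real N < \<theta> ^ Suc j"
        by (rule ex_power_bracket[OF \<theta>])
      have "\<theta> ^ J < \<theta> ^ Suc j" using N j by linarith
      then have "J \<le> j" using \<theta> by (simp only: power_strict_increasing_iff)
      then have "s \<notin> B j" "1 < LL j" using J by auto
      moreover have "N \<le> n j" using j(2) by (simp add: n_def le_nat_floor less_imp_le)
      ultimately have "\<not> t j \<le> S N y s" unfolding B_def by blast
      then have "S N y s \<le> t j" by linarith
      also have "t j \<le> \<sigma> * sqrt (2 * real N * ln (ln (real N)))"
      proof -
        have "ln (\<theta> ^ j) \<noteq> 0" using \<open>1 < LL j\<close> by (auto simp: LL_def)
        moreover have "0 \<le> ln (\<theta> ^ j)" using \<theta> by simp
        ultimately have p: "0 < ln (\<theta> ^ j)" by linarith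
        have "0 < \<theta> ^ j" using \<theta> by simp
        then have "LL j \<le> ln (ln (real N))" unfolding LL_def using p j(1) by (simp add: ln_mono)
        then have "2 * \<theta> ^ j * LL j \<le> 2 * real N * ln (ln (real N))"
          using j(1) \<open>1 < LL j\<close> \<open>0 < \<theta> ^ j\<close> by (intro mult_mono) auto
        then show ?thesis unfolding t_def using \<sigma> by (intro mult_left_mono) auto
      qed
      finally show ?thesis .
    qed
    moreover have "\<forall>\<^sub>F N in sequentially. \<theta> ^ J \<le> real N"
      using filterlim_real_sequentially by (simp add: filterlim_at_top)
    ultimately show ?case by (auto elim: eventually_mono)
  qed
qed

end

section \<open>The lower half of the law of the iterated logarithm\<close>

lemma walk_pos_add: "walk_pos n (walk_pos m y s) (sdrop m s) = walk_pos (m + n) y s"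
  by (induction m arbitrary: y s) auto

context lil_walk
begin

text \<open>By the Markov property, a bound that is uniform in the starting point survives conditioning on
  the first \<open>n\<close> steps.\<close>

lemma prob_superadditive:
  assumes p: "\<And>y. p \<le> paths.prob {s. r \<le> S n y s}" "0 \<le> p"
    and p': "\<And>y. p' \<le> paths.prob {s. r' \<le> S m y s}" "0 \<le> p'"
  shows "p * p' \<le> paths.prob {s. r + r' \<le> S (n + m) y s}"
proof -
  have "ennreal (p * p') = ennreal p' * ennreal p" using p(2) p'(2) by (simp add: ennreal_mult mult.commute)
  also have "\<dots> \<le> ennreal p' * emeasure paths {s. r \<le> S n y s}"
    using p(1)[of y] by (intro mult_left_mono) (auto simp: paths.emeasure_eq_measure ennreal_leI)
  also have "\<dots> = (\<integral>\<^sup>+s. ennreal p' * indicator {r..} (S n y s) \<partial>paths)"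
  proof -
    have [measurable]: "{s. r \<le> S n y s} \<in> sets paths" by (rule sets_Collect_paths) measurable
    have "(\<integral>\<^sup>+s. ennreal p' * indicator {r..} (S n y s) \<partial>paths)
      = (\<integral>\<^sup>+s. ennreal p' * indicator {s. r \<le> S n y s} s \<partial>paths)"
      by (intro nn_integral_cong) (auto split: split_indicator)
    then show ?thesis by (simp add: nn_integral_cmult_indicator)
  qed
  also have "\<dots> \<le> (\<integral>\<^sup>+s. (\<integral>\<^sup>+s'. indicator {r..} (S n y s) * indicator {r'..} (S m (walk_pos n y s) s') \<partial>paths) \<partial>paths)"
  proof (intro nn_integral_mono)
    fix s
    have [measurable]: "{s. r' \<le> S m z s} \<in> sets paths" for z by (rule sets_Collect_paths) measurable
    have "(\<integral>\<^sup>+s'. indicator {r'..} (S m z s') \<partial>paths) = (\<integral>\<^sup>+s'. indicator {s. r' \<le> S m z s} s' \<partial>paths)" for z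
      by (intro nn_integral_cong) (auto split: split_indicator)
    then have "(\<integral>\<^sup>+s'. indicator {r'..} (S m z s') \<partial>paths) = emeasure paths {s. r' \<le> S m z s}" for z by simp
    then have "ennreal p' \<le> (\<integral>\<^sup>+s'. indicator {r'..} (S m z s') \<partial>paths)" for z
      using p'(1)[of z] by (simp add: paths.emeasure_eq_measure ennreal_leI)
    then show "ennreal p' * indicator {r..} (S n y s)
        \<le> (\<integral>\<^sup>+s'. indicator {r..} (S n y s) * indicator {r'..} (S m (walk_pos n y s) s') \<partial>paths)"
      by (auto split: split_indicator)
  qed
  also have "\<dots> = (\<integral>\<^sup>+s. indicator {r..} (S n y s) * indicator {r'..} (S m (walk_pos n y s) (sdrop n s)) \<partial>paths)"
    by (rule markov_property[symmetric]) measurable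
  also have "\<dots> \<le> (\<integral>\<^sup>+s. indicator {s. r + r' \<le> S (n + m) y s} s \<partial>paths)"
    by (intro nn_integral_mono) (auto split: split_indicator simp: walk_sum_add)
  also have "\<dots> = emeasure paths {s. r + r' \<le> S (n + m) y s}"
    by (intro nn_integral_indicator sets_Collect_paths) measurable
  finally show ?thesis by (simp add: paths.emeasure_eq_measure ennreal_le_iff)
qed

lemma prob_blocks:
  assumes p: "\<And>y. p \<le> paths.prob {s. r \<le> S n y s}" "0 \<le> p"
  shows "p ^ q \<le> paths.prob {s. real q * r \<le> S (q * n) y s}"
proof (induction q arbitrary: y)
  case 0
  then show ?case using paths.prob_space by simp
next
  case (Suc q)
  have "p * p ^ q \<le> paths.prob {s. r + real q * r \<le> S (n + q * n) y s}"
    using p(2) by (intro prob_superadditive p Suc) auto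
  then show ?case by (simp add: algebra_simps)
qed

text \<open>Moderate deviations from below: \<open>n\<close> steps are cut into about \<open>ln (ln n)\<close> blocks, and in each of
  them the central limit theorem forces an excess of \<open>c\<close> standard deviations.\<close>

lemma moderate_deviation_lower:
  assumes \<tau>: "0 < \<tau>" "\<tau>\<^sup>2 < asym_var"
  obtains \<rho> where "0 < \<rho>" "\<rho> < 1"
    "\<forall>\<^sub>F n in sequentially. \<forall>y. ln (real n) powr (- \<rho>)
        \<le> paths.prob {s. \<tau> * sqrt (2 * real n * ln (ln (real n))) \<le> S n y s}"
proof -
  define A where "A = asym_var"
  have A: "0 < A" "\<tau>\<^sup>2 < A" using \<tau> by (auto simp: A_def intro: le_less_trans[OF zero_le_power2])
  obtain v where v: "\<tau>\<^sup>2 < v" "v < A" using dense[OF A(2)] by blast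
  have v0: "0 < v" using v(1) by (meson le_less_trans zero_le_power2)
  \<comment> \<open>so that the cost \<open>\<rho>\<close> of the blocks below is less than 1\<close>
  define \<delta> where "\<delta> = (A / v - 1) / 2"
  have \<delta>: "0 < \<delta>" using v v0 by (simp add: \<delta>_def)
  define \<rho> where "\<rho> = v * (1 + \<delta>) / A"
  have \<rho>: "0 < \<rho>" "\<rho> < 1" using v v0 \<delta> A by (auto simp: \<rho>_def \<delta>_def field_simps intro!: add_pos_pos)
  obtain c where c: "0 < c" "exp (- (c\<^sup>2 * (1 + \<delta>) / 2)) < measure std_normal_distribution {c<..}"
    using normal_tail_lower[OF \<delta>] by blast
  define p where "p = exp (- (c\<^sup>2 * (1 + \<delta>) / 2))"
  obtain n0 where n0: "\<And>n y. n \<ge> n0 \<Longrightarrow> p \<le> paths.prob {s. c * sqrt (A * real n) \<le> S n y s}"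
    using uniform_clt[OF _ c(2)] A(1) unfolding A_def p_def by blast
  obtain F where F: "0 \<le> F" "\<And>z. norm (f z) \<le> F" using f(1) by (rule bdd_meas_bound) blast
  \<comment> \<open>\<open>q\<close> blocks, each with excess \<open>c\<close> standard deviations, add up to about
    \<open>c * sqrt (A * q * n)\<close>, which this choice makes \<open>sqrt (2 * v * n * ln (ln n))\<close>\<close>
  define \<kappa> where "\<kappa> = 2 * v / (A * c\<^sup>2)"
  have \<kappa>: "0 < \<kappa>" using v0 A c by (simp add: \<kappa>_def)
  \<comment> \<open>rounding down keeps \<open>p ^ q n\<close> above \<open>ln n powr (- \<rho>)\<close>; the loss in the sum is covered by \<open>\<tau>\<^sup>2 < v\<close>\<close>
  define q where "q n = nat \<lfloor>\<kappa> * ln (ln (real n))\<rfloor>" for n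
  \<comment> \<open>\<open>R n\<close> bounds the sum of the block contributions from below; the last term pays for the at most
    \<open>q n\<close> steps left over after the blocks\<close>
  define R where "R n = c * sqrt A * sqrt ((\<kappa> * ln (ln (real n)) - 1) * real n - (\<kappa> * ln (ln (real n)))\<^sup>2)
      - \<kappa> * ln (ln (real n)) * F" for n :: nat
  have lim: "(\<lambda>n. R n / sqrt (real n * ln (ln (real n)))) \<longlonglongrightarrow> c * sqrt A * sqrt \<kappa> - \<kappa> * F * 0"
  proof -
    have "(\<lambda>n. sqrt ((\<kappa> * ln (ln (real n)) - 1) * real n - (\<kappa> * ln (ln (real n)))\<^sup>2) / sqrt (real n * ln (ln (real n)))) \<longlonglongrightarrow> \<kappa> powr (1/2)"
      using \<kappa> by real_asymp
    then have "(\<lambda>n. sqrt ((\<kappa> * ln (ln (real n)) - 1) * real n - (\<kappa> * ln (ln (real n)))\<^sup>2) / sqrt (real n * ln (ln (real n)))) \<longlonglongrightarrow> sqrt \<kappa>"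
      using \<kappa> by (simp add: powr_half_sqrt)
    moreover have "(\<lambda>n. ln (ln (real n)) / sqrt (real n * ln (ln (real n)))) \<longlonglongrightarrow> 0" by real_asymp
    ultimately have "(\<lambda>n. c * sqrt A * (sqrt ((\<kappa> * ln (ln (real n)) - 1) * real n - (\<kappa> * ln (ln (real n)))\<^sup>2) / sqrt (real n * ln (ln (real n))))
       - \<kappa> * F * (ln (ln (real n)) / sqrt (real n * ln (ln (real n))))) \<longlonglongrightarrow> c * sqrt A * sqrt \<kappa> - \<kappa> * F * 0"
      by (intro tendsto_intros)
    then show ?thesis by (simp add: R_def[abs_def] diff_divide_distrib mult_ac)
  qed
  have "c * sqrt A * sqrt \<kappa> = sqrt (2 * v)"
  proof -
    have "(c * sqrt A * sqrt \<kappa>)\<^sup>2 = 2 * v" using A c \<kappa> by (simp add: power_mult_distrib \<kappa>_def)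
    moreover have "0 \<le> c * sqrt A * sqrt \<kappa>" using A c \<kappa> by simp
    ultimately show ?thesis by (metis real_sqrt_unique)
  qed
  moreover have "sqrt 2 * \<tau> < sqrt (2 * v)"
  proof -
    have "sqrt (2 * \<tau>\<^sup>2) < sqrt (2 * v)" using v(1) by simp
    then show ?thesis using \<tau>(1) by (simp add: real_sqrt_mult)
  qed
  ultimately have ev1: "\<forall>\<^sub>F n in sequentially. sqrt 2 * \<tau> < R n / sqrt (real n * ln (ln (real n)))"
    using order_tendstoD(1)[OF lim] by simp
  have ev2: "\<forall>\<^sub>F n in sequentially. 1 < ln (ln (real n))" by real_asymp
  have ev3: "\<forall>\<^sub>F n in sequentially. 1 < \<kappa> * ln (ln (real n))" using \<kappa> by real_asymp
  have ev4: "\<forall>\<^sub>F n in sequentially. (real n0 + 1) * (\<kappa> * ln (ln (real n))) < real n" using \<kappa> by real_asymp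
  have "\<forall>\<^sub>F n in sequentially. \<forall>y. ln (real n) powr (- \<rho>)
        \<le> paths.prob {s. \<tau> * sqrt (2 * real n * ln (ln (real n))) \<le> S n y s}"
    using ev1 ev2 ev3 ev4
  proof eventually_elim
    case (elim n)
    define LL where "LL = ln (ln (real n))"
    have LL: "1 < LL" "1 < \<kappa> * LL" using elim by (auto simp: LL_def)
    have q: "real (q n) \<le> \<kappa> * LL" "\<kappa> * LL - 1 < real (q n)"
      using LL by (auto simp: q_def LL_def)
    then have q0: "0 < q n" using LL by linarith
    define b where "b = n div q n"
    have nb: "n = q n * b + n mod q n" and nm: "n mod q n < q n" using q0 by (auto simp: b_def)
    have b: "real n / real (q n) - 1 < real b"
    proof -
      have "real n < real (q n * b + q n)" using nb nm by linarith
      then show ?thesis using q0 by (simp add: field_simps)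
    qed
    have "n0 \<le> b"
    proof -
      have "(real n0 + 1) * real (q n) \<le> (real n0 + 1) * (\<kappa> * LL)" using q by (intro mult_left_mono) auto
      then have "(real n0 + 1) * real (q n) < real n" using elim(4) unfolding LL_def by linarith
      then have "real n0 + 1 < real n / real (q n)" using q0 by (simp add: field_simps)
      with b show ?thesis by linarith
    qed
    have R: "R n \<le> real (q n) * (c * sqrt (A * real b)) - real (q n) * F"
    proof -
      have "(\<kappa> * LL - 1) * real n - (\<kappa> * LL)\<^sup>2 \<le> real (q n) * real n - (real (q n))\<^sup>2"
        using q by (intro diff_mono mult_right_mono power_mono) auto
      also have "\<dots> = (real (q n))\<^sup>2 * (real n / real (q n) - 1)" using q0 by (simp add: power2_eq_square field_simps)
      also have "\<dots> \<le> (real (q n))\<^sup>2 * real b" using b by (intro mult_left_mono) auto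
      finally have "sqrt ((\<kappa> * LL - 1) * real n - (\<kappa> * LL)\<^sup>2) \<le> real (q n) * sqrt (real b)"
        using real_sqrt_le_mono[of _ "(real (q n))\<^sup>2 * real b"] by (simp add: real_sqrt_mult)
      then have "c * sqrt A * sqrt ((\<kappa> * LL - 1) * real n - (\<kappa> * LL)\<^sup>2) \<le> c * sqrt A * (real (q n) * sqrt (real b))"
        using c A by (intro mult_left_mono) auto
      moreover have "real (q n) * F \<le> \<kappa> * LL * F" using q F(1) by (intro mult_right_mono) auto
      ultimately show ?thesis by (simp add: R_def LL_def[symmetric] real_sqrt_mult mult_ac)
    qed
    have "\<tau> * sqrt (2 * real n * LL) \<le> R n"
    proof -
      have "0 < sqrt (real n * LL)" using LL elim(2) by (auto intro!: mult_pos_pos simp: LL_def intro: ccontr)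
      then show ?thesis using elim(1) by (simp add: LL_def[symmetric] real_sqrt_mult field_simps)
    qed
    with R have target: "\<tau> * sqrt (2 * real n * LL) \<le> real (q n) * (c * sqrt (A * real b)) - real (q n) * F" by linarith
    show ?case
    proof
      fix y
      have "LL * \<rho> = \<kappa> * LL * (c\<^sup>2 * (1 + \<delta>) / 2)" using A c by (simp add: \<rho>_def \<kappa>_def field_simps)
      also have "\<dots> \<ge> real (q n) * (c\<^sup>2 * (1 + \<delta>) / 2)" using q \<delta> by (intro mult_right_mono) auto
      finally have "exp (- \<rho> * LL) \<le> p ^ q n"
        unfolding p_def exp_of_nat_mult[symmetric] by (simp add: mult_ac)
      moreover have "ln (real n) powr (- \<rho>) = exp (- \<rho> * LL)"
        using elim(2) unfolding powr_def LL_def by auto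
      ultimately have "ln (real n) powr (- \<rho>) \<le> p ^ q n" by simp
      also have "\<dots> \<le> paths.prob {s. real (q n) * (c * sqrt (A * real b)) \<le> S (q n * b) y s}"
        using n0[OF \<open>n0 \<le> b\<close>] by (intro prob_blocks) (auto simp: p_def)
      also have "\<dots> \<le> paths.prob {s. \<tau> * sqrt (2 * real n * LL) \<le> S n y s}"
      proof (intro paths.finite_measure_mono sets_Collect_paths subsetI CollectI; (elim CollectE)?)
        fix s assume s: "real (q n) * (c * sqrt (A * real b)) \<le> S (q n * b) y s"
        have "\<bar>S (n mod q n) (walk_pos (q n * b) y s) (sdrop (q n * b) s)\<bar> \<le> real (n mod q n) * F"
          using F(2) by (intro abs_walk_sum_le) simp
        also have "\<dots> \<le> real (q n) * F" using nm F(1) by (intro mult_right_mono) auto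
        finally have "\<bar>S (n mod q n) (walk_pos (q n * b) y s) (sdrop (q n * b) s)\<bar> \<le> real (q n) * F" .
        moreover have "S n y s = S (q n * b) y s + S (n mod q n) (walk_pos (q n * b) y s) (sdrop (q n * b) s)"
          using walk_sum_add[of f "q n * b" "n mod q n" y s] nb by metis
        ultimately show "\<tau> * sqrt (2 * real n * LL) \<le> S n y s"
          using s target by linarith
      qed measurable
      finally show "ln (real n) powr (- \<rho>) \<le> paths.prob {s. \<tau> * sqrt (2 * real n * ln (ln (real n))) \<le> S n y s}"
        by (simp add: LL_def)
    qed
  qed
  with \<rho> show thesis by (rule that)
qed

end

text \<open>The absence of large increments is defined by recursion on the number of blocks, so that the
  Markov property can remove the first block.\<close>

primrec avoids :: "(real \<Rightarrow> real) \<Rightarrow> (nat \<Rightarrow> nat) \<Rightarrow> (nat \<Rightarrow> real) \<Rightarrow> nat \<Rightarrow> nat \<Rightarrow> real \<Rightarrow> real stream \<Rightarrow> bool" where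
  "avoids f len T 0 J y s \<longleftrightarrow> True"
| "avoids f len T (Suc d) J y s \<longleftrightarrow> walk_sum f (len J) y s < T J \<and>
     avoids f len T d (Suc J) (walk_pos (len J) y s) (sdrop (len J) s)"

lemma not_avoids:
  assumes "\<not> avoids f len T d J (walk_pos (n J) y s) (sdrop (n J) s)"
    and n: "\<And>j. n (Suc j) = n j + len j"
  shows "\<exists>j\<ge>J. T j \<le> walk_sum f (n (Suc j)) y s - walk_sum f (n j) y s"
  using assms(1)
proof (induction d arbitrary: J)
  case (Suc d)
  show ?case
  proof (cases "T J \<le> walk_sum f (len J) (walk_pos (n J) y s) (sdrop (n J) s)")
    case True
    then show ?thesis by (intro exI[of _ J]) (simp add: n walk_sum_add)
  next
    case False
    then have "\<not> avoids f len T d (Suc J) (walk_pos (n (Suc J)) y s) (sdrop (n (Suc J)) s)"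
      using Suc.prems by (simp add: n walk_pos_add)
    from Suc.IH[OF this] show ?thesis using Suc_leD by blast
  qed
qed simp

lemma walk_sum_uminus: "walk_sum (\<lambda>z. - f z) n y s = - walk_sum f n y s"
  by (induction n arbitrary: y s) auto

lemma (in random_walk) measurable_avoids [measurable (raw)]:
  assumes [measurable]: "f \<in> borel_measurable borel"
  assumes "g \<in> borel_measurable N" "h \<in> measurable N paths"
  shows "Measurable.pred N (\<lambda>x. avoids f len T d J (g x) (h x))"
  using assms(2,3)
proof (induction d arbitrary: J g h)
  case (Suc d)
  note Suc.prems[measurable]
  show ?case unfolding avoids.simps
    by (intro pred_intros_logic Suc.IH) measurable
qed simp

context lil_walk
begin

text \<open>By the Markov property the probability is at most
  \<open>\<Prod>\<^sub>j (1 - 1 / (j + 1))\<close> over \<open>J \<le> j < J + d\<close>, and this product telescopes.\<close>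

lemma prob_avoids:
  assumes p: "\<And>j y. j \<ge> J0 \<Longrightarrow> 1 / (real j + 1) \<le> paths.prob {s. T j \<le> S (len j) y s}"
    and J: "J0 \<le> J" "1 \<le> J"
  shows "paths.prob {s. avoids f len T d J y s} \<le> real J / real (J + d)"
  using J
proof (induction d arbitrary: J y)
  case 0
  then show ?case by simp
next
  case (Suc d)
  define v where "v = real (Suc J) / real (Suc J + d)"
  have v: "0 \<le> v" by (simp add: v_def)
  have m1: "{s. S n y s < t} \<in> sets paths" for n y t by (rule sets_Collect_paths) measurable
  have m2: "{s. avoids f len T d J y s} \<in> sets paths" for d J y by (rule sets_Collect_paths) measurable
  have "emeasure paths {s. avoids f len T (Suc d) J y s}
      = (\<integral>\<^sup>+s. indicator {s. avoids f len T (Suc d) J y s} s \<partial>paths)"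
    using m2 by (rule nn_integral_indicator[symmetric])
  also have "\<dots> = (\<integral>\<^sup>+s. (if S (len J) y s < T J \<and>
        avoids f len T d (Suc J) (walk_pos (len J) y s) (sdrop (len J) s) then 1 else 0) \<partial>paths)"
    by (intro nn_integral_cong) (auto split: split_indicator)
  also have "\<dots> = (\<integral>\<^sup>+s. (\<integral>\<^sup>+s'. (if S (len J) y s < T J \<and>
        avoids f len T d (Suc J) (walk_pos (len J) y s) s' then 1 else 0) \<partial>paths) \<partial>paths)"
    by (rule markov_property) measurable
  also have "\<dots> \<le> (\<integral>\<^sup>+s. ennreal v * indicator {s. S (len J) y s < T J} s \<partial>paths)"
  proof (intro nn_integral_mono)
    fix s
    have "(\<integral>\<^sup>+s'. (if avoids f len T d (Suc J) z s' then 1 else 0) \<partial>paths) \<le> ennreal v" for z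
    proof -
      have "(\<integral>\<^sup>+s'. (if avoids f len T d (Suc J) z s' then 1 else 0) \<partial>paths)
         = (\<integral>\<^sup>+s'. indicator {s. avoids f len T d (Suc J) z s} s' \<partial>paths)"
        by (intro nn_integral_cong) (auto split: split_indicator)
      also have "\<dots> = emeasure paths {s. avoids f len T d (Suc J) z s}"
        using m2 by (rule nn_integral_indicator)
      also have "\<dots> \<le> ennreal v"
        using Suc.IH[of "Suc J" z] Suc.prems by (simp add: paths.emeasure_eq_measure v_def ennreal_leI)
      finally show ?thesis .
    qed
    then show "(\<integral>\<^sup>+s'. (if S (len J) y s < T J \<and> avoids f len T d (Suc J) (walk_pos (len J) y s) s' then 1 else 0) \<partial>paths)
        \<le> ennreal v * indicator {s. S (len J) y s < T J} s"
      by (auto split: split_indicator)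
  qed
  also have "\<dots> = ennreal v * emeasure paths {s. S (len J) y s < T J}"
    using m1 by (rule nn_integral_cmult_indicator)
  also have "emeasure paths {s. S (len J) y s < T J} \<le> ennreal (1 - 1 / (real J + 1))"
  proof -
    have mT: "{s. T J \<le> S (len J) y s} \<in> sets paths" by (rule sets_Collect_paths) measurable
    have "{s. S (len J) y s < T J} = space paths - {s. T J \<le> S (len J) y s}" by auto
    then have "paths.prob {s. S (len J) y s < T J} = 1 - paths.prob {s. T J \<le> S (len J) y s}"
      using paths.prob_compl[OF mT] by simp
    then show ?thesis using p[OF Suc.prems(1), of y] by (simp add: paths.emeasure_eq_measure ennreal_leI)
  qed
  also have "ennreal v * ennreal (1 - 1 / (real J + 1)) = ennreal (v * (1 - 1 / (real J + 1)))"
    using v by (intro ennreal_mult[symmetric]) auto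
  also have "1 - 1 / (real J + 1) = real J / real (Suc J)" by (simp add: field_simps)
  also have "v * (real J / real (Suc J)) = real J / real (J + Suc d)"
    by (simp add: v_def del: of_nat_Suc)
  finally show ?case by (simp add: paths.emeasure_eq_measure ennreal_le_iff mult_left_mono)
qed

lemma AE_not_avoids:
  assumes p: "\<And>j y. j \<ge> J0 \<Longrightarrow> 1 / (real j + 1) \<le> paths.prob {s. T j \<le> S (len j) y s}"
    and J: "J0 \<le> J" "1 \<le> J"
  shows "AE s in paths. \<exists>d. \<not> avoids f len T d J (walk_pos m y s) (sdrop m s)"
proof -
  define N where "N = {s. \<forall>d. avoids f len T d J (walk_pos m y s) (sdrop m s)}"
  have N: "N \<in> sets paths" unfolding N_def by (rule sets_Collect_paths) measurable
  have m2: "{s. avoids f len T d J y s} \<in> sets paths" for d y by (rule sets_Collect_paths) measurable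
  have "paths.prob N \<le> real J / real (J + d)" for d
  proof -
    have "emeasure paths N = (\<integral>\<^sup>+s. indicator N s \<partial>paths)" using N by simp
    also have "\<dots> \<le> (\<integral>\<^sup>+s. (if avoids f len T d J (walk_pos m y s) (sdrop m s) then 1 else 0) \<partial>paths)"
      by (intro nn_integral_mono) (auto split: split_indicator simp: N_def)
    also have "\<dots> = (\<integral>\<^sup>+s. (\<integral>\<^sup>+s'. (if avoids f len T d J (walk_pos m y s) s' then 1 else 0) \<partial>paths) \<partial>paths)"
      by (rule markov_property[where H="\<lambda>w z s. if avoids f len T d J z s then 1 else 0", OF f_borel]) measurable
    also have "\<dots> \<le> (\<integral>\<^sup>+s. ennreal (real J / real (J + d)) \<partial>paths)"
    proof (intro nn_integral_mono)
      fix s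
      have "(\<integral>\<^sup>+s'. (if avoids f len T d J (walk_pos m y s) s' then 1 else 0) \<partial>paths)
         = (\<integral>\<^sup>+s'. indicator {s'. avoids f len T d J (walk_pos m y s) s'} s' \<partial>paths)"
        by (intro nn_integral_cong) (auto split: split_indicator)
      also have "\<dots> = emeasure paths {s'. avoids f len T d J (walk_pos m y s) s'}"
        using m2 by (rule nn_integral_indicator)
      also have "\<dots> \<le> ennreal (real J / real (J + d))"
        unfolding paths.emeasure_eq_measure by (intro ennreal_leI prob_avoids[OF p J])
      finally show "(\<integral>\<^sup>+s'. (if avoids f len T d J (walk_pos m y s) s' then 1 else 0) \<partial>paths)
        \<le> ennreal (real J / real (J + d))" .
    qed
    also have "\<dots> = ennreal (real J / real (J + d))"
      using paths.emeasure_space_1 by simp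
    finally show ?thesis by (simp add: paths.emeasure_eq_measure ennreal_le_iff)
  qed
  moreover have "(\<lambda>d. real J / real (J + d)) \<longlonglongrightarrow> 0" by real_asymp
  ultimately have "paths.prob N \<le> 0" by (intro LIMSEQ_le_const) auto
  then have "N \<in> null_sets paths"
    using N measure_nonneg[of paths N] by (intro null_setsI) (auto simp: paths.emeasure_eq_measure)
  then have "AE s in paths. s \<notin> N" by (rule AE_not_in)
  then show ?thesis by eventually_elim (auto simp: N_def)
qed

lemma lil_walk_uminus: "lil_walk \<nu> (\<lambda>z. - f z)"
  by unfold_locales (use f in \<open>auto intro!: bdd_meas_minus simp: periodic1_def circ_uminus\<close>)

lemma asym_var_uminus: "lil_walk.asym_var \<nu> (\<lambda>z. - f z) = asym_var"
proof -
  interpret neg: lil_walk \<nu> "\<lambda>z. - f z" by (rule lil_walk_uminus)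
  have "(step_op ^^ k) (\<lambda>z. - f z) = (\<lambda>y. - (step_op ^^ k) f y)" for k
    using step_op_funpow_affine[OF f(1), of k 0 "-1"] by simp
  then show ?thesis unfolding neg.asym_var_def asym_var_def by (simp only:) simp
qed

lemma eventually_ge_lil:
  assumes "0 < \<sigma>" "asym_var < \<sigma>\<^sup>2"
  shows "AE s in paths. \<forall>\<^sub>F N in sequentially. - (\<sigma> * sqrt (2 * real N * ln (ln (real N)))) \<le> S N y s"
proof -
  interpret neg: lil_walk \<nu> "\<lambda>z. - f z" by (rule lil_walk_uminus)
  have "AE s in paths. \<forall>\<^sub>F N in sequentially. neg.S N y s \<le> \<sigma> * sqrt (2 * real N * ln (ln (real N)))"
    using assms by (intro neg.eventually_le_lil) (simp_all add: asym_var_uminus)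
  then show ?thesis unfolding walk_sum_uminus
    by eventually_elim (auto elim: eventually_mono)
qed

text \<open>Infinitely many increments over blocks of length about \<open>\<theta>\<^sup>j\<close> are large. For \<open>\<theta>\<close> large the sum up
  to the beginning of the block, which the upper bound for \<open>- f\<close> controls, cannot compensate.\<close>

lemma frequently_ge_lil:
  assumes \<sigma>: "0 < \<sigma>" "\<sigma>\<^sup>2 < asym_var"
  shows "AE s in paths. \<exists>\<^sub>F N in sequentially. \<sigma> * sqrt (2 * real N * ln (ln (real N))) \<le> S N y s"
proof -
  define A where "A = asym_var"
  have A: "0 < A" using \<sigma> by (auto simp: A_def intro: le_less_trans[OF zero_le_power2])
  have "sqrt (\<sigma>\<^sup>2) < sqrt A" using \<sigma>(2) unfolding A_def by (rule real_sqrt_less_mono)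
  then have "\<sigma> < sqrt A" using \<sigma>(1) by simp
  then obtain \<tau> where \<tau>: "\<sigma> < \<tau>" "\<tau> < sqrt A" using dense by blast
  obtain \<tau>1 where \<tau>1: "\<sigma> < \<tau>1" "\<tau>1 < \<tau>" using dense[OF \<tau>(1)] by blast
  have "\<tau>\<^sup>2 < (sqrt A)\<^sup>2" using \<tau> \<sigma> by (intro power_strict_mono) auto
  then have \<tau>A: "0 < \<tau>" "\<tau>\<^sup>2 < asym_var" using \<tau> \<sigma> A by (auto simp: A_def)
  define \<sigma>2 where "\<sigma>2 = sqrt A + 1"
  have "(sqrt A)\<^sup>2 < \<sigma>2\<^sup>2" unfolding \<sigma>2_def using A by (intro power_strict_mono) auto
  then have \<sigma>2: "0 < \<sigma>2" "asym_var < \<sigma>2\<^sup>2" using A by (auto simp: \<sigma>2_def A_def intro: add_nonneg_pos)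
  obtain \<rho> where \<rho>: "0 < \<rho>" "\<rho> < 1"
    "\<forall>\<^sub>F n in sequentially. \<forall>y. ln (real n) powr (- \<rho>)
        \<le> paths.prob {s. \<tau> * sqrt (2 * real n * ln (ln (real n))) \<le> S n y s}"
    by (rule moderate_deviation_lower[OF \<tau>A]) blast
  \<comment> \<open>for large \<open>\<theta>\<close> a block is almost as long as its end point (\<open>e1\<close>), and what precedes it is
    negligible (\<open>e2\<close>)\<close>
  have "(\<lambda>\<theta>. sqrt (real \<theta> / (real \<theta> - 1))) \<longlonglongrightarrow> 1" by real_asymp
  then have "(\<lambda>\<theta>. \<tau>1 * sqrt (real \<theta> / (real \<theta> - 1))) \<longlonglongrightarrow> \<tau>1 * 1" by (intro tendsto_intros)
  then have e1: "\<forall>\<^sub>F \<theta> in sequentially. \<tau>1 * sqrt (real \<theta> / (real \<theta> - 1)) < \<tau>"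
    using \<tau>1 by (intro order_tendstoD(2)) auto
  have "(\<lambda>\<theta>. \<sigma>2 / sqrt (real \<theta>)) \<longlonglongrightarrow> 0" by real_asymp
  then have e2: "\<forall>\<^sub>F \<theta> in sequentially. \<sigma>2 / sqrt (real \<theta>) < \<tau>1 - \<sigma>"
    using \<tau>1 by (intro order_tendstoD(2)) auto
  have "\<forall>\<^sub>F \<theta> in sequentially. \<tau>1 * sqrt (real \<theta> / (real \<theta> - 1)) < \<tau> \<and> \<sigma>2 / sqrt (real \<theta>) < \<tau>1 - \<sigma> \<and> 2 < \<theta>"
    using e1 e2 eventually_gt_at_top[of 2] by eventually_elim simp
  then obtain \<theta> :: nat where \<theta>: "\<tau>1 * sqrt (real \<theta> / (real \<theta> - 1)) < \<tau>" "\<sigma>2 / sqrt (real \<theta>) < \<tau>1 - \<sigma>" "2 < \<theta>"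
    using eventually_happens'[OF sequentially_bot] by blast
  define n where "n j = \<theta> ^ j" for j
  define len where "len j = \<theta> ^ j * (\<theta> - 1)" for j
  have nlen: "n (Suc j) = n j + len j" for j
    using \<theta>(3) by (simp add: n_def len_def algebra_simps diff_mult_distrib2)
  define T where "T j = \<tau>1 * sqrt (2 * real (n (Suc j)) * ln (ln (real (n (Suc j)))))" for j
  define a b where "a = ln (real \<theta>)" and "b = ln (real \<theta> - 1)"
  have a: "0 < a" and b: "0 < b" using \<theta>(3) by (auto simp: a_def b_def)
  have lnn: "ln (real (n j)) = real j * a" for j using \<theta>(3) by (simp add: n_def a_def ln_realpow)
  have lnl: "ln (real (len j)) = real j * a + b" for j
    using \<theta>(3) by (simp add: len_def a_def b_def ln_mult ln_realpow of_nat_diff)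
  have "strict_mono n" unfolding n_def using \<theta>(3) by (intro strict_monoI power_strict_increasing) auto
  have jlen: "j \<le> len j" for j
  proof -
    have "j \<le> n j" using \<open>strict_mono n\<close> by (rule strict_mono_imp_increasing)
    also have "\<dots> * 1 \<le> len j" unfolding len_def n_def using \<theta>(3) by (intro mult_left_mono) auto
    finally show ?thesis by simp
  qed
  then have flen: "filterlim len at_top sequentially"
    by (intro filterlim_at_top_mono[OF filterlim_ident]) (auto intro: always_eventually)
  have E1: "\<forall>\<^sub>F j in sequentially. \<forall>y. ln (real (len j)) powr (- \<rho>)
        \<le> paths.prob {s. \<tau> * sqrt (2 * real (len j) * ln (ln (real (len j)))) \<le> S (len j) y s}"
    using \<rho>(3) flen unfolding filterlim_iff by blast
  have E2: "\<forall>\<^sub>F j in sequentially. 1 / (real j + 1) \<le> (real j * a + b) powr (- \<rho>)"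
    using a \<rho> by real_asymp
  have "(\<lambda>j. ln (real (Suc j) * a) / ln (real j * a + b)) \<longlonglongrightarrow> 1" using a by real_asymp
  then have "(\<lambda>j. \<tau>1 * sqrt (real \<theta> / (real \<theta> - 1)) * sqrt (ln (real (Suc j) * a) / ln (real j * a + b)))
      \<longlonglongrightarrow> \<tau>1 * sqrt (real \<theta> / (real \<theta> - 1)) * sqrt 1" by (intro tendsto_intros)
  then have E3: "\<forall>\<^sub>F j in sequentially. \<tau>1 * sqrt (real \<theta> / (real \<theta> - 1)) * sqrt (ln (real (Suc j) * a) / ln (real j * a + b)) < \<tau>"
    using \<theta>(1) by (intro order_tendstoD(2)) auto
  have E4: "\<forall>\<^sub>F j in sequentially. 0 < ln (real j * a)" "\<forall>\<^sub>F j in sequentially. 0 < ln (real j * a + b)"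
    using a by real_asymp+
  have "\<forall>\<^sub>F j in sequentially. 0 < ln (real j * a) \<and> (\<forall>y. 1 / (real j + 1) \<le> paths.prob {s. T j \<le> S (len j) y s})"
    using E1 E2 E3 E4
  proof eventually_elim
    case (elim j)
  \<comment> \<open>\<open>T j\<close> is measured by \<open>\<tau>1\<close> against the end point of the block, the right-hand side by \<open>\<tau>\<close> against its length\<close>
    have "T j \<le> \<tau> * sqrt (2 * real (len j) * ln (ln (real (len j))))"
    proof -
      have "2 * real (n (Suc j)) * ln (ln (real (n (Suc j)))) = (real \<theta> / (real \<theta> - 1)) *
          (ln (real (Suc j) * a) / ln (real j * a + b)) * (2 * real (len j) * ln (ln (real (len j))))"
        unfolding lnn lnl using \<theta>(3) elim(5) by (simp add: n_def len_def of_nat_diff)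
      then have "T j = (\<tau>1 * sqrt (real \<theta> / (real \<theta> - 1)) * sqrt (ln (real (Suc j) * a) / ln (real j * a + b)))
           * sqrt (2 * real (len j) * ln (ln (real (len j))))"
        by (simp only: T_def real_sqrt_mult mult.assoc)
      also have "\<dots> \<le> \<tau> * sqrt (2 * real (len j) * ln (ln (real (len j))))"
        using elim(3,5) by (intro mult_right_mono) (auto simp: lnl)
      finally show ?thesis .
    qed
    then have "paths.prob {s. \<tau> * sqrt (2 * real (len j) * ln (ln (real (len j)))) \<le> S (len j) y s}
        \<le> paths.prob {s. T j \<le> S (len j) y s}" for y
      by (intro paths.finite_measure_mono sets_Collect_paths) (auto, measurable)
    then show ?case using elim(1,2,4) unfolding lnl by (meson order_trans)
  qed
  then obtain J0 where J0: "\<And>j. j \<ge> J0 \<Longrightarrow> 0 < ln (real j * a)"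
    "\<And>j y. j \<ge> J0 \<Longrightarrow> 1 / (real j + 1) \<le> paths.prob {s. T j \<le> S (len j) y s}"
    unfolding eventually_sequentially by blast
  have "AE s in paths. \<forall>J\<in>{max J0 1..}. \<exists>d. \<not> avoids f len T d J (walk_pos (n J) y s) (sdrop (n J) s)"
  proof (rule AE_ball_countable')
    fix J assume J: "J \<in> {max J0 1..}"
    show "AE s in paths. \<exists>d. \<not> avoids f len T d J (walk_pos (n J) y s) (sdrop (n J) s)"
    proof (rule AE_not_avoids)
      show "1 / (real j + 1) \<le> paths.prob {s. T j \<le> S (len j) y s}" if "j \<ge> J0" for j y
        using that by (rule J0(2))
    qed (use J in auto)
  qed simp
  moreover have "AE s in paths. \<forall>\<^sub>F N in sequentially. - (\<sigma>2 * sqrt (2 * real N * ln (ln (real N)))) \<le> S N y s"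
    by (rule eventually_ge_lil[OF \<sigma>2])
  ultimately show ?thesis
  proof eventually_elim
    case (elim s)
    obtain N0 where N0: "\<And>N. N \<ge> N0 \<Longrightarrow> - (\<sigma>2 * sqrt (2 * real N * ln (ln (real N)))) \<le> S N y s"
      using elim(2) unfolding eventually_sequentially by blast
    show ?case unfolding frequently_sequentially
    proof
      fix M :: nat
      define J where "J = max (max J0 1) (max N0 M)"
      have "J \<in> {max J0 1..}" by (simp add: J_def)
      then obtain d where "\<not> avoids f len T d J (walk_pos (n J) y s) (sdrop (n J) s)" using elim(1) by blast
      from not_avoids[where n=n, OF this nlen]
      obtain j where j: "J \<le> j" "T j \<le> S (n (Suc j)) y s - S (n j) y s" by blast
      have jn: "i \<le> n i" for i using \<open>strict_mono n\<close> by (rule strict_mono_imp_increasing)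
      have "N0 \<le> n j" "M \<le> n (Suc j)" "J0 \<le> j"
        using j(1) jn[of j] jn[of "Suc j"] by (auto simp: J_def)
      define R where "R = sqrt (2 * real (n (Suc j)) * ln (ln (real (n (Suc j)))))"
      have "sqrt (2 * real (n j) * ln (ln (real (n j)))) \<le> R / sqrt (real \<theta>)"
      proof -
        have l: "0 < ln (real j * a)" using J0(1) \<open>J0 \<le> j\<close> by blast
        then have "0 < real j * a" using a by (cases "j = 0") auto
        then have "ln (real j * a) \<le> ln (real (Suc j) * a)" using a by (intro ln_mono mult_right_mono) auto
        then have "2 * real (n j) * ln (real j * a) \<le> 2 * real (n j) * ln (real (Suc j) * a)"
          by (intro mult_left_mono) auto
        also have "\<dots> = 2 * real (n (Suc j)) * ln (real (Suc j) * a) / real \<theta>"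
          using \<theta>(3) by (simp add: n_def)
        finally show ?thesis unfolding R_def lnn real_sqrt_divide[symmetric] by (rule real_sqrt_le_mono)
      qed
      then have "\<sigma>2 * sqrt (2 * real (n j) * ln (ln (real (n j)))) \<le> \<sigma>2 * (R / sqrt (real \<theta>))"
        using \<sigma>2(1) by (intro mult_left_mono) auto
      moreover have "0 \<le> R"
        using J0(1)[of "Suc j"] \<open>J0 \<le> j\<close> unfolding R_def lnn by simp
      then have "(\<sigma>2 / sqrt (real \<theta>)) * R \<le> (\<tau>1 - \<sigma>) * R" using \<theta>(2) by (intro mult_right_mono) auto
      moreover have "T j = \<tau>1 * R" by (simp add: T_def R_def)
      ultimately have "\<sigma> * R \<le> S (n (Suc j)) y s"
        using j(2) N0[OF \<open>N0 \<le> n j\<close>] by (simp add: algebra_simps)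
      then show "\<exists>N\<ge>M. \<sigma> * sqrt (2 * real N * ln (ln (real N))) \<le> S N y s"
        using \<open>M \<le> n (Suc j)\<close> unfolding R_def by blast
    qed
  qed
qed

lemma frequently_gt_lil:
  assumes "\<sigma> < sqrt asym_var"
  shows "AE s in paths. \<exists>\<^sub>F N in sequentially. \<sigma> * sqrt (2 * real N * ln (ln (real N))) \<le> S N y s"
proof (cases "asym_var = 0")
  case True
  then have "AE s in paths. \<forall>\<^sub>F N in sequentially. - (- \<sigma> * sqrt (2 * real N * ln (ln (real N)))) \<le> S N y s"
    using assms by (intro eventually_ge_lil) auto
  then show ?thesis
    by eventually_elim (auto intro: eventually_frequently[OF sequentially_bot])
next
  case False
  with asym_var_nonneg have A: "0 < asym_var" by linarith
  define \<sigma>' where "\<sigma>' = max \<sigma> (sqrt asym_var / 2)"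
  have \<sigma>': "0 < \<sigma>'" "\<sigma>' < sqrt asym_var" "\<sigma> \<le> \<sigma>'" using assms A by (auto simp: \<sigma>'_def less_max_iff_disj)
  have "\<sigma>'\<^sup>2 < (sqrt asym_var)\<^sup>2" using \<sigma>' by (intro power_strict_mono) auto
  then have "AE s in paths. \<exists>\<^sub>F N in sequentially. \<sigma>' * sqrt (2 * real N * ln (ln (real N))) \<le> S N y s"
    using A \<sigma>'(1) by (intro frequently_ge_lil) auto
  then show ?thesis
  proof eventually_elim
    case (elim s)
    have "\<forall>\<^sub>F N in sequentially. 0 \<le> 2 * real N * ln (ln (real N))" by real_asymp
    then have "\<forall>\<^sub>F N in sequentially. \<sigma> * sqrt (2 * real N * ln (ln (real N))) \<le> \<sigma>' * sqrt (2 * real N * ln (ln (real N)))"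
      by eventually_elim (use \<sigma>'(3) in \<open>auto intro!: mult_right_mono\<close>)
    from frequently_eventually_conj[OF elim this] show ?case
      by (rule frequently_elim1) auto
  qed
qed

theorem lil_paths:
  "AE s in paths. limsup (\<lambda>N. ereal ((2 * real N * ln (ln (real N))) powr (- 1 / 2) * S N y s))
     = ereal (sqrt asym_var)"
proof -
  have "AE s in paths. \<forall>k. \<forall>\<^sub>F N in sequentially. S N y s \<le> (sqrt asym_var + 1 / real (Suc k)) * sqrt (2 * real N * ln (ln (real N)))"
  proof (intro AE_all_countable[THEN iffD2] allI eventually_le_lil)
    fix k
    have "(sqrt asym_var)\<^sup>2 < (sqrt asym_var + 1 / real (Suc k))\<^sup>2"
      using asym_var_nonneg by (intro power_strict_mono) auto
    then show "asym_var < (sqrt asym_var + 1 / real (Suc k))\<^sup>2" using asym_var_nonneg by simp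
    show "0 < sqrt asym_var + 1 / real (Suc k)" using asym_var_nonneg by (intro add_nonneg_pos) auto
  qed
  moreover have "AE s in paths. \<forall>k. \<exists>\<^sub>F N in sequentially. (sqrt asym_var - 1 / real (Suc k)) * sqrt (2 * real N * ln (ln (real N))) \<le> S N y s"
    by (intro AE_all_countable[THEN iffD2] allI frequently_gt_lil) simp
  ultimately show ?thesis
  proof eventually_elim
    case (elim s)
    define L where "L N = 2 * real N * ln (ln (real N))" for N :: nat
    define X where "X N = L N powr (- 1 / 2) * S N y s" for N
    have "\<forall>\<^sub>F N in sequentially. 0 < L N" unfolding L_def by real_asymp
    then have L: "\<forall>\<^sub>F N in sequentially. 0 < L N \<and> X N = S N y s / sqrt (L N)"
      by eventually_elim (simp add: X_def powr_minus powr_half_sqrt field_simps)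
    let ?l = "limsup (\<lambda>N. ereal (X N))"
    have ub: "?l \<le> ereal (sqrt asym_var + 1 / real (Suc k))" for k
    proof (rule Limsup_bounded)
      show "\<forall>\<^sub>F N in sequentially. ereal (X N) \<le> ereal (sqrt asym_var + 1 / real (Suc k))"
        using L spec[OF elim(1), of k] by eventually_elim (simp add: L_def[symmetric] pos_divide_le_eq del: of_nat_Suc)
    qed
    have "(\<lambda>k. ereal (sqrt asym_var + 1 / real (Suc k))) \<longlonglongrightarrow> ereal (sqrt asym_var + 0)"
      by (intro tendsto_intros LIMSEQ_Suc[OF lim_1_over_n])
    then have up: "?l \<le> ereal (sqrt asym_var + 0)"
      by (rule LIMSEQ_le_const) (use ub in blast)
    have lb: "ereal (sqrt asym_var - 1 / real (Suc k)) \<le> ?l" for k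
    proof (rule ccontr)
      assume "\<not> ?thesis"
      then have "\<forall>\<^sub>F N in sequentially. ereal (X N) < ereal (sqrt asym_var - 1 / real (Suc k))"
        unfolding not_le by (rule Limsup_lessD)
      with L have "\<forall>\<^sub>F N in sequentially. \<not> (sqrt asym_var - 1 / real (Suc k)) * sqrt (L N) \<le> S N y s"
        by eventually_elim (simp add: pos_divide_less_eq not_le del: of_nat_Suc)
      with spec[OF elim(2), of k] show False unfolding L_def frequently_def by simp
    qed
    have "(\<lambda>k. ereal (sqrt asym_var - 1 / real (Suc k))) \<longlonglongrightarrow> ereal (sqrt asym_var - 0)"
      by (intro tendsto_intros LIMSEQ_Suc[OF lim_1_over_n])
    then have "ereal (sqrt asym_var - 0) \<le> ?l"
      by (rule LIMSEQ_le_const2) (use lb in blast)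
    with up show ?case unfolding X_def L_def by simp
  qed
qed

end

section \<open>Transfer to the given probability space\<close>

lemma (in prob_space) distr_to_stream:
  fixes Z :: "nat \<Rightarrow> 'a \<Rightarrow> real"
  assumes indep: "indep_vars (\<lambda>_. borel) Z {1..}"
    and \<nu>: "\<And>j. j \<ge> 1 \<Longrightarrow> distr M borel (Z j) = \<nu>"
  shows "(\<lambda>\<omega>. to_stream (\<lambda>i. Z (Suc i) \<omega>)) \<in> measurable M (stream_space \<nu>)"
    and "distr M (stream_space \<nu>) (\<lambda>\<omega>. to_stream (\<lambda>i. Z (Suc i) \<omega>)) = stream_space \<nu>"
proof -
  have rv: "Z j \<in> borel_measurable M" if "j \<ge> 1" for j
    using indep that by (auto simp: indep_vars_def)
  then have [measurable]: "Z (Suc i) \<in> borel_measurable M" for i by simp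
  have [measurable_cong]: "sets \<nu> = sets borel" using \<nu>[of 1] by (metis order_refl sets_distr)
  have prob: "prob_space \<nu>" using prob_space_distr[OF rv[of 1]] \<nu>[of 1] by simp
  show m: "(\<lambda>\<omega>. to_stream (\<lambda>i. Z (Suc i) \<omega>)) \<in> measurable M (stream_space \<nu>)"
    by (rule measurable_stream_space2) (simp add: to_stream_def, measurable)
  have "distr M (\<Pi>\<^sub>M i\<in>{1..}. borel) (\<lambda>\<omega>. \<lambda>i\<in>{1..}. Z i \<omega>) = (\<Pi>\<^sub>M i\<in>{1..}. distr M borel (Z i))"
    using indep rv by (subst (asm) indep_vars_iff_distr_eq_PiM') auto
  also have "\<dots> = (\<Pi>\<^sub>M i\<in>{1..}. \<nu>)" using \<nu> by (intro PiM_cong) auto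
  finally have P: "distr M (\<Pi>\<^sub>M i\<in>{1..}. borel) (\<lambda>\<omega>. \<lambda>i\<in>{1..}. Z i \<omega>) = (\<Pi>\<^sub>M i\<in>{1..}. \<nu>)" .
  have shift: "distr (\<Pi>\<^sub>M i\<in>{1..}. \<nu>) (\<Pi>\<^sub>M i\<in>UNIV. \<nu>) (\<lambda>\<omega>. \<lambda>i\<in>UNIV. \<omega> (Suc i)) = (\<Pi>\<^sub>M i\<in>UNIV. \<nu>)"
    by (rule distr_PiM_reindex) (auto simp: prob)
  have mZ: "(\<lambda>\<omega>. \<lambda>i\<in>{1..}. Z i \<omega>) \<in> measurable M (\<Pi>\<^sub>M i\<in>{1..}. borel)"
    using rv by (intro measurable_restrict) auto
  have mS: "(\<lambda>\<omega>. \<lambda>i\<in>UNIV. \<omega> (Suc i)) \<in> measurable (\<Pi>\<^sub>M i\<in>{1..}. \<nu>) (\<Pi>\<^sub>M i\<in>UNIV. \<nu>)"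
    by (intro measurable_restrict measurable_component_singleton) auto
  have s1: "sets (\<Pi>\<^sub>M i\<in>{1::nat..}. \<nu>) = sets (\<Pi>\<^sub>M i\<in>{1..}. (borel :: real measure))"
    by (intro sets_PiM_cong) (auto simp: \<open>sets \<nu> = sets borel\<close>)
  have mS': "(\<lambda>\<omega>. \<lambda>i\<in>UNIV. \<omega> (Suc i)) \<in> measurable (\<Pi>\<^sub>M i\<in>{1..}. borel) (\<Pi>\<^sub>M i\<in>UNIV. \<nu>)"
    using mS by (simp cong: measurable_cong_sets add: s1)
  have "stream_space \<nu> = distr (\<Pi>\<^sub>M i\<in>UNIV. \<nu>) (stream_space \<nu>) to_stream"
    by (rule stream_space_eq_distr)
  also have "\<dots> = distr (distr (\<Pi>\<^sub>M i\<in>{1..}. \<nu>) (\<Pi>\<^sub>M i\<in>UNIV. \<nu>) (\<lambda>\<omega>. \<lambda>i\<in>UNIV. \<omega> (Suc i))) (stream_space \<nu>) to_stream"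
    unfolding shift ..
  also have "\<dots> = distr (\<Pi>\<^sub>M i\<in>{1..}. \<nu>) (stream_space \<nu>) (to_stream \<circ> (\<lambda>\<omega>. \<lambda>i\<in>UNIV. \<omega> (Suc i)))"
    using mS by (rule distr_distr[OF measurable_to_stream])
  also have "\<dots> = distr (distr M (\<Pi>\<^sub>M i\<in>{1..}. borel) (\<lambda>\<omega>. \<lambda>i\<in>{1..}. Z i \<omega>)) (stream_space \<nu>) (to_stream \<circ> (\<lambda>\<omega>. \<lambda>i\<in>UNIV. \<omega> (Suc i)))"
    unfolding P ..
  also have "\<dots> = distr M (stream_space \<nu>) ((to_stream \<circ> (\<lambda>\<omega>. \<lambda>i\<in>UNIV. \<omega> (Suc i))) \<circ> (\<lambda>\<omega>. \<lambda>i\<in>{1..}. Z i \<omega>))"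
    using mZ by (rule distr_distr[OF measurable_comp[OF mS' measurable_to_stream]])
  also have "(to_stream \<circ> (\<lambda>\<omega>. \<lambda>i\<in>UNIV. \<omega> (Suc i))) \<circ> (\<lambda>\<omega>. \<lambda>i\<in>{1..}. Z i \<omega>) = (\<lambda>\<omega>. to_stream (\<lambda>i. Z (Suc i) \<omega>))"
    by (auto simp: fun_eq_iff restrict_def)
  finally show "distr M (stream_space \<nu>) (\<lambda>\<omega>. to_stream (\<lambda>i. Z (Suc i) \<omega>)) = stream_space \<nu>" by simp
qed

lemma Lip_imp_bdd_meas:
  assumes L: "Lip \<alpha> f" and p: "\<And>t. f (t + 1) = f t"
  shows "bdd_meas f"
proof -
  from L obtain L where \<alpha>: "0 < \<alpha>" and L: "\<And>s t. \<bar>f s - f t\<bar> \<le> L * \<bar>s - t\<bar> powr \<alpha>"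
    unfolding Lip_def by blast
  have "isCont f t" for t
  proof -
    have "((\<lambda>s. \<bar>s - t\<bar>) \<longlongrightarrow> \<bar>t - t\<bar>) (at t)" by (intro tendsto_intros)
    then have "((\<lambda>s. \<bar>s - t\<bar> powr \<alpha>) \<longlongrightarrow> \<bar>t - t\<bar> powr \<alpha>) (at t)"
      by (rule tendsto_powr2[OF _ tendsto_const]) (use \<alpha> in auto)
    then have "((\<lambda>s. L * \<bar>s - t\<bar> powr \<alpha>) \<longlongrightarrow> L * \<bar>t - t\<bar> powr \<alpha>) (at t)"
      by (rule tendsto_mult_left)
    then have "((\<lambda>s. L * \<bar>s - t\<bar> powr \<alpha>) \<longlongrightarrow> 0) (at t)" by simp
    then have "((\<lambda>s. f s - f t) \<longlongrightarrow> 0) (at t)"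
      by (rule Lim_null_comparison[rotated]) (auto simp: L)
    then show ?thesis by (simp add: isCont_def LIM_zero_iff)
  qed
  then have "f \<in> borel_measurable borel"
    by (intro borel_measurable_continuous_onI continuous_at_imp_continuous_on) auto
  moreover have "norm (f t) \<le> \<bar>f 0\<bar> + \<bar>L\<bar>" for t
  proof -
    have "f t = f (frac t)"
      using periodic1_int[of f "frac t" "\<lfloor>t\<rfloor>"] p by (simp add: frac_def periodic1_def)
    moreover have "\<bar>f (frac t) - f 0\<bar> \<le> L * \<bar>frac t\<bar> powr \<alpha>" using L[of "frac t" 0] by simp
    moreover have "\<bar>frac t\<bar> powr \<alpha> \<le> 1"
      using powr_mono2[of \<alpha> "frac t" 1] \<alpha> frac_lt_1[of t] by simp
    then have "L * \<bar>frac t\<bar> powr \<alpha> \<le> \<bar>L\<bar> * 1" by (intro mult_mono) auto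
    ultimately show ?thesis by simp
  qed
  ultimately show ?thesis by (rule bdd_measI)
qed

theorem mainTheorem2:
  fixes M :: "'a measure"
    and X :: "nat \<Rightarrow> 'a \<Rightarrow> real"
    and f g :: "real \<Rightarrow> real"
    and \<alpha> B C :: real
  assumes "prob_space M"
    and "prob_space.indep_vars M (\<lambda>_. borel) X {1..}"
    and "\<And>j. j \<ge> 1 \<Longrightarrow> distr M borel (X j) = distr M borel (X 1)"
    and "\<And>j. j \<ge> 1 \<Longrightarrow> AE \<omega> in M. 0 < X j \<omega>"
    and "AE \<omega> in M. \<bar>X 1 \<omega>\<bar> \<le> B"
    and "distributed M lborel (X 1) (\<lambda>t. ennreal (g t))"
    and "\<And>t. 0 \<le> g t \<and> g t \<le> C"
    and "Lip \<alpha> f"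
    and "\<And>t. f (t + 1) = f t"
    and "(LINT t:{0..1}|lborel. f t) = 0"
    and "set_integrable lborel {0..1} (\<lambda>t. (f t)\<^sup>2)"
  shows "(\<forall>x\<in>{0<..<1}. summable (\<lambda>k. \<bar>corr M X f x (Suc k)\<bar>)) \<and>
    (AE \<omega> in M. AE x in lborel. x \<in> {0<..<1} \<longrightarrow>
      limsup (\<lambda>N. ereal ((2 * real N * ln (ln (real N))) powr (- 1 / 2) *
          (\<Sum>k=1..N. f (rand_seq X k \<omega> * x))))
        = ereal (sqrt (A_const M X f x)))"
proof -
  interpret prob_space M by fact
  have rv: "X j \<in> borel_measurable M" if "j \<ge> 1" for j
    using assms(2) that by (auto simp: indep_vars_def)
  then have [measurable]: "rand_seq X k \<in> borel_measurable M" for k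
    unfolding rand_seq_def[abs_def] by (intro borel_measurable_sum) auto
  have bf: "bdd_meas f" using assms(8,9) by (rule Lip_imp_bdd_meas)
  then have [measurable]: "f \<in> borel_measurable borel" by (rule bdd_meas_borel)
  obtain F where F: "0 \<le> F" "\<And>y. norm (f y) \<le> F" using bf by (rule bdd_meas_bound) blast
  have pf: "periodic1 f" using assms(9) by (simp add: periodic1_def)
  have cf: "circ f = 0" using assms(10) by (simp add: circ_eq_LINT)
  interpret UM: pair_prob_space unif M ..

  have fixed_x: "summable (\<lambda>k. \<bar>corr M X f x (Suc k)\<bar>) \<and>
      (AE \<omega> in M. limsup (\<lambda>N. ereal ((2 * real N * ln (ln (real N))) powr (- 1 / 2) *
          (\<Sum>k=1..N. f (rand_seq X k \<omega> * x)))) = ereal (sqrt (A_const M X f x)))"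
    if x: "x \<in> {0<..<1}" for x
  proof -
    define \<nu> where "\<nu> = distr M borel (\<lambda>\<omega>. X 1 \<omega> * x)"
    have law: "distr M borel (\<lambda>\<omega>. X j \<omega> * x) = \<nu>" if "j \<ge> 1" for j
    proof -
      have "distr M borel (\<lambda>\<omega>. X j \<omega> * x) = distr (distr M borel (X j)) borel (\<lambda>t. t * x)" if "j \<ge> 1" for j
        using rv[OF that] by (subst distr_distr) (auto simp: o_def)
      then show ?thesis using that assms(3)[OF that] by (simp add: \<nu>_def)
    qed
    have "distributed M lborel (\<lambda>\<omega>. 0 + x * X 1 \<omega>) (\<lambda>t. ennreal (g ((t - 0) / x)) / \<bar>x\<bar>)"
      using x by (intro distributed_affine assms(6)) auto
    then have dens: "\<nu> = density lborel (\<lambda>t. ennreal (g ((t - 0) / x)) / \<bar>x\<bar>)"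
      and mdens: "(\<lambda>t. ennreal (g ((t - 0) / x)) / \<bar>x\<bar>) \<in> borel_measurable borel"
      unfolding distributed_def \<nu>_def by (simp_all add: mult.commute cong: distr_cong)
    interpret W: random_walk \<nu>
      unfolding random_walk_def random_walk_axioms_def \<nu>_def
      using rv[of 1] by (auto intro!: prob_space_distr)
    interpret W: lil_walk \<nu> f
      by unfold_locales (use W.doeblin_density[OF dens mdens] bf pf cf in auto)
    define \<Phi> where "\<Phi> \<omega> = to_stream (\<lambda>i. X (Suc i) \<omega> * x)" for \<omega>
    have indep: "indep_vars (\<lambda>_. borel) (\<lambda>j \<omega>. X j \<omega> * x) {1..}"
      using assms(2) by (rule indep_vars_compose2) auto
    have \<Phi>: "\<Phi> \<in> measurable M W.paths" "distr M W.paths \<Phi> = W.paths"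
      using distr_to_stream[OF indep law] by (auto simp: \<Phi>_def[abs_def])
    have pos: "walk_pos k y (\<Phi> \<omega>) = y + rand_seq X k \<omega> * x" for k y \<omega>
      by (simp add: \<Phi>_def walk_pos_to_stream rand_seq_def sum_distrib_right sum.atLeast1_atMost_eq)
    have corr: "corr M X f x k = circ (\<lambda>u. f u * (W.step_op ^^ k) f u)" for k
    proof -
      have "norm (f u * f (u + z)) \<le> F * F" for u z
        unfolding norm_mult using F by (intro mult_mono) auto
      then have "integrable (unif \<Otimes>\<^sub>M M) (\<lambda>(u, \<omega>). f u * f (u + rand_seq X k \<omega> * x))"
        by (intro UM.P.integrable_const_bound[where B="F * F"] AE_I2) (auto split: prod.split)
      then have "corr M X f x k = (\<integral>u. (\<integral>\<omega>. f u * f (u + rand_seq X k \<omega> * x) \<partial>M) \<partial>unif)"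
        unfolding corr_def by (rule UM.integral_fst[symmetric])
      also have "\<dots> = (\<integral>u. f u * (\<integral>\<omega>. f (walk_pos k u (\<Phi> \<omega>)) \<partial>M) \<partial>unif)"
        by (simp add: pos)
      also have "\<dots> = (\<integral>u. f u * (\<integral>s. f (walk_pos k u s) \<partial>distr M W.paths \<Phi>) \<partial>unif)"
        using \<Phi>(1) by (subst integral_distr) auto
      also have "\<dots> = circ (\<lambda>u. f u * (W.step_op ^^ k) f u)"
        unfolding \<Phi>(2) W.integral_walk_pos[OF bf] circ_def ..
      finally show ?thesis .
    qed
    have A: "A_const M X f x = W.asym_var"
      unfolding A_const_def W.asym_var_def corr norm2_sq_def by (simp add: circ_eq_LINT)
    have "AE s in distr M W.paths \<Phi>. limsup (\<lambda>N. ereal ((2 * real N * ln (ln (real N))) powr (- 1 / 2) * W.S N 0 s))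
        = ereal (sqrt W.asym_var)"
      unfolding \<Phi>(2) by (rule W.lil_paths)
    from AE_distrD[OF \<Phi>(1) this]
    have "AE \<omega> in M. limsup (\<lambda>N. ereal ((2 * real N * ln (ln (real N))) powr (- 1 / 2) *
          (\<Sum>k=1..N. f (rand_seq X k \<omega> * x)))) = ereal (sqrt (A_const M X f x))"
      by (simp add: walk_sum_eq pos A)
    moreover have "summable (\<lambda>k. \<bar>corr M X f x (Suc k)\<bar>)"
      unfolding corr using W.summable_correlations by (subst summable_Suc_iff)
    ultimately show ?thesis by blast
  qed

  interpret MX: pair_sigma_finite M lborel ..
  have [measurable]: "(\<lambda>x. corr M X f x k) \<in> borel_measurable borel" for k
    unfolding corr_def by measurable
  have [measurable]: "(\<lambda>x. A_const M X f x) \<in> borel_measurable borel"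
    unfolding A_const_def by measurable
  let ?P = "\<lambda>\<omega> x. x \<in> {0<..<1} \<longrightarrow>
      limsup (\<lambda>N. ereal ((2 * real N * ln (ln (real N))) powr (- 1 / 2) *
          (\<Sum>k=1..N. f (rand_seq X k \<omega> * x)))) = ereal (sqrt (A_const M X f x))"
  have meas: "{z \<in> space (M \<Otimes>\<^sub>M lborel). ?P (fst z) (snd z)} \<in> sets (M \<Otimes>\<^sub>M lborel)"
    by measurable
  have "AE x in lborel. AE \<omega> in M. ?P \<omega> x"
  proof (rule AE_I2)
    fix x :: real
    show "AE \<omega> in M. ?P \<omega> x"
    proof (cases "x \<in> {0<..<1}")
      case True
      from fixed_x[OF True, THEN conjunct2] show ?thesis by eventually_elim simp
    qed auto
  qed
  then have "AE \<omega> in M. AE x in lborel. ?P \<omega> x"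
    by (rule MX.AE_commute[OF meas, THEN iffD2])
  moreover have "\<forall>x\<in>{0<..<1}. summable (\<lambda>k. \<bar>corr M X f x (Suc k)\<bar>)"
    by (intro ballI fixed_x[THEN conjunct1])
  ultimately show ?thesis by (intro conjI)
qed

end
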